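(* Let $P$ be a Borel probability measure on the Wasserstein space $(\mathcal{P}_2(\mathbb{R}),W_2)$ such that there exist $\mu\in\mathcal{P}_2(\mathbb{R})$ and $\lambda>0$ with $\int_{\mathcal{P}_2(\mathbb{R})}\exp(\lambda W_2^2(\mu,\nu))\,dP(\nu)<\infty$, and such that $P(\mathcal{W}_{\mathrm{ac}}(\mathbb{R}))=1$. Let $\nu_1,\nu_2,\ldots$ be IID with law $P$ on a probability space with probability measure $\mathbb{P}$, and let $\mu_n^*$ be the Wasserstein barycenter of $\nu_1,\ldots,\nu_n$. Then $\{\mu_n^*\}_{n\in\mathbb{N}}$ satisfies a large deviations principle in $(\mathcal{W}_{\mathrm{ac}}(\mathbb{R}),W_2)$ with rate function $$I_P(\mu)=\sup_{\alpha\in L^2([0,1])}\left(\langle\alpha,F_\mu^{-1}\rangle_{L^2([0,1])}-\log\int_{\mathcal{W}_{\mathrm{ac}}(\mathbb{R})}\exp\langle\alpha,F_\nu^{-1}\rangle_{L^2([0,1])}\,dP(\nu)\right),\qquad\mu\in\mathcal{W}_{\mathrm{ac}}(\mathbb{R}).$$ That is, for every Borel $E\subseteq\mathcal{W}_{\mathrm{ac}}(\mathbb{R})$, $$-\inf_{\mu\in E^\circ}I_P(\mu)\le\liminf_{n\to\infty}\frac1n\log\mathbb{P}(\mu_n^*\in E)\le\limsup_{n\to\infty}\frac1n\log\mathbb{P}(\mu_n^*\in E)\le-\inf_{\mu\in\bar E}I_P(\mu),$$ with interior and closure taken in $(\mathcal{W}_{\mathrm{ac}}(\mathbb{R}),W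_2)$.
   Context: $\mathcal{P}_2(\mathbb{R})$ is the set of Borel probability measures on $\mathbb{R}$ with finite second moment, with 2-Wasserstein metric $W_2$; $\mathcal{W}_{\mathrm{ac}}(\mathbb{R})\subseteq\mathcal{P}_2(\mathbb{R})$ is the subset of measures absolutely continuous with respect to Lebesgue measure. $F_\mu$ is the cumulative distribution function of $\mu$ and $F_\mu^{-1}$ its quantile function, an element of $L^2([0,1])$. The Wasserstein barycenter of $\nu_1,\ldots,\nu_n$ is the minimizer over $\mu\in\mathcal{P}_2(\mathbb{R})$ of $\frac1n\sum_{i=1}^nW_2^2(\mu,\nu_i)$. *)

theory Defs
  imports "HOL-Probability.Probability"
begin

definition P2 :: "real measure set" where
  "P2 = {\<mu>. real_distribution \<mu> \<and> integrable \<mu> (\<lambda>x. x\<^sup>2)}"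

definition Wac :: "real measure set" where
  "Wac = {\<mu> \<in> P2. absolutely_continuous lborel \<mu>}"

definition couplings :: "real measure \<Rightarrow> real measure \<Rightarrow> (real \<times> real) measure set" where
  "couplings \<mu> \<nu> = {\<pi>. sets \<pi> = sets (borel \<Otimes>\<^sub>M borel) \<and>
                         distr \<pi> borel fst = \<mu> \<and> distr \<pi> borel snd = \<nu>}"

text \<open>The infimum is finite whenever both arguments lie in \<^const>\<open>P2\<close>, so \<^const>\<open>enn2real\<close> loses
  nothing there.\<close>

definition W2 :: "real measure \<Rightarrow> real measure \<Rightarrow> real" where
  "W2 \<mu> \<nu> = sqrt (enn2real
     (INF \<pi> \<in> couplings \<mu> \<nu>. \<integral>\<^sup>+z. ennreal ((fst z - snd z)\<^sup>2) \<partial>\<pi>))"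

definition P2_topology :: "real measure topology" where
  "P2_topology = Metric_space.mtopology P2 W2"

definition Wac_topology :: "real measure topology" where
  "Wac_topology = Metric_space.mtopology Wac W2"

definition borel_of :: "'a topology \<Rightarrow> 'a measure" where
  "borel_of X = sigma (topspace X) {U. openin X U}"

definition is_barycenter :: "nat \<Rightarrow> (nat \<Rightarrow> real measure) \<Rightarrow> real measure \<Rightarrow> bool" where
  "is_barycenter n \<nu> \<mu> \<longleftrightarrow> \<mu> \<in> P2 \<and>
     (\<forall>\<rho> \<in> P2. 1 / real n * (\<Sum>i = 1..n. (W2 \<mu> (\<nu> i))\<^sup>2)
             \<le> 1 / real n * (\<Sum>i = 1..n. (W2 \<rho> (\<nu> i))\<^sup>2))"

definition barycenter :: "nat \<Rightarrow> (nat \<Rightarrow> real measure) \<Rightarrow> real measure" where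
  "barycenter n \<nu> = (THE \<mu>. is_barycenter n \<nu> \<mu>)"

text \<open>Only the values on the open unit interval are meaningful: at the endpoints the infimum may
  be taken over an empty or unbounded set, which does not affect integrals.\<close>

definition quantile :: "real measure \<Rightarrow> real \<Rightarrow> real" where
  "quantile \<mu> u = Inf {x. u \<le> cdf \<mu> x}"

definition L2_unit :: "(real \<Rightarrow> real) set" where
  "L2_unit = {\<alpha>. set_borel_measurable lborel {0..1} \<alpha> \<and>
                 set_integrable lborel {0..1} (\<lambda>u. (\<alpha> u)\<^sup>2)}"

definition inner_L2 :: "(real \<Rightarrow> real) \<Rightarrow> (real \<Rightarrow> real) \<Rightarrow> real" where
  "inner_L2 \<alpha> \<beta> = (LINT u:{0..1}|lborel. \<alpha> u * \<beta> u)"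

definition elog :: "ennreal \<Rightarrow> ereal" where
  "elog x = (if x = 0 then -\<infinity> else if x = \<infinity> then \<infinity> else ereal (ln (enn2real x)))"

definition rate_function :: "'a topology \<Rightarrow> ('a \<Rightarrow> ereal) \<Rightarrow> bool" where
  "rate_function X I \<longleftrightarrow> (\<forall>x \<in> topspace X. 0 \<le> I x) \<and>
     (\<forall>c::real. closedin X {x \<in> topspace X. I x \<le> ereal c})"

definition satisfies_LDP ::
  "'w measure \<Rightarrow> 'a topology \<Rightarrow> (nat \<Rightarrow> 'w \<Rightarrow> 'a) \<Rightarrow> ('a \<Rightarrow> ereal) \<Rightarrow> bool" where
  "satisfies_LDP M X Z I \<longleftrightarrow> rate_function X I \<and>
     (\<forall>E \<in> sets (borel_of X).
        - (INF x \<in> X interior_of E. I x)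
          \<le> liminf (\<lambda>n. ereal (1 / real n) * elog (emeasure M {\<omega> \<in> space M. Z n \<omega> \<in> E})) \<and>
        liminf (\<lambda>n. ereal (1 / real n) * elog (emeasure M {\<omega> \<in> space M. Z n \<omega> \<in> E}))
          \<le> limsup (\<lambda>n. ereal (1 / real n) * elog (emeasure M {\<omega> \<in> space M. Z n \<omega> \<in> E})) \<and>
        limsup (\<lambda>n. ereal (1 / real n) * elog (emeasure M {\<omega> \<in> space M. Z n \<omega> \<in> E}))
          \<le> - (INF x \<in> X closure_of E. I x))"

definition I_rate :: "real measure measure \<Rightarrow> real measure \<Rightarrow> ereal" where
  "I_rate P \<mu> = (SUP \<alpha> \<in> L2_unit. ereal (inner_L2 \<alpha> (quantile \<mu>)) -
     elog (\<integral>\<^sup>+\<nu>\<in>Wac. ennreal (exp (inner_L2 \<alpha> (quantile \<nu>))) \<partial>P))"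

end

theory Submission
  imports Defs
begin

text \<open>On the line, \<open>\<mu> \<mapsto> F\<^sub>\<mu>\<^sup>-\<^sup>1\<close> is an isometry of \<^const>\<open>P2\<close> into \<open>L\<^sup>2(0, 1)\<close> and the barycenter has
  the mean of the quantile functions as its quantile function, so the claim is an instance of
  Cramer's theorem for means of random vectors in \<open>L\<^sup>2\<close>, restricted to \<^const>\<open>Wac\<close>.

  By Helly's theorem, uniform smallness of the \<open>L\<^sup>2\<close> norms of quantile functions near the endpoints
  gives compactness, and the exponential moments make the law of the barycenter exponentially tight
  for such compact sets. Compactness then yields both bounds: the upper one from finitely many
  half-spaces and the Chernoff inequality, the lower one from finitely many functionals, for which
  the measure is tilted. The subset \<^const>\<open>Wac\<close> carries all barycenters, but it is not closed;
  what saves the upper bound is that the rate function is infinite outside of it. If \<open>\<mu>\<close> charges a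
  Lebesgue null set, cover that set by intervals of small total length: the corresponding increments
  of \<open>F\<^sub>\<mu>\<^sup>-\<^sup>1\<close> are small in total, whereas those of an absolutely continuous measure
  are bounded away from zero.\<close>

section \<open>Square-integrable functions\<close>

text \<open>Compactness is available in \<open>P2\<close> only, so the covering argument for the
  upper bound works with the closure of the event in \<open>P2\<close>. Its points outside
  \<open>Wac\<close> must be separated as well, whence the study of the rate there. The increments
  of an absolutely continuous measure are bounded away from zero, but not uniformly over the support
  of the law; an infimum over countably many test functionals, positive almost surely, is fed into
  dominated convergence instead.

  For the lower bound, the Legendre supremum over finitely many functionals need not be attained:
  the functionals may be degenerate under the law, or the target may lie on the boundary of the
  support. A small quadratic penalty yields a minimiser in every case; the tilted mean then misses
  the target by an amount that vanishes with the penalty.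

  The moment hypothesis enters as finiteness of every exponential moment of the norm, so the
  cumulant function is real on all of L2. Elements of L2 are functions, not classes; left-continuity
  selects the representative of a quantile function.\<close>

definition L2 :: "'a measure \<Rightarrow> ('a \<Rightarrow> real) set" where
  "L2 N = {f \<in> borel_measurable N. integrable N (\<lambda>x. (f x)\<^sup>2)}"

definition L2_norm :: "'a measure \<Rightarrow> ('a \<Rightarrow> real) \<Rightarrow> real" where
  "L2_norm N f = sqrt (\<integral>x. (f x)\<^sup>2 \<partial>N)"

lemma L2_measurable: "f \<in> L2 N \<Longrightarrow> f \<in> borel_measurable N"
  by (simp add: L2_def)

lemma L2_norm_nonneg [simp]: "0 \<le> L2_norm N f"
  by (simp add: L2_norm_def)

lemma L2_norm_power2: "(L2_norm N f)\<^sup>2 = (\<integral>x. (f x)\<^sup>2 \<partial>N)"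
  by (simp add: L2_norm_def)

lemma L2_mult_integrable:
  assumes "f \<in> L2 N" "g \<in> L2 N"
  shows "integrable N (\<lambda>x. f x * g x)"
proof (rule Bochner_Integration.integrable_bound)
  show "integrable N (\<lambda>x. (f x)\<^sup>2 + (g x)\<^sup>2)"
    using assms by (auto simp: L2_def)
  show "(\<lambda>x. f x * g x) \<in> borel_measurable N"
    using assms by (auto simp: L2_def)
  have "norm (a * b) \<le> norm (a\<^sup>2 + b\<^sup>2)" for a b :: real
  proof -
    have "2 * (\<bar>a\<bar> * \<bar>b\<bar>) \<le> a\<^sup>2 + b\<^sup>2"
      using zero_le_power2[of "\<bar>a\<bar> - \<bar>b\<bar>"] by (simp add: power2_diff)
    moreover have "0 \<le> \<bar>a\<bar> * \<bar>b\<bar>" by simp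
    ultimately show ?thesis by (simp only: real_norm_def abs_mult)
  qed
  then show "AE x in N. norm (f x * g x) \<le> norm ((f x)\<^sup>2 + (g x)\<^sup>2)" by simp
qed

lemma L2_add:
  assumes "f \<in> L2 N" "g \<in> L2 N"
  shows "(\<lambda>x. f x + g x) \<in> L2 N"
proof -
  have "integrable N (\<lambda>x. (f x)\<^sup>2 + (g x)\<^sup>2 + 2 * (f x * g x))"
    using assms L2_mult_integrable[OF assms] by (auto simp: L2_def)
  then show ?thesis using assms by (auto simp: L2_def power2_sum mult.assoc)
qed

lemma L2_cmult:
  assumes "f \<in> L2 N"
  shows "(\<lambda>x. c * f x) \<in> L2 N"
  using assms by (auto simp: L2_def power_mult_distrib)

lemma L2_diff:
  assumes "f \<in> L2 N" "g \<in> L2 N"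
  shows "(\<lambda>x. f x - g x) \<in> L2 N"
  using L2_add[OF assms(1) L2_cmult[OF assms(2), of "-1"]] by simp

lemma L2_sum:
  assumes "\<And>i. i \<in> I \<Longrightarrow> f i \<in> L2 N"
  shows "(\<lambda>x. \<Sum>i\<in>I. f i x) \<in> L2 N"
  using assms
proof (induction I rule: infinite_finite_induct)
  case (insert i I)
  then show ?case using L2_add[of "f i" N "\<lambda>x. \<Sum>i\<in>I. f i x"] by simp
qed (auto simp: L2_def)

lemma L2_bounded_mult:
  fixes C :: real
  assumes "f \<in> L2 N" "h \<in> borel_measurable N" "\<And>x. \<bar>h x\<bar> \<le> C"
  shows "(\<lambda>x. h x * f x) \<in> L2 N"
proof -
  have "integrable N (\<lambda>x. (h x * f x)\<^sup>2)"
  proof (rule Bochner_Integration.integrable_bound)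
    show "integrable N (\<lambda>x. C\<^sup>2 * (f x)\<^sup>2)" using assms by (auto simp: L2_def)
    have "(h x)\<^sup>2 \<le> C\<^sup>2" for x
      using assms(3)[of x] by (metis abs_ge_zero power2_abs power_mono)
    then show "AE x in N. norm ((h x * f x)\<^sup>2) \<le> norm (C\<^sup>2 * (f x)\<^sup>2)"
      by (auto simp: power_mult_distrib intro!: mult_right_mono)
  qed (use assms in \<open>auto simp: L2_def\<close>)
  then show ?thesis using assms by (auto simp: L2_def)
qed

lemma L2_norm_diff_power2:
  assumes "f \<in> L2 N" "g \<in> L2 N"
  shows "(L2_norm N (\<lambda>x. f x - g x))\<^sup>2
    = (L2_norm N f)\<^sup>2 + (L2_norm N g)\<^sup>2 - 2 * (\<integral>x. f x * g x \<partial>N)"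
proof -
  have "(\<integral>x. (f x - g x)\<^sup>2 \<partial>N) = (\<integral>x. (f x)\<^sup>2 + (g x)\<^sup>2 - 2 * (f x * g x) \<partial>N)"
    by (simp add: power2_diff mult.assoc)
  also have "\<dots> = (\<integral>x. (f x)\<^sup>2 \<partial>N) + (\<integral>x. (g x)\<^sup>2 \<partial>N) - 2 * (\<integral>x. f x * g x \<partial>N)"
    using assms L2_mult_integrable[OF assms] by (auto simp: L2_def)
  finally show ?thesis by (simp add: L2_norm_power2)
qed

lemma L2_norm_cmult: "L2_norm N (\<lambda>x. c * f x) = \<bar>c\<bar> * L2_norm N f"
  by (simp add: L2_norm_def power_mult_distrib real_sqrt_mult)

lemma L2_Cauchy_Schwarz:
  assumes "f \<in> L2 N" "g \<in> L2 N"
  shows "\<bar>\<integral>x. f x * g x \<partial>N\<bar> \<le> L2_norm N f * L2_norm N g"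
proof -
  let ?p = "\<integral>x. f x * g x \<partial>N" and ?a = "L2_norm N f" and ?b = "L2_norm N g"
  have quad: "0 \<le> s\<^sup>2 * ?a\<^sup>2 + t\<^sup>2 * ?b\<^sup>2 - 2 * (s * t * ?p)" for s t
  proof -
    have "0 \<le> (L2_norm N (\<lambda>x. s * f x - t * g x))\<^sup>2" by simp
    also have "\<dots> = s\<^sup>2 * ?a\<^sup>2 + t\<^sup>2 * ?b\<^sup>2 - 2 * (\<integral>x. (s * t) * (f x * g x) \<partial>N)"
      by (subst L2_norm_diff_power2[OF L2_cmult[OF assms(1)] L2_cmult[OF assms(2)]])
        (simp add: L2_norm_cmult power_mult_distrib mult_ac)
    finally show ?thesis by simp
  qed
  have sq: "?p\<^sup>2 \<le> ?a\<^sup>2 * ?b\<^sup>2"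
  proof (cases "?b = 0")
    case True
    have "?p = 0"
    proof (rule ccontr)
      assume "?p \<noteq> 0"
      \<comment> \<open>With \<open>?b = 0\<close> the form is affine in \<open>t\<close>; this
        \<open>t\<close> makes its value \<open>-1\<close>.\<close>
      then show False using quad[of 1 "(?a\<^sup>2 + 1) / (2 * ?p)"] True by (auto simp: field_simps)
    qed
    then show ?thesis by simp
  next
    case False
    \<comment> \<open>The minimising ratio of \<open>t\<close> to \<open>s\<close> is
      \<open>?p\<close> to \<open>?b\<^sup>2\<close>; these weights realise it without a
      division.\<close>
    have "0 \<le> (?b\<^sup>2)\<^sup>2 * ?a\<^sup>2 + ?p\<^sup>2 * ?b\<^sup>2 - 2 * (?b\<^sup>2 * ?p * ?p)" by (rule quad)
    then have "0 \<le> ?b\<^sup>2 * (?a\<^sup>2 * ?b\<^sup>2 - ?p\<^sup>2)" by (simp add: algebra_simps power2_eq_square)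
    then show ?thesis using False by (simp add: zero_le_mult_iff)
  qed
  then have "\<bar>?p\<bar>\<^sup>2 \<le> (?a * ?b)\<^sup>2" by (simp add: power_mult_distrib)
  then show ?thesis by (rule power2_le_imp_le) simp
qed

lemma L2_norm_triangle:
  assumes "f \<in> L2 N" "g \<in> L2 N"
  shows "L2_norm N (\<lambda>x. f x + g x) \<le> L2_norm N f + L2_norm N g"
proof (rule power2_le_imp_le)
  have "(L2_norm N (\<lambda>x. f x + g x))\<^sup>2
      = (L2_norm N f)\<^sup>2 + (L2_norm N g)\<^sup>2 + 2 * (\<integral>x. f x * g x \<partial>N)"
    using L2_norm_diff_power2[OF assms(1) L2_cmult[OF assms(2), of "-1"]]
      L2_norm_cmult[of N "-1" g] by simp
  also have "\<dots> \<le> (L2_norm N f + L2_norm N g)\<^sup>2"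
    using L2_Cauchy_Schwarz[OF assms] by (simp add: power2_sum)
  finally show "(L2_norm N (\<lambda>x. f x + g x))\<^sup>2 \<le> (L2_norm N f + L2_norm N g)\<^sup>2" .
qed simp

lemma L2_norm_triangle_diff:
  assumes "f \<in> L2 N" "g \<in> L2 N" "h \<in> L2 N"
  shows "L2_norm N (\<lambda>x. f x - h x) \<le> L2_norm N (\<lambda>x. f x - g x) + L2_norm N (\<lambda>x. g x - h x)"
  using L2_norm_triangle[OF L2_diff[OF assms(1,2)] L2_diff[OF assms(2,3)]] by simp

lemma L2_norm_diff_abs:
  assumes "f \<in> L2 N" "g \<in> L2 N"
  shows "\<bar>L2_norm N f - L2_norm N g\<bar> \<le> L2_norm N (\<lambda>x. f x - g x)"
proof -
  have "L2_norm N (\<lambda>x. g x - f x) = L2_norm N (\<lambda>x. f x - g x)"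
    by (simp add: L2_norm_def power2_commute)
  then show ?thesis
    using L2_norm_triangle[OF L2_diff[OF assms] assms(2)]
      L2_norm_triangle[OF L2_diff[OF assms(2,1)] assms(1)] by simp
qed

lemma L2_norm_sum_le:
  assumes "\<And>i. i \<in> I \<Longrightarrow> f i \<in> L2 N"
  shows "L2_norm N (\<lambda>x. \<Sum>i\<in>I. f i x) \<le> (\<Sum>i\<in>I. L2_norm N (f i))"
  using assms
proof (induction I rule: infinite_finite_induct)
  case (insert i I)
  then show ?case
    using L2_norm_triangle[of "f i" N "\<lambda>x. \<Sum>i\<in>I. f i x"] L2_sum[of I f N] by auto
qed (auto simp: L2_norm_def)

lemma L2_norm_mono:
  assumes "g \<in> L2 N" "f \<in> borel_measurable N" "AE x in N. \<bar>f x\<bar> \<le> \<bar>g x\<bar>"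
  shows "L2_norm N f \<le> L2_norm N g"
  unfolding L2_norm_def
  by (intro real_sqrt_le_mono integral_mono_AE')
    (use assms in \<open>auto simp: L2_def abs_le_square_iff\<close>)

lemma L2_norm_eq_0D:
  assumes "f \<in> L2 N" "L2_norm N f = 0"
  shows "AE x in N. f x = 0"
  using assms integral_nonneg_eq_0_iff_AE[of N "\<lambda>x. (f x)\<^sup>2"] by (auto simp: L2_norm_def L2_def)

section \<open>Quantile functions\<close>

text \<open>The open interval is chosen because \<open>quantile\<close> is meaningful exactly there:
  monotonicity and pointwise identities then hold on the whole space. The closed interval in
  \<open>L2_unit\<close> and \<open>inner_L2\<close> differs from it by a null set.\<close>

definition UI :: "real measure" where
  "UI = restrict_space lborel {0<..<1}"

lemma space_UI [simp]: "space UI = {0<..<1}"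
  by (simp add: UI_def space_restrict_space)

lemma emeasure_UI: "A \<in> sets borel \<Longrightarrow> A \<subseteq> {0<..<1} \<Longrightarrow> emeasure UI A = emeasure lborel A"
  by (simp add: UI_def emeasure_restrict_space)

lemma sets_UI_iff: "A \<in> sets UI \<longleftrightarrow> A \<in> sets borel \<and> A \<subseteq> {0<..<1}"
  by (auto simp: UI_def sets_restrict_space_iff)

interpretation UI: prob_space UI
  by standard (simp add: emeasure_UI)

lemma measurable_UI_borel: "f \<in> borel_measurable borel \<Longrightarrow> f \<in> borel_measurable UI"
  unfolding UI_def by (intro measurable_restrict_space1) simp

lemma mono_on_measurable_UI: "mono_on {0<..<1} g \<Longrightarrow> g \<in> borel_measurable UI" for g :: "real \<Rightarrow> real"
proof -
  assume "mono_on {0<..<1} g"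
  then have "g \<in> borel_measurable (restrict_space borel {0<..<1})"
    by (rule borel_measurable_mono_on_fnc)
  moreover have "sets UI = sets (restrict_space borel {0<..<1})"
    by (auto simp: UI_def sets_restrict_space)
  ultimately show ?thesis by (simp cong: measurable_cong_sets)
qed

lemma L2_unit_eq: "L2_unit = L2 UI"
proof -
  have X: "countable {0, 1::real}" "\<And>x. x \<in> {0, 1::real} \<Longrightarrow> {x} \<in> sets lborel"
    "\<And>x. x \<in> {0, 1::real} \<Longrightarrow> emeasure lborel {x} = 0" by auto
  have meas: "set_borel_measurable lborel {0..1} \<alpha> \<longleftrightarrow> \<alpha> \<in> borel_measurable UI" for \<alpha> :: "real \<Rightarrow> real"
  proof -
    have "(\<lambda>x. indicator {0..1} x *\<^sub>R \<alpha> x) \<in> borel_measurable lborel \<longleftrightarrow>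
        (\<lambda>x. indicator {0<..<1} x *\<^sub>R \<alpha> x) \<in> borel_measurable lborel"
      by (intro iffI; erule measurable_discrete_difference[OF _ X(1)])
        (auto simp: indicator_def)
    then show ?thesis
      by (simp add: set_borel_measurable_def UI_def borel_measurable_restrict_space_iff mult.commute)
  qed
  have int: "set_integrable lborel {0..1} f \<longleftrightarrow> integrable UI f" for f :: "real \<Rightarrow> real"
  proof -
    have "integrable lborel (\<lambda>x. indicator {0..1} x *\<^sub>R f x) \<longleftrightarrow>
        integrable lborel (\<lambda>x. indicator {0<..<1} x *\<^sub>R f x)"
      by (rule integrable_discrete_difference[OF X(1,3,2)]) (auto simp: indicator_def)
    then show ?thesis by (simp add: set_integrable_def UI_def integrable_restrict_space)
  qed
  show ?thesis by (auto simp: L2_unit_def L2_def meas int)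
qed

lemma inner_L2_eq: "inner_L2 \<alpha> \<beta> = (\<integral>u. \<alpha> u * \<beta> u \<partial>UI)"
proof -
  have "inner_L2 \<alpha> \<beta> = (\<integral>x. indicator {0<..<1} x *\<^sub>R (\<alpha> x * \<beta> x) \<partial>lborel)"
    unfolding inner_L2_def set_lebesgue_integral_def
    by (rule integral_discrete_difference[of "{0,1}"]) (auto simp: indicator_def)
  then show ?thesis by (simp add: UI_def integral_restrict_space)
qed

text \<open>The Galois connection between cdf and quantile function. It turns events about quantiles
  into intervals of levels \<open>u\<close>, whose measure is a difference of cdf values.\<close>

lemma quantile_le_iff:
  assumes "real_distribution \<mu>" "0 < u" "u < 1"
  shows "quantile \<mu> u \<le> x \<longleftrightarrow> u \<le> cdf \<mu> x"
proof -
  interpret cdf_distribution \<mu> unfolding cdf_distribution_def by fact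
  show ?thesis using pseudoinverse[of u x] assms by (simp add: quantile_def)
qed

lemma quantile_mono_on:
  assumes "real_distribution \<mu>"
  shows "mono_on {0<..<1} (quantile \<mu>)"
proof -
  interpret cdf_distribution \<mu> unfolding cdf_distribution_def by fact
  show ?thesis using mono_I unfolding quantile_def .
qed

lemma quantile_measurable: "real_distribution \<mu> \<Longrightarrow> quantile \<mu> \<in> borel_measurable UI"
  by (intro mono_on_measurable_UI quantile_mono_on)

lemma distr_quantile:
  assumes "real_distribution \<mu>"
  shows "distr UI borel (quantile \<mu>) = \<mu>"
proof -
  interpret cdf_distribution \<mu> unfolding cdf_distribution_def by fact
  show ?thesis using distr_I_eq_M unfolding quantile_def UI_def .
qed

text \<open>These are precisely the functions that are the quantile function of some law, at every
  point of the open interval and not just almost everywhere. The property is stable under finite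
  averages, which is how the barycenter is identified.\<close>

definition quantile_like :: "(real \<Rightarrow> real) \<Rightarrow> bool" where
  "quantile_like g \<longleftrightarrow> mono_on {0<..<1} g \<and> (\<forall>u\<in>{0<..<1}. continuous (at_left u) g)"

lemma quantile_like_quantile:
  assumes "real_distribution \<mu>"
  shows "quantile_like (quantile \<mu>)"
proof -
  note mono = quantile_mono_on[OF assms]
  have "(quantile \<mu> \<longlongrightarrow> quantile \<mu> u) (at_left u)" if u: "u \<in> {0<..<1}" for u
  proof (rule order_tendstoI)
    fix a assume "a < quantile \<mu> u"
    then have "cdf \<mu> a < u" using quantile_le_iff[OF assms, of u a] u by auto
    moreover have "a < quantile \<mu> v" if "max 0 (cdf \<mu> a) < v" "v < u" for v
      using quantile_le_iff[OF assms, of v a] that u by auto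
    ultimately show "\<forall>\<^sub>F v in at_left u. a < quantile \<mu> v"
      using u unfolding eventually_at_left_field by (intro exI[of _ "max 0 (cdf \<mu> a)"]) auto
  next
    fix a assume "quantile \<mu> u < a"
    moreover have "quantile \<mu> v \<le> quantile \<mu> u" if "0 < v" "v < u" for v
      using mono_onD[OF mono, of v u] that u by auto
    ultimately show "\<forall>\<^sub>F v in at_left u. quantile \<mu> v < a"
      using u unfolding eventually_at_left_field by (intro exI[of _ 0]) force
  qed
  then show ?thesis using mono by (simp add: quantile_like_def continuous_within)
qed

lemma real_distribution_distr_UI:
  assumes "g \<in> borel_measurable UI"
  shows "real_distribution (distr UI borel g)"
  by (intro real_distribution.intro UI.prob_space_distr real_distribution_axioms.intro)
    (use assms in auto)

lemma quantile_distr_UI: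
  assumes g: "quantile_like g" and u: "u \<in> {0<..<1}"
  shows "quantile (distr UI borel g) u = g u"
proof -
  have mono: "mono_on {0<..<1} g" and left: "(g \<longlongrightarrow> g u) (at_left u)"
    using assms by (auto simp: quantile_like_def continuous_within)
  have [measurable]: "g \<in> borel_measurable UI" by (rule mono_on_measurable_UI[OF mono])
  note rd = real_distribution_distr_UI[OF this]
  have cdf: "cdf (distr UI borel g) x = measure UI {v\<in>{0<..<1}. g v \<le> x}" for x
    by (auto simp: cdf_def measure_distr intro!: arg_cong[where f="measure UI"])
  have S: "{v\<in>{0<..<1}. g v \<le> x} \<in> sets UI" for x
  proof -
    have "{v\<in>space UI. g v \<le> x} \<in> sets UI" by measurable
    then show ?thesis by simp
  qed
  have "quantile (distr UI borel g) u \<le> x \<longleftrightarrow> g u \<le> x" for x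
  proof -
    have "u \<le> measure UI {v\<in>{0<..<1}. g v \<le> x} \<longleftrightarrow> g u \<le> x"
    proof
      assume "g u \<le> x"
      then have "{0<..u} \<subseteq> {v\<in>{0<..<1}. g v \<le> x}"
        using mono_onD[OF mono, of _ u] u by force
      then have "measure UI {0<..u} \<le> measure UI {v\<in>{0<..<1}. g v \<le> x}"
        by (intro UI.finite_measure_mono S)
      moreover have "measure UI {0<..u} = u"
        using u by (simp add: measure_def emeasure_UI subset_eq)
      ultimately show "u \<le> measure UI {v\<in>{0<..<1}. g v \<le> x}" by simp
    next
      assume le: "u \<le> measure UI {v\<in>{0<..<1}. g v \<le> x}"
      have "g v \<le> x" if v: "0 < v" "v < u" for v
      proof (rule ccontr)
        assume nv: "\<not> g v \<le> x"
        have "{w\<in>{0<..<1}. g w \<le> x} \<subseteq> {0<..v}"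
        proof
          fix w assume "w \<in> {w\<in>{0<..<1}. g w \<le> x}"
          then show "w \<in> {0<..v}"
            using mono_onD[OF mono, of v w] v u nv by (cases "w \<le> v") auto
        qed
        then have "measure UI {w\<in>{0<..<1}. g w \<le> x} \<le> measure UI {0<..v}"
          using v u by (intro UI.finite_measure_mono) (auto simp: sets_UI_iff)
        also have "\<dots> = v" using v u by (simp add: measure_def emeasure_UI subset_eq)
        finally show False using le v by simp
      qed
      then have "\<forall>\<^sub>F v in at_left u. g v \<le> x"
        using u unfolding eventually_at_left_field by (intro exI[of _ 0]) auto
      \<comment> \<open>A sublevel set of length at least \<open>u\<close> contains every
        \<open>v < u\<close>, but perhaps not \<open>u\<close>; left-continuity closes this
        gap.\<close>
      then show "g u \<le> x" using left by (intro tendsto_upperbound[OF left]) auto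
    qed
    then show ?thesis using quantile_le_iff[OF rd, of u x] u by (simp add: cdf)
  qed
  then show ?thesis by (meson order_antisym order_refl)
qed

lemma real_distribution_P2: "\<mu> \<in> P2 \<Longrightarrow> real_distribution \<mu>"
  by (simp add: P2_def)

lemma distr_UI_P2_iff:
  assumes "g \<in> borel_measurable UI"
  shows "distr UI borel g \<in> P2 \<longleftrightarrow> g \<in> L2 UI"
  using assms real_distribution_distr_UI[OF assms]
  by (simp add: P2_def L2_def integrable_distr_eq)

lemma quantile_L2:
  assumes "\<mu> \<in> P2"
  shows "quantile \<mu> \<in> L2 UI"
  using assms distr_UI_P2_iff[OF quantile_measurable[OF real_distribution_P2[OF assms]]]
  by (simp add: distr_quantile real_distribution_P2)

lemma quantile_AE_unique:
  assumes "real_distribution \<mu>" "real_distribution \<nu>" "AE u in UI. quantile \<mu> u = quantile \<nu> u"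
  shows "\<mu> = \<nu>"
proof -
  have "distr UI borel (quantile \<mu>) = distr UI borel (quantile \<nu>)"
    using assms by (intro distr_cong_AE) (auto intro: quantile_measurable)
  then show ?thesis using assms by (simp add: distr_quantile)
qed

section \<open>The Wasserstein distance on the line\<close>

text \<open>The square \<open>[a, b)\<^sup>2\<close> has area \<open>(a - b)\<^sup>2\<close>; after Tonelli, the quadratic cost of a coupling becomes
  an integral of probabilities of quadrants, each of which the comonotone coupling minimises.\<close>

definition quadrant :: "real \<times> real \<Rightarrow> real \<times> real \<Rightarrow> ennreal" where
  "quadrant z p = indicator {q. fst q \<le> min (fst p) (snd p) \<and> max (fst p) (snd p) < snd q} z
     + indicator {q. snd q \<le> min (fst p) (snd p) \<and> max (fst p) (snd p) < fst q} z"

lemma nn_integral_quadrant: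
  "ennreal ((fst z - snd z)\<^sup>2) = (\<integral>\<^sup>+p. quadrant z p \<partial>(lborel \<Otimes>\<^sub>M lborel))"
proof -
  have sq: "(\<integral>\<^sup>+p. indicator ({a..<b} \<times> {a..<b}) p \<partial>(lborel \<Otimes>\<^sub>M lborel)) = ennreal (b - a) * ennreal (b - a)"
    for a b :: real
  proof -
    have "emeasure lborel {a..<b} = ennreal (b - a)"
      by (cases "a \<le> b") (auto simp: ennreal_neg)
    then show ?thesis by (simp add: lborel.emeasure_pair_measure_Times del: emeasure_lborel_Ico)
  qed
  have "quadrant z p = indicator ({fst z..<snd z} \<times> {fst z..<snd z}) p
      + indicator ({snd z..<fst z} \<times> {snd z..<fst z}) p" for p
    by (cases p) (auto simp: quadrant_def indicator_def)
  then have "(\<integral>\<^sup>+p. quadrant z p \<partial>(lborel \<Otimes>\<^sub>M lborel)) =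
      ennreal (snd z - fst z) * ennreal (snd z - fst z) + ennreal (fst z - snd z) * ennreal (fst z - snd z)"
    by (simp add: sq nn_integral_add)
  also have "\<dots> = ennreal ((fst z - snd z)\<^sup>2)"
    by (cases "fst z \<le> snd z")
      (auto simp: ennreal_neg ennreal_mult[symmetric] power2_eq_square algebra_simps)
  finally show ?thesis by simp
qed

lemma quadrant_measurable:
  assumes "sets \<pi> = sets (borel \<Otimes>\<^sub>M borel)"
  shows "(\<lambda>(z, p). quadrant z p) \<in> borel_measurable (\<pi> \<Otimes>\<^sub>M (lborel \<Otimes>\<^sub>M lborel))"
proof -
  note [measurable_cong] = assms
  show ?thesis unfolding quadrant_def by measurable
qed

lemma coupling_prob_space:
  assumes "real_distribution \<mu>" "\<pi> \<in> couplings \<mu> \<nu>"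
  shows "prob_space \<pi>"
proof -
  interpret real_distribution \<mu> by fact
  have s: "sets \<pi> = sets (borel \<Otimes>\<^sub>M borel)" and d: "distr \<pi> borel fst = \<mu>"
    using assms by (auto simp: couplings_def)
  have f: "fst \<in> measurable \<pi> borel" using s by (simp cong: measurable_cong_sets)
  have "emeasure \<pi> (space \<pi>) = emeasure (distr \<pi> borel fst) UNIV"
    using f by (simp add: emeasure_distr)
  then show ?thesis using d emeasure_space_1 by (intro prob_spaceI) simp
qed

lemma coupling_cost:
  assumes "real_distribution \<mu>" "\<pi> \<in> couplings \<mu> \<nu>"
  shows "(\<integral>\<^sup>+z. ennreal ((fst z - snd z)\<^sup>2) \<partial>\<pi>) =
    (\<integral>\<^sup>+p. emeasure \<pi> {z. fst z \<le> min (fst p) (snd p) \<and> max (fst p) (snd p) < snd z}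
        + emeasure \<pi> {z. snd z \<le> min (fst p) (snd p) \<and> max (fst p) (snd p) < fst z}
       \<partial>(lborel \<Otimes>\<^sub>M lborel))"
proof -
  have s: "sets \<pi> = sets (borel \<Otimes>\<^sub>M borel)" using assms by (simp add: couplings_def)
  note [measurable_cong] = s
  have sp: "space \<pi> = UNIV" using sets_eq_imp_space_eq[OF s] by (simp add: space_pair_measure)
  interpret \<pi>: prob_space \<pi> by (rule coupling_prob_space[OF assms])
  interpret L: pair_sigma_finite lborel "lborel :: real measure" ..
  interpret ps: pair_sigma_finite \<pi> "lborel \<Otimes>\<^sub>M (lborel :: real measure)"
    by (intro pair_sigma_finite.intro) (unfold_locales)
  have "(\<integral>\<^sup>+z. ennreal ((fst z - snd z)\<^sup>2) \<partial>\<pi>)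
      = (\<integral>\<^sup>+z. (\<integral>\<^sup>+p. quadrant z p \<partial>(lborel \<Otimes>\<^sub>M lborel)) \<partial>\<pi>)"
    by (simp add: nn_integral_quadrant)
  also have "\<dots> = (\<integral>\<^sup>+p. (\<integral>\<^sup>+z. quadrant z p \<partial>\<pi>) \<partial>(lborel \<Otimes>\<^sub>M lborel))"
    by (rule ps.Fubini'[symmetric]) (rule quadrant_measurable[OF s])
  also have "\<dots> = (\<integral>\<^sup>+p. emeasure \<pi> {z. fst z \<le> min (fst p) (snd p) \<and> max (fst p) (snd p) < snd z}
        + emeasure \<pi> {z. snd z \<le> min (fst p) (snd p) \<and> max (fst p) (snd p) < fst z}
       \<partial>(lborel \<Otimes>\<^sub>M lborel))"
  proof (intro nn_integral_cong)
    fix p :: "real \<times> real"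
    have "{z \<in> space \<pi>. fst z \<le> min (fst p) (snd p) \<and> max (fst p) (snd p) < snd z} \<in> sets \<pi>"
      "{z \<in> space \<pi>. snd z \<le> min (fst p) (snd p) \<and> max (fst p) (snd p) < fst z} \<in> sets \<pi>"
      by measurable
    then show "(\<integral>\<^sup>+z. quadrant z p \<partial>\<pi>) = emeasure \<pi> {z. fst z \<le> min (fst p) (snd p) \<and> max (fst p) (snd p) < snd z}
        + emeasure \<pi> {z. snd z \<le> min (fst p) (snd p) \<and> max (fst p) (snd p) < fst z}"
      by (simp add: quadrant_def nn_integral_add sp)
  qed
  finally show ?thesis .
qed

text \<open>A Frechet bound: \<open>f \<le> s\<close> is contained in the union of the quadrant and
  \<open>g \<le> t\<close>. The functions \<open>f\<close> and \<open>g\<close> are left general so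
  that the bound serves both orders of the two projections.\<close>

lemma coupling_quadrant_ge:
  fixes \<pi> :: "(real \<times> real) measure" and f g :: "real \<times> real \<Rightarrow> real"
  assumes "sets \<pi> = sets (borel \<Otimes>\<^sub>M borel)" "prob_space \<pi>"
    and "f \<in> borel_measurable \<pi>" "g \<in> borel_measurable \<pi>"
  shows "ennreal (cdf (distr \<pi> borel f) s - cdf (distr \<pi> borel g) t)
    \<le> emeasure \<pi> {z. f z \<le> s \<and> t < g z}"
proof -
  interpret prob_space \<pi> by fact
  note [measurable] = assms(3,4)
  have sp: "space \<pi> = UNIV" using sets_eq_imp_space_eq[OF assms(1)] by (simp add: space_pair_measure)
  have A: "{z\<in>space \<pi>. f z \<le> s} \<in> sets \<pi>" "{z\<in>space \<pi>. g z \<le> t} \<in> sets \<pi>"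
    "{z\<in>space \<pi>. f z \<le> s \<and> t < g z} \<in> sets \<pi>" by measurable
  then have "measure \<pi> {z. f z \<le> s} \<le> measure \<pi> ({z. f z \<le> s \<and> t < g z} \<union> {z. g z \<le> t})"
    by (intro finite_measure_mono) (auto simp: sp)
  also have "\<dots> \<le> measure \<pi> {z. f z \<le> s \<and> t < g z} + measure \<pi> {z. g z \<le> t}"
    using A by (intro measure_Un_le) (auto simp: sp)
  finally have "measure \<pi> {z. f z \<le> s} - measure \<pi> {z. g z \<le> t} \<le> measure \<pi> {z. f z \<le> s \<and> t < g z}"
    by simp
  moreover have "cdf (distr \<pi> borel h) x = measure \<pi> {z. h z \<le> x}"
    if "h \<in> borel_measurable \<pi>" for h :: "_ \<Rightarrow> real" and x
    using that by (auto simp: cdf_def measure_distr sp intro!: arg_cong[where f="measure \<pi>"])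
  ultimately show ?thesis by (simp add: emeasure_eq_measure ennreal_leI)
qed

definition comonotone :: "real measure \<Rightarrow> real measure \<Rightarrow> (real \<times> real) measure" where
  "comonotone \<mu> \<nu> = distr UI (borel \<Otimes>\<^sub>M borel) (\<lambda>u. (quantile \<mu> u, quantile \<nu> u))"

lemma comonotone_coupling:
  assumes "real_distribution \<mu>" "real_distribution \<nu>"
  shows "comonotone \<mu> \<nu> \<in> couplings \<mu> \<nu>"
proof -
  have [measurable]: "quantile \<mu> \<in> borel_measurable UI" "quantile \<nu> \<in> borel_measurable UI"
    using assms by (auto intro: quantile_measurable)
  show ?thesis
    using assms by (simp add: couplings_def comonotone_def distr_distr comp_def distr_quantile)
qed

text \<open>In the comonotone coupling the quadrant is the single interval of levels from
  \<open>cdf \<nu> t\<close> to \<open>cdf \<mu> s\<close>, so the Frechet bound is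
  attained.\<close>

lemma quantile_quadrant_le:
  assumes "real_distribution \<mu>" "real_distribution \<nu>"
  shows "emeasure UI {u\<in>{0<..<1}. quantile \<mu> u \<le> s \<and> t < quantile \<nu> u} \<le> ennreal (cdf \<mu> s - cdf \<nu> t)"
proof -
  have "{u\<in>{0<..<1}. quantile \<mu> u \<le> s \<and> t < quantile \<nu> u} = {cdf \<nu> t<..cdf \<mu> s} \<inter> {0<..<1}"
    using quantile_le_iff[OF assms(1)] quantile_le_iff[OF assms(2)]
    by (auto simp: not_le[symmetric])
  then have "emeasure UI {u\<in>{0<..<1}. quantile \<mu> u \<le> s \<and> t < quantile \<nu> u}
      = emeasure lborel ({cdf \<nu> t<..cdf \<mu> s} \<inter> {0<..<1})"
    by (simp add: emeasure_UI)
  also have "\<dots> \<le> emeasure lborel {cdf \<nu> t<..cdf \<mu> s}" by (intro emeasure_mono) auto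
  also have "\<dots> \<le> ennreal (cdf \<mu> s - cdf \<nu> t)"
    by (cases "cdf \<nu> t \<le> cdf \<mu> s") auto
  finally show ?thesis .
qed

text \<open>The two Tonelli representations of the cost are compared integrand by integrand.
  Everything stays in the extended nonnegative reals, so an infinite cost does no harm.\<close>

lemma comonotone_optimal:
  assumes "real_distribution \<mu>" "real_distribution \<nu>" "\<pi> \<in> couplings \<mu> \<nu>"
  shows "(\<integral>\<^sup>+u. ennreal ((quantile \<mu> u - quantile \<nu> u)\<^sup>2) \<partial>UI) \<le> (\<integral>\<^sup>+z. ennreal ((fst z - snd z)\<^sup>2) \<partial>\<pi>)"
proof -
  have [measurable]: "quantile \<mu> \<in> borel_measurable UI" "quantile \<nu> \<in> borel_measurable UI"
    using assms by (auto intro: quantile_measurable)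
  note c = comonotone_coupling[OF assms(1,2)]
  have s: "sets \<pi> = sets (borel \<Otimes>\<^sub>M borel)" and d: "distr \<pi> borel fst = \<mu>" "distr \<pi> borel snd = \<nu>"
    using assms by (auto simp: couplings_def)
  have f: "fst \<in> borel_measurable \<pi>" "snd \<in> borel_measurable \<pi>"
    using s by (simp_all cong: measurable_cong_sets)
  note ps = coupling_prob_space[OF assms(1,3)]
  have "(\<integral>\<^sup>+u. ennreal ((quantile \<mu> u - quantile \<nu> u)\<^sup>2) \<partial>UI) = (\<integral>\<^sup>+z. ennreal ((fst z - snd z)\<^sup>2) \<partial>(comonotone \<mu> \<nu>))"
    unfolding comonotone_def by (subst nn_integral_distr) auto
  also have "\<dots> \<le> (\<integral>\<^sup>+z. ennreal ((fst z - snd z)\<^sup>2) \<partial>\<pi>)"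
    unfolding coupling_cost[OF assms(1,3)] coupling_cost[OF assms(1) c]
  proof (intro nn_integral_mono add_mono)
    fix p :: "real \<times> real"
    let ?s = "min (fst p) (snd p)" and ?t = "max (fst p) (snd p)"
    have "{z \<in> space (borel \<Otimes>\<^sub>M borel). fst z \<le> ?s \<and> ?t < snd z} \<in> sets (borel \<Otimes>\<^sub>M borel)"
      "{z \<in> space (borel \<Otimes>\<^sub>M borel). snd z \<le> ?s \<and> ?t < fst z} \<in> sets (borel \<Otimes>\<^sub>M borel)"
      by measurable
    then have A: "{z. fst z \<le> ?s \<and> ?t < snd z} \<in> sets (borel \<Otimes>\<^sub>M borel)"
      "{z. snd z \<le> ?s \<and> ?t < fst z} \<in> sets (borel \<Otimes>\<^sub>M borel)"
      by (auto simp: space_pair_measure)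
    have vim: "(\<lambda>u. (quantile \<mu> u, quantile \<nu> u)) -` {z. fst z \<le> ?s \<and> ?t < snd z} \<inter> space UI
        = {u\<in>{0<..<1}. quantile \<mu> u \<le> ?s \<and> ?t < quantile \<nu> u}"
      "(\<lambda>u. (quantile \<mu> u, quantile \<nu> u)) -` {z. snd z \<le> ?s \<and> ?t < fst z} \<inter> space UI
        = {u\<in>{0<..<1}. quantile \<nu> u \<le> ?s \<and> ?t < quantile \<mu> u}"
      by auto
    show "emeasure (comonotone \<mu> \<nu>) {z. fst z \<le> ?s \<and> ?t < snd z} \<le> emeasure \<pi> {z. fst z \<le> ?s \<and> ?t < snd z}"
      unfolding comonotone_def using A vim quantile_quadrant_le[OF assms(1,2), of ?s ?t]
        coupling_quadrant_ge[OF s ps f, of ?s ?t]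
      by (subst emeasure_distr) (auto simp: d)
    show "emeasure (comonotone \<mu> \<nu>) {z. snd z \<le> ?s \<and> ?t < fst z} \<le> emeasure \<pi> {z. snd z \<le> ?s \<and> ?t < fst z}"
      unfolding comonotone_def using A vim quantile_quadrant_le[OF assms(2,1), of ?s ?t]
        coupling_quadrant_ge[OF s ps f(2,1), of ?s ?t]
      by (subst emeasure_distr) (auto simp: d)
  qed
  finally show ?thesis .
qed

theorem W2_eq_L2_norm:
  assumes "\<mu> \<in> P2" "\<nu> \<in> P2"
  shows "W2 \<mu> \<nu> = L2_norm UI (\<lambda>u. quantile \<mu> u - quantile \<nu> u)"
proof -
  have rd: "real_distribution \<mu>" "real_distribution \<nu>" using assms by (auto simp: P2_def)
  have [measurable]: "quantile \<mu> \<in> borel_measurable UI" "quantile \<nu> \<in> borel_measurable UI"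
    using rd by (auto intro: quantile_measurable)
  have "(\<integral>\<^sup>+z. ennreal ((fst z - snd z)\<^sup>2) \<partial>(comonotone \<mu> \<nu>)) = (\<integral>\<^sup>+u. ennreal ((quantile \<mu> u - quantile \<nu> u)\<^sup>2) \<partial>UI)"
    unfolding comonotone_def by (subst nn_integral_distr) auto
  then have "(INF \<pi> \<in> couplings \<mu> \<nu>. \<integral>\<^sup>+z. ennreal ((fst z - snd z)\<^sup>2) \<partial>\<pi>)
      = (\<integral>\<^sup>+u. ennreal ((quantile \<mu> u - quantile \<nu> u)\<^sup>2) \<partial>UI)"
    using comonotone_optimal[OF rd] comonotone_coupling[OF rd]
    by (intro antisym INF_lower2[of "comonotone \<mu> \<nu>"] INF_greatest) auto
  moreover have "integrable UI (\<lambda>u. (quantile \<mu> u - quantile \<nu> u)\<^sup>2)"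
    using L2_diff[OF quantile_L2[OF assms(1)] quantile_L2[OF assms(2)]] by (simp add: L2_def)
  ultimately show ?thesis
    by (simp add: W2_def L2_norm_def nn_integral_eq_integral)
qed

lemma INF_coupling_swap:
  "(INF \<pi> \<in> couplings x y. \<integral>\<^sup>+z. ennreal ((fst z - snd z)\<^sup>2) \<partial>\<pi>)
    \<le> (INF \<pi> \<in> couplings y x. \<integral>\<^sup>+z. ennreal ((fst z - snd z)\<^sup>2) \<partial>\<pi>)"
proof (intro INF_mono)
  fix \<pi> assume "\<pi> \<in> couplings y x"
  then have s: "sets \<pi> = sets (borel \<Otimes>\<^sub>M borel)" and d: "distr \<pi> borel fst = y" "distr \<pi> borel snd = x"
    by (auto simp: couplings_def)
  let ?sw = "\<lambda>z :: real \<times> real. (snd z, fst z)"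
  let ?\<pi> = "distr \<pi> (borel \<Otimes>\<^sub>M borel) ?sw"
  have [measurable]: "?sw \<in> measurable \<pi> (borel \<Otimes>\<^sub>M borel)"
    by (subst measurable_cong_sets[OF s refl]) measurable
  have "?\<pi> \<in> couplings x y"
    using d by (auto simp: couplings_def distr_distr comp_def)
  moreover have "(\<integral>\<^sup>+z. ennreal ((fst z - snd z)\<^sup>2) \<partial>?\<pi>) = (\<integral>\<^sup>+z. ennreal ((fst z - snd z)\<^sup>2) \<partial>\<pi>)"
    by (subst nn_integral_distr) (auto simp: power2_commute)
  ultimately show "\<exists>\<pi>'\<in>couplings x y. (\<integral>\<^sup>+z. ennreal ((fst z - snd z)\<^sup>2) \<partial>\<pi>') \<le> (\<integral>\<^sup>+z. ennreal ((fst z - snd z)\<^sup>2) \<partial>\<pi>)"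
    by (intro bexI[of _ ?\<pi>]) auto
qed

lemma Metric_space_P2: "Metric_space P2 W2"
proof
  show "0 \<le> W2 x y" for x y by (simp add: W2_def)
  show "W2 x y = W2 y x" for x y by (simp add: W2_def order_antisym[OF INF_coupling_swap INF_coupling_swap])
  show "W2 x y = 0 \<longleftrightarrow> x = y" if "x \<in> P2" "y \<in> P2" for x y
  proof
    assume "W2 x y = 0"
    then have "AE u in UI. quantile x u - quantile y u = 0"
      using that by (intro L2_norm_eq_0D L2_diff quantile_L2) (auto simp: W2_eq_L2_norm)
    then show "x = y" using that by (intro quantile_AE_unique) (auto simp: P2_def)
  qed (use that in \<open>simp add: W2_eq_L2_norm, simp add: L2_norm_def\<close>)
  show "W2 x z \<le> W2 x y + W2 y z" if "x \<in> P2" "y \<in> P2" "z \<in> P2" for x y z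
    using that by (simp add: W2_eq_L2_norm L2_norm_triangle_diff quantile_L2)
qed

interpretation P2: Metric_space P2 W2
  by (rule Metric_space_P2)

section \<open>Barycenters\<close>

definition mean_quantile :: "nat \<Rightarrow> (nat \<Rightarrow> real measure) \<Rightarrow> real \<Rightarrow> real" where
  "mean_quantile n \<nu> u = 1 / real n * (\<Sum>i=1..n. quantile (\<nu> i) u)"

lemma mean_quantile_L2: "(\<And>i. i \<in> {1..n} \<Longrightarrow> \<nu> i \<in> P2) \<Longrightarrow> mean_quantile n \<nu> \<in> L2 UI"
  unfolding mean_quantile_def [abs_def] by (intro L2_cmult L2_sum quantile_L2)

lemma quantile_like_mean_quantile:
  assumes "\<And>i. i \<in> {1..n} \<Longrightarrow> \<nu> i \<in> P2"
  shows "quantile_like (mean_quantile n \<nu>)"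
  unfolding quantile_like_def
proof (intro conjI ballI mono_onI)
  fix u v :: real assume uv: "u \<in> {0<..<1}" "v \<in> {0<..<1}" "u \<le> v"
  have q: "quantile (\<nu> i) u \<le> quantile (\<nu> i) v" if "i \<in> {1..n}" for i
    using mono_onD[OF quantile_mono_on uv] assms[OF that] by (simp add: real_distribution_P2)
  show "mean_quantile n \<nu> u \<le> mean_quantile n \<nu> v"
    unfolding mean_quantile_def
    using q by (intro mult_left_mono sum_mono) auto
next
  have q: "quantile_like (quantile (\<nu> i))" if "i \<in> {1..n}" for i
    using assms[OF that] by (simp add: quantile_like_quantile real_distribution_P2)
  fix u :: real assume u: "u \<in> {0<..<1}"
  show "continuous (at_left u) (mean_quantile n \<nu>)"
    unfolding mean_quantile_def [abs_def]
    using q u by (intro continuous_intros) (auto simp: quantile_like_def)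
qed

text \<open>The parallel axis identity. Integrated over the levels, it becomes the corresponding
  identity for squared \<open>W2\<close> distances to the barycenter.\<close>

lemma sum_sq_dev_mean:
  fixes q :: "nat \<Rightarrow> real"
  assumes "n \<ge> 1" "m = 1 / real n * (\<Sum>i=1..n. q i)"
  shows "(\<Sum>i=1..n. (r - q i)\<^sup>2) = real n * (r - m)\<^sup>2 + (\<Sum>i=1..n. (m - q i)\<^sup>2)"
proof -
  have "(\<Sum>i=1..n. q i) = real n * m" using assms by simp
  then have "(\<Sum>i=1..n. m - q i) = 0" by (simp add: sum_subtractf)
  then have z: "(\<Sum>i=1..n. 2 * (r - m) * (m - q i)) = 0"
    using sum_distrib_left[of "2 * (r - m)" "\<lambda>i. m - q i" "{1..n}"] by (metis mult_zero_right)
  have "(\<Sum>i=1..n. (r - q i)\<^sup>2) = (\<Sum>i=1..n. (r - m)\<^sup>2 + 2 * (r - m) * (m - q i) + (m - q i)\<^sup>2)"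
    by (intro sum.cong) (auto simp: power2_eq_square algebra_simps)
  also have "\<dots> = real n * (r - m)\<^sup>2 + (\<Sum>i=1..n. (m - q i)\<^sup>2)"
    by (simp only: sum.distrib z) simp
  finally show ?thesis .
qed

text \<open>By \<open>dec\<close>, the cost of \<open>\<rho>\<close> exceeds that of
  \<open>?\<beta>\<close> by exactly \<open>n\<close> times the squared distance between them, so
  the minimiser is unique and the description in \<open>barycenter\<close> is proper. For
  \<open>n = 0\<close> every element of \<open>P2\<close> minimises, so \<open>barycenter 0\<close>
  is unspecified; hence the recurring assumption \<open>n \<ge> 1\<close>.\<close>

lemma
  assumes n: "n \<ge> 1" and \<nu>: "\<And>i. i \<in> {1..n} \<Longrightarrow> \<nu> i \<in> P2"
  shows barycenter_eq: "barycenter n \<nu> = distr UI borel (mean_quantile n \<nu>)"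
    and barycenter_P2: "barycenter n \<nu> \<in> P2"
    and quantile_barycenter: "u \<in> {0<..<1} \<Longrightarrow> quantile (barycenter n \<nu>) u = mean_quantile n \<nu> u"
proof -
  let ?\<beta> = "distr UI borel (mean_quantile n \<nu>)"
  note L2m = mean_quantile_L2[of n \<nu>, OF \<nu>] and qm = quantile_like_mean_quantile[of n \<nu>, OF \<nu>]
  have \<beta>: "?\<beta> \<in> P2" using L2m by (simp add: distr_UI_P2_iff L2_measurable)
  have q\<beta>: "quantile ?\<beta> u = mean_quantile n \<nu> u" if "u \<in> {0<..<1}" for u
    by (rule quantile_distr_UI[OF qm that])
  have int: "integrable UI (\<lambda>u. (quantile \<rho> u - quantile \<rho>' u)\<^sup>2)" if "\<rho> \<in> P2" "\<rho>' \<in> P2" for \<rho> \<rho>'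
    using L2_diff[OF quantile_L2 quantile_L2, OF that] by (simp add: L2_def)
  have W: "(W2 \<rho> \<rho>')\<^sup>2 = (\<integral>u. (quantile \<rho> u - quantile \<rho>' u)\<^sup>2 \<partial>UI)" if "\<rho> \<in> P2" "\<rho>' \<in> P2" for \<rho> \<rho>'
    using that by (simp add: W2_eq_L2_norm L2_norm_power2)
  have dec: "(\<Sum>i=1..n. (W2 \<rho> (\<nu> i))\<^sup>2) = real n * (W2 \<rho> ?\<beta>)\<^sup>2 + (\<Sum>i=1..n. (W2 ?\<beta> (\<nu> i))\<^sup>2)"
    if \<rho>: "\<rho> \<in> P2" for \<rho>
  proof -
    have "(\<Sum>i=1..n. (W2 \<rho> (\<nu> i))\<^sup>2) = (\<integral>u. (\<Sum>i=1..n. (quantile \<rho> u - quantile (\<nu> i) u)\<^sup>2) \<partial>UI)"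
      using \<nu> \<rho> by (subst Bochner_Integration.integral_sum) (auto simp: W int)
    also have "\<dots> = (\<integral>u. real n * (quantile \<rho> u - quantile ?\<beta> u)\<^sup>2 + (\<Sum>i=1..n. (quantile ?\<beta> u - quantile (\<nu> i) u)\<^sup>2) \<partial>UI)"
      using n by (intro Bochner_Integration.integral_cong refl sum_sq_dev_mean)
        (auto simp: q\<beta> mean_quantile_def)
    also have "\<dots> = real n * (W2 \<rho> ?\<beta>)\<^sup>2 + (\<Sum>i=1..n. (W2 ?\<beta> (\<nu> i))\<^sup>2)"
      using \<nu> \<rho> \<beta> by (subst Bochner_Integration.integral_add)
        (auto simp: W int Bochner_Integration.integral_sum intro!: Bochner_Integration.integrable_sum)
    finally show ?thesis .
  qed
  have "is_barycenter n \<nu> \<mu> \<longleftrightarrow> \<mu> = ?\<beta>" for \<mu>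
  proof
    assume "is_barycenter n \<nu> \<mu>"
    then have \<mu>: "\<mu> \<in> P2" and "1 / real n * (\<Sum>i = 1..n. (W2 \<mu> (\<nu> i))\<^sup>2) \<le> 1 / real n * (\<Sum>i = 1..n. (W2 ?\<beta> (\<nu> i))\<^sup>2)"
      using \<beta> by (auto simp: is_barycenter_def)
    then have "real n * (W2 \<mu> ?\<beta>)\<^sup>2 \<le> 0"
      using n dec[OF \<mu>] by (simp add: divide_right_mono_neg field_simps)
    then have "W2 \<mu> ?\<beta> = 0" using n by (simp add: mult_le_0_iff)
    then show "\<mu> = ?\<beta>" using \<mu> \<beta> by simp
  next
    assume "\<mu> = ?\<beta>"
    moreover have "(\<Sum>i=1..n. (W2 ?\<beta> (\<nu> i))\<^sup>2) \<le> (\<Sum>i=1..n. (W2 \<rho> (\<nu> i))\<^sup>2)" if "\<rho> \<in> P2" for \<rho>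
      unfolding dec[OF that] by simp
    ultimately show "is_barycenter n \<nu> \<mu>"
      using \<beta> unfolding is_barycenter_def by (simp add: divide_right_mono)
  qed
  then show *: "barycenter n \<nu> = ?\<beta>" by (simp add: barycenter_def)
  show "barycenter n \<nu> \<in> P2" using * \<beta> by simp
  show "quantile (barycenter n \<nu>) u = mean_quantile n \<nu> u" if "u \<in> {0<..<1}"
    using * q\<beta>[OF that] by simp
qed

lemma inner_L2_barycenter:
  assumes "n \<ge> 1" "\<And>i. i \<in> {1..n} \<Longrightarrow> \<nu> i \<in> P2" "\<alpha> \<in> L2_unit"
  shows "inner_L2 \<alpha> (quantile (barycenter n \<nu>)) = 1 / real n * (\<Sum>i=1..n. inner_L2 \<alpha> (quantile (\<nu> i)))"
proof -
  have int: "integrable UI (\<lambda>u. \<alpha> u * quantile (\<nu> i) u)" if "i \<in> {1..n}" for i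
    using assms that by (intro L2_mult_integrable quantile_L2) (auto simp: L2_unit_eq)
  have "inner_L2 \<alpha> (quantile (barycenter n \<nu>)) = (\<integral>u. 1 / real n * (\<Sum>i=1..n. \<alpha> u * quantile (\<nu> i) u) \<partial>UI)"
    unfolding inner_L2_eq
    by (intro Bochner_Integration.integral_cong)
      (use quantile_barycenter[OF assms(1,2)] in \<open>simp_all add: mean_quantile_def sum_distrib_left sum_divide_distrib\<close>)
  also have "\<dots> = 1 / real n * (\<Sum>i=1..n. inner_L2 \<alpha> (quantile (\<nu> i)))"
    using int by (simp add: Bochner_Integration.integral_sum inner_L2_eq)
  finally show ?thesis .
qed

text \<open>The weight of the quantile function near both endpoints. For \<open>e \<ge> 1\<close>
  the two ends cover the unit interval, so \<open>tail_norm 1\<close> is the full norm and one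
  family controls both boundedness and uniform integrability.\<close>

definition tail_norm :: "real \<Rightarrow> real measure \<Rightarrow> real" where
  "tail_norm e \<mu> = L2_norm UI (\<lambda>u. indicator ({..<e} \<union> {1 - e<..}) u * quantile \<mu> u)"

lemma tail_norm_nonneg: "0 \<le> tail_norm e \<mu>"
  by (simp add: tail_norm_def)

lemma L2_tail:
  "f \<in> L2 UI \<Longrightarrow> (\<lambda>u. indicator ({..<e} \<union> {1 - e<..}) u * f u) \<in> L2 UI"
  by (intro L2_bounded_mult[where C=1] measurable_UI_borel) (auto simp: indicator_def)

text \<open>Minkowski's inequality. It reduces tail control of the barycenter to sums of real random
  variables, to which Chernoff's inequality applies.\<close>

lemma tail_norm_barycenter:
  assumes "n \<ge> 1" "\<And>i. i \<in> {1..n} \<Longrightarrow> \<nu> i \<in> P2"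
  shows "tail_norm e (barycenter n \<nu>) \<le> 1 / real n * (\<Sum>i=1..n. tail_norm e (\<nu> i))"
proof -
  let ?h = "indicator ({..<e} \<union> {1 - e<..}) :: real \<Rightarrow> real"
  have "tail_norm e (barycenter n \<nu>) = L2_norm UI (\<lambda>u. 1 / real n * (\<Sum>i=1..n. ?h u * quantile (\<nu> i) u))"
    unfolding tail_norm_def L2_norm_def
    by (intro arg_cong[where f=sqrt] Bochner_Integration.integral_cong)
      (use quantile_barycenter[OF assms] in \<open>auto simp: mean_quantile_def indicator_def\<close>)
  also have "\<dots> \<le> 1 / real n * (\<Sum>i=1..n. tail_norm e (\<nu> i))"
    unfolding L2_norm_cmult tail_norm_def abs_of_nonneg[OF divide_nonneg_nonneg[OF zero_le_one of_nat_0_le_iff]]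
    using assms(2) by (intro mult_left_mono L2_norm_sum_le L2_tail quantile_L2) auto
  finally show ?thesis .
qed

section \<open>The topology of the Wasserstein space\<close>

lemma topspace_P2 [simp]: "topspace P2_topology = P2"
  by (simp add: P2_topology_def)

lemma inner_L2_diff_le:
  assumes "\<alpha> \<in> L2_unit" "\<mu> \<in> P2" "\<nu> \<in> P2"
  shows "\<bar>inner_L2 \<alpha> (quantile \<mu>) - inner_L2 \<alpha> (quantile \<nu>)\<bar> \<le> L2_norm UI \<alpha> * W2 \<mu> \<nu>"
proof -
  have a: "\<alpha> \<in> L2 UI" using assms by (simp add: L2_unit_eq)
  have "inner_L2 \<alpha> (quantile \<mu>) - inner_L2 \<alpha> (quantile \<nu>) = (\<integral>u. \<alpha> u * (quantile \<mu> u - quantile \<nu> u) \<partial>UI)"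
    using assms a by (simp add: inner_L2_eq right_diff_distrib L2_mult_integrable quantile_L2)
  then show ?thesis
    using L2_Cauchy_Schwarz[OF a L2_diff[OF quantile_L2 quantile_L2], OF assms(2,3)] assms
    by (simp add: W2_eq_L2_norm)
qed

lemma tail_norm_diff_le:
  assumes "\<mu> \<in> P2" "\<nu> \<in> P2"
  shows "\<bar>tail_norm e \<mu> - tail_norm e \<nu>\<bar> \<le> W2 \<mu> \<nu>"
proof -
  let ?h = "indicator ({..<e} \<union> {1 - e<..}) :: real \<Rightarrow> real"
  note L = quantile_L2[OF assms(1)] quantile_L2[OF assms(2)]
  have "\<bar>tail_norm e \<mu> - tail_norm e \<nu>\<bar> \<le> L2_norm UI (\<lambda>u. ?h u * quantile \<mu> u - ?h u * quantile \<nu> u)"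
    unfolding tail_norm_def by (intro L2_norm_diff_abs L2_tail L)
  also have "\<dots> \<le> L2_norm UI (\<lambda>u. quantile \<mu> u - quantile \<nu> u)"
    by (intro L2_norm_mono L2_diff L L2_measurable[OF L2_diff[OF L2_tail L2_tail]])
      (auto simp: indicator_def)
  finally show ?thesis using assms by (simp add: W2_eq_L2_norm)
qed

lemma openin_P2_Lipschitz_vimage:
  fixes f :: "real measure \<Rightarrow> real"
  assumes "\<And>\<mu> \<nu>. \<mu> \<in> P2 \<Longrightarrow> \<nu> \<in> P2 \<Longrightarrow> \<bar>f \<mu> - f \<nu>\<bar> \<le> C * W2 \<mu> \<nu>" "open U"
  shows "openin P2_topology {\<mu>\<in>P2. f \<mu> \<in> U}"
  unfolding P2_topology_def P2.openin_mtopology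
proof (intro conjI ballI allI impI)
  fix \<mu> assume \<mu>: "\<mu> \<in> {\<mu>\<in>P2. f \<mu> \<in> U}"
  then obtain e where e: "e > 0" "\<And>y. \<bar>y - f \<mu>\<bar> < e \<Longrightarrow> y \<in> U"
    using assms(2) unfolding open_dist dist_real_def by blast
  \<comment> \<open>The constant \<open>C\<close> may be zero or negative, so
    \<open>\<bar>C\<bar> + 1\<close> takes its place in the radius.\<close>
  have "P2.mball \<mu> (e / (\<bar>C\<bar> + 1)) \<subseteq> {\<mu>\<in>P2. f \<mu> \<in> U}"
  proof
    fix \<nu> assume \<nu>: "\<nu> \<in> P2.mball \<mu> (e / (\<bar>C\<bar> + 1))"
    then have "\<bar>f \<nu> - f \<mu>\<bar> \<le> C * W2 \<mu> \<nu>" using assms(1)[of \<mu> \<nu>] \<mu> by (simp add: abs_minus_commute)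
    also have "\<dots> \<le> (\<bar>C\<bar> + 1) * W2 \<mu> \<nu>" by (intro mult_right_mono) auto
    also have "\<dots> < e" using \<nu> by (simp add: pos_less_divide_eq mult.commute)
    finally show "\<nu> \<in> {\<mu>\<in>P2. f \<mu> \<in> U}" using \<nu> e by auto
  qed
  then show "\<exists>r>0. P2.mball \<mu> r \<subseteq> {\<mu>\<in>P2. f \<mu> \<in> U}"
    using e by (intro exI[of _ "e / (\<bar>C\<bar> + 1)"]) auto
qed auto

lemma sets_borel_of: "sets (borel_of X) = sigma_sets (topspace X) {U. openin X U}"
  unfolding borel_of_def by (rule sets_measure_of) (auto dest: openin_subset)

lemma space_borel_of: "space (borel_of X) = topspace X"
  unfolding borel_of_def by (rule space_measure_of) (auto dest: openin_subset)

lemma borel_of_open: "openin X U \<Longrightarrow> U \<in> sets (borel_of X)"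
  by (simp add: sets_borel_of sigma_sets.Basic)

lemma Lipschitz_measurable_borel_of_P2:
  fixes f :: "real measure \<Rightarrow> real"
  assumes "\<And>\<mu> \<nu>. \<mu> \<in> P2 \<Longrightarrow> \<nu> \<in> P2 \<Longrightarrow> \<bar>f \<mu> - f \<nu>\<bar> \<le> C * W2 \<mu> \<nu>"
  shows "f \<in> borel_measurable (borel_of P2_topology)"
proof (rule borel_measurableI)
  fix S :: "real set" assume "open S"
  from openin_P2_Lipschitz_vimage[of f C, OF assms this]
  have "openin P2_topology (f -` S \<inter> P2)" by (simp add: vimage_def Int_def conj_commute)
  then show "f -` S \<inter> space (borel_of P2_topology) \<in> sets (borel_of P2_topology)"
    by (simp add: space_borel_of borel_of_open)
qed

lemma inner_L2_measurable:
  "\<alpha> \<in> L2_unit \<Longrightarrow> (\<lambda>\<mu>. inner_L2 \<alpha> (quantile \<mu>)) \<in> borel_measurable (borel_of P2_topology)"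
  by (rule Lipschitz_measurable_borel_of_P2[OF inner_L2_diff_le])

lemma tail_norm_measurable: "tail_norm e \<in> borel_measurable (borel_of P2_topology)"
  using tail_norm_diff_le by (intro Lipschitz_measurable_borel_of_P2[of _ 1]) simp

lemma openin_inner_L2:
  "\<alpha> \<in> L2_unit \<Longrightarrow> open U \<Longrightarrow> openin P2_topology {\<mu>\<in>P2. inner_L2 \<alpha> (quantile \<mu>) \<in> U}"
  by (rule openin_P2_Lipschitz_vimage[OF inner_L2_diff_le])

section \<open>Compactness\<close>

lemma L2_norm_Fatou:
  assumes f: "\<And>i. f i \<in> L2 N" "\<And>i. L2_norm N (f i) \<le> r"
    and g: "g \<in> borel_measurable N" and lim: "AE x in N. (\<lambda>i. f i x) \<longlonglongrightarrow> g x"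
  shows "g \<in> L2 N" and "L2_norm N g \<le> r"
proof -
  have [measurable]: "f i \<in> borel_measurable N" for i using f L2_measurable by blast
  note [measurable] = g
  have r: "0 \<le> r" using f(2)[of 0] L2_norm_nonneg[of N "f 0"] by linarith
  have "(\<integral>\<^sup>+x. ennreal ((g x)\<^sup>2) \<partial>N) = (\<integral>\<^sup>+x. liminf (\<lambda>i. ennreal ((f i x)\<^sup>2)) \<partial>N)"
  proof (intro nn_integral_cong_AE, use lim in eventually_elim)
    fix x assume "(\<lambda>i. f i x) \<longlonglongrightarrow> g x"
    then have "(\<lambda>i. ennreal ((f i x)\<^sup>2)) \<longlonglongrightarrow> ennreal ((g x)\<^sup>2)" by (intro tendsto_intros)
    then show "ennreal ((g x)\<^sup>2) = liminf (\<lambda>i. ennreal ((f i x)\<^sup>2))" 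
      by (rule lim_imp_Liminf[OF trivial_limit_sequentially, symmetric])
  qed
  also have "\<dots> \<le> liminf (\<lambda>i. \<integral>\<^sup>+x. ennreal ((f i x)\<^sup>2) \<partial>N)" by (intro nn_integral_liminf) auto
  also have "\<dots> \<le> ennreal (r\<^sup>2)"
  proof -
    have "(\<integral>\<^sup>+x. ennreal ((f i x)\<^sup>2) \<partial>N) = ennreal ((L2_norm N (f i))\<^sup>2)" for i
      using f(1)[of i] unfolding L2_norm_power2 by (intro nn_integral_eq_integral) (auto simp: L2_def)
    also have "\<dots> i \<le> ennreal (r\<^sup>2)" for i using f(2) by (intro ennreal_leI power_mono) auto
    finally have "\<forall>i. (\<integral>\<^sup>+x. ennreal ((f i x)\<^sup>2) \<partial>N) \<le> ennreal (r\<^sup>2)" by simp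
    then show ?thesis using Liminf_mono[of "\<lambda>i. \<integral>\<^sup>+x. ennreal ((f i x)\<^sup>2) \<partial>N" "\<lambda>i. ennreal (r\<^sup>2)" sequentially]
      by (simp add: Liminf_const)
  qed
  finally have le: "(\<integral>\<^sup>+x. ennreal ((g x)\<^sup>2) \<partial>N) \<le> ennreal (r\<^sup>2)" .
  then have int: "integrable N (\<lambda>x. (g x)\<^sup>2)"
    by (intro integrableI_bounded) (auto simp: le_less_trans)
  then show "g \<in> L2 N" by (simp add: L2_def)
  have "ennreal (\<integral>x. (g x)\<^sup>2 \<partial>N) \<le> ennreal (r\<^sup>2)"
    using le nn_integral_eq_integral[OF int] by simp
  then have "(\<integral>x. (g x)\<^sup>2 \<partial>N) \<le> r\<^sup>2" by (simp add: ennreal_le_iff)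
  then show "L2_norm N g \<le> r" using r by (simp add: L2_norm_def real_le_lsqrt)
qed

text \<open>By monotonicity the quantile function exceeds its value at \<open>u\<close> in modulus
  on the whole of one side of \<open>u\<close>, to the right if the value is nonnegative and to the
  left otherwise; that side has measure at least \<open>e\<close>.\<close>

lemma quantile_bound:
  assumes "\<mu> \<in> P2" "0 < e" "e \<le> u" "u \<le> 1 - e"
  shows "\<bar>quantile \<mu> u\<bar> * sqrt e \<le> L2_norm UI (quantile \<mu>)"
proof -
  note mono = mono_onD[OF quantile_mono_on[OF real_distribution_P2[OF assms(1)]]]
  have L: "quantile \<mu> \<in> L2 UI" by (rule quantile_L2[OF assms(1)])
  define S where "S = (if 0 \<le> quantile \<mu> u then {u<..<1} else {0<..<u})"
  have S: "S \<in> sets UI" "S \<subseteq> {0<..<1}" using assms by (auto simp: S_def sets_UI_iff)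
  have mS: "e \<le> measure UI S" using assms by (auto simp: S_def measure_def emeasure_UI subset_eq)
  have "\<bar>quantile \<mu> u\<bar>\<^sup>2 * e \<le> (quantile \<mu> u)\<^sup>2 * measure UI S"
    using mS by (simp add: mult_left_mono)
  also have "\<dots> = (\<integral>v. indicator S v * (quantile \<mu> u)\<^sup>2 \<partial>UI)" using S by (simp add: Int_absorb2)
  also have "\<dots> \<le> (\<integral>v. (quantile \<mu> v)\<^sup>2 \<partial>UI)"
  proof (rule integral_mono)
    show "integrable UI (\<lambda>v. indicator S v * (quantile \<mu> u)\<^sup>2)"
      using S by (intro integrable_mult_left integrable_real_indicator) (auto simp: UI.emeasure_finite less_top[symmetric])
    show "integrable UI (\<lambda>v. (quantile \<mu> v)\<^sup>2)" using L by (simp add: L2_def)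
    fix v assume "v \<in> space UI"
    have "\<bar>quantile \<mu> u\<bar> \<le> \<bar>quantile \<mu> v\<bar>" if "v \<in> S"
      using that mono[of u v] mono[of v u] assms by (auto simp: S_def split: if_splits)
    then show "indicator S v * (quantile \<mu> u)\<^sup>2 \<le> (quantile \<mu> v)\<^sup>2"
      by (auto simp: indicator_def abs_le_square_iff)
  qed
  also have "\<dots> = (L2_norm UI (quantile \<mu>))\<^sup>2" by (simp add: L2_norm_power2)
  finally have "(\<bar>quantile \<mu> u\<bar> * sqrt e)\<^sup>2 \<le> (L2_norm UI (quantile \<mu>))\<^sup>2"
    using assms by (simp add: power_mult_distrib)
  then show ?thesis by (rule power2_le_imp_le) simp
qed

text \<open>Convergence holds wherever the limiting quantile function is continuous, that is, off a
  countable set. The comparison points \<open>x\<close> are taken without mass, where the cdfs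
  converge; atoms are countable, so such points are dense.\<close>

lemma weak_conv_quantile_AE:
  assumes \<mu>: "\<And>n. real_distribution (\<mu> n)" and M: "real_distribution M" and conv: "weak_conv_m \<mu> M"
  shows "AE u in UI. (\<lambda>n. quantile (\<mu> n) u) \<longlonglongrightarrow> quantile M u"
proof -
  interpret M: real_distribution M by fact
  have cdf_conv: "(\<lambda>n. cdf (\<mu> n) x) \<longlonglongrightarrow> cdf M x" if "measure M {x} = 0" for x
    using conv that M.isCont_cdf by (simp add: weak_conv_m_def weak_conv_def)
  have point: "\<exists>x. a < x \<and> x < b \<and> measure M {x} = 0" if "a < b" for a b :: real
    using open_minus_countable[OF M.countable_support, of "{a<..<b}"] that by auto
  let ?Q = "quantile M"
  have conv_at: "(\<lambda>n. quantile (\<mu> n) u) \<longlonglongrightarrow> ?Q u" if u: "0 < u" "u < 1" and cont: "isCont ?Q u" for u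
  proof (rule order_tendstoI)
    fix a assume "a < ?Q u"
    then obtain x where x: "a < x" "x < ?Q u" "measure M {x} = 0" using point by blast
    then have "cdf M x < u" using quantile_le_iff[OF M u, of x] by linarith
    then have "\<forall>\<^sub>F n in sequentially. cdf (\<mu> n) x < u" using cdf_conv[OF x(3)] order_tendstoD(2) by blast
    then show "\<forall>\<^sub>F n in sequentially. a < quantile (\<mu> n) u"
    proof eventually_elim
      case (elim n)
      then show ?case using quantile_le_iff[OF \<mu> u, of n x] x by linarith
    qed
  next
    fix b assume "?Q u < b"
    \<comment> \<open>The level is moved to some \<open>v > u\<close> first:
      \<open>v \<le> cdf M x\<close> then places \<open>cdf M x\<close> strictly above
      \<open>u\<close>, and a strict inequality persists for large \<open>n\<close>.\<close>
    moreover have "(?Q \<longlongrightarrow> ?Q u) (at_right u)"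
      using cont by (auto simp: continuous_at intro: tendsto_within_subset)
    ultimately have "\<forall>\<^sub>F v in at_right u. ?Q v < b" by (rule order_tendstoD(2)[rotated])
    moreover have "\<forall>\<^sub>F v in at_right u. v < 1"
      using u unfolding eventually_at_right_field by (intro exI[of _ 1]) auto
    ultimately have "\<forall>\<^sub>F v in at_right u. ?Q v < b \<and> v < 1" by (rule eventually_conj)
    then obtain v where v: "u < v" "v < 1" "?Q v < b"
      unfolding eventually_at_right_field by (metis dense)
    then obtain x where x: "?Q v < x" "x < b" "measure M {x} = 0" using point by blast
    then have "v \<le> cdf M x" using quantile_le_iff[OF M, of v x] u v by simp
    then have "\<forall>\<^sub>F n in sequentially. u < cdf (\<mu> n) x"
      using v cdf_conv[OF x(3)] order_tendstoD(1)[of _ "cdf M x" _ u] by auto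
    then show "\<forall>\<^sub>F n in sequentially. quantile (\<mu> n) u < b"
    proof eventually_elim
      case (elim n)
      then show ?case using quantile_le_iff[OF \<mu> u, of n x] x by linarith
    qed
  qed
  let ?D = "{u\<in>{0<..<1}. \<not> isCont ?Q u}"
  have D: "countable ?D"
    using mono_on_ctble_discont[OF quantile_mono_on[OF M]]
    by (simp add: at_within_open[of _ "{0<..<1}"] cong: conj_cong)
  have D0: "?D \<in> sets borel" "emeasure lborel ?D = 0"
    using countable_imp_null_set_lborel[OF D] by (simp_all add: null_sets_def)
  then have "emeasure UI ?D = 0" by (subst emeasure_UI) (simp_all add: subset_eq)
  then have "?D \<in> null_sets UI" using D0 by (auto simp: null_sets_def sets_UI_iff)
  then show ?thesis
    by (rule AE_I') (use conv_at in auto)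
qed

lemma tail_norm_ge_1: "e \<ge> 1 \<Longrightarrow> tail_norm e \<mu> = L2_norm UI (quantile \<mu>)"
  unfolding tail_norm_def L2_norm_def
  by (intro arg_cong[where f=sqrt] Bochner_Integration.integral_cong) auto

lemma tight_bounded_L2:
  assumes \<mu>: "\<And>n. \<mu> n \<in> P2" "\<And>n. L2_norm UI (quantile (\<mu> n)) \<le> R"
  shows "tight \<mu>"
  unfolding tight_def
proof (intro conjI allI impI)
  show "real_distribution (\<mu> n)" for n using \<mu> real_distribution_P2 by blast
  fix \<epsilon> :: real assume \<epsilon>: "0 < \<epsilon>"
  have R: "0 \<le> R" using \<mu>(2)[of 0] L2_norm_nonneg order_trans by blast
  \<comment> \<open>Chebyshev gives \<open>R\<^sup>2 / A\<^sup>2\<close>; the \<open>+ 1\<close>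
    makes this strictly smaller than \<open>\<epsilon>\<close> and \<open>A\<close> positive even
    for \<open>R = 0\<close>.\<close>
  define A where "A = (R + 1) / sqrt \<epsilon>"
  have A: "A > 0" using R \<epsilon> by (simp add: A_def)
  have "measure (\<mu> n) {-A<..A} > 1 - \<epsilon>" for n
  proof -
    interpret real_distribution "\<mu> n" using \<mu> real_distribution_P2 by blast
    have int: "integrable (\<mu> n) (\<lambda>x. x\<^sup>2)" using \<mu>(1) by (simp add: P2_def)
    have "measure (\<mu> n) {x\<in>space (\<mu> n). \<bar>x\<bar> \<ge> A} \<le> (\<integral>x. x\<^sup>2 \<partial>(\<mu> n)) / A\<^sup>2"
      by (rule second_moment_method) (use int A in auto)
    also have "(\<integral>x. x\<^sup>2 \<partial>(\<mu> n)) = (\<integral>x. x\<^sup>2 \<partial>(distr UI borel (quantile (\<mu> n))))"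
      by (simp add: distr_quantile real_distribution_axioms)
    also have "\<dots> = (L2_norm UI (quantile (\<mu> n)))\<^sup>2"
      by (subst integral_distr) (auto simp: L2_norm_power2 quantile_measurable real_distribution_axioms)
    also have "\<dots> / A\<^sup>2 \<le> R\<^sup>2 / A\<^sup>2" using \<mu>(2) by (intro divide_right_mono power_mono) auto
    also have "\<dots> < (R + 1)\<^sup>2 / A\<^sup>2"
      using R A by (intro divide_strict_right_mono power_strict_mono) auto
    also have "\<dots> = \<epsilon>" using \<epsilon> R by (simp add: A_def power_divide)
    finally have "measure (\<mu> n) {x. \<bar>x\<bar> \<ge> A} < \<epsilon>" by simp
    moreover have "1 \<le> measure (\<mu> n) ({-A<..A} \<union> {x. \<bar>x\<bar> \<ge> A})"
    proof -
      have "{-A<..A} \<union> {x. \<bar>x\<bar> \<ge> A} = UNIV" by auto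
      then show ?thesis using prob_space by simp
    qed
    moreover have "measure (\<mu> n) ({-A<..A} \<union> {x. \<bar>x\<bar> \<ge> A}) \<le> measure (\<mu> n) {-A<..A} + measure (\<mu> n) {x. \<bar>x\<bar> \<ge> A}"
      by (intro measure_Un_le) auto
    ultimately show ?thesis by linarith
  qed
  then show "\<exists>a b. a < b \<and> (\<forall>n. 1 - \<epsilon> < measure (\<mu> n) {a<..b})"
    using A by (intro exI[of _ "-A"] exI[of _ A]) auto
qed

text \<open>The constraint of index 0 has \<open>\<eta> 0 = 1\<close> and bounds the full norm,
  which gives tightness. Along a subsequence the quantile functions converge almost everywhere, and
  Fatou's lemma keeps the limit in the set. On the middle interval \<open>quantile_bound\<close>
  supplies a constant majorant for dominated convergence; each end contributes at most
  \<open>r k\<close>, uniformly along the sequence.\<close>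

proposition compactin_tail_norm:
  assumes r: "r \<longlonglongrightarrow> 0" and \<eta>: "\<And>k. 0 < \<eta> k" "\<eta> 0 = 1"
  shows "compactin P2_topology {\<mu>\<in>P2. \<forall>k. tail_norm (\<eta> k) \<mu> \<le> r k}"
  unfolding P2_topology_def P2.compactin_sequentially
proof (intro conjI allI impI)
  let ?K = "{\<mu>\<in>P2. \<forall>k. tail_norm (\<eta> k) \<mu> \<le> r k}"
  let ?h = "\<lambda>e. indicator ({..<e} \<union> {1 - e<..}) :: real \<Rightarrow> real"
  fix \<sigma> :: "nat \<Rightarrow> real measure" assume "range \<sigma> \<subseteq> ?K"
  then have \<sigma>: "\<sigma> n \<in> P2" "tail_norm (\<eta> k) (\<sigma> n) \<le> r k" for n k by auto
  define R where "R = r 0"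
  have nR: "L2_norm UI (quantile (\<sigma> n)) \<le> R" for n
    using \<sigma>(2)[of 0 n] \<eta>(2) by (simp add: tail_norm_ge_1 R_def)
  have "tight \<sigma>" by (rule tight_bounded_L2[OF \<sigma>(1) nR])
  then obtain s M where s: "strict_mono (s :: nat \<Rightarrow> nat)" and M: "real_distribution M"
    and "weak_conv_m (\<sigma> \<circ> id \<circ> s) M"
    using tight_imp_convergent_subsubsequence[of \<sigma> id] by (auto simp: strict_mono_id)
  then have "weak_conv_m (\<lambda>n. \<sigma> (s n)) M" by (simp add: comp_def)
  then have AE_lim: "AE u in UI. (\<lambda>n. quantile (\<sigma> (s n)) u) \<longlonglongrightarrow> quantile M u"
    by (intro weak_conv_quantile_AE M) (use \<sigma> in \<open>auto simp: real_distribution_P2\<close>)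
  have Q: "quantile (\<sigma> n) \<in> L2 UI" for n using \<sigma> by (simp add: quantile_L2)
  have QM: "quantile M \<in> borel_measurable UI" by (rule quantile_measurable[OF M])
  have h: "?h e \<in> borel_measurable UI" for e by (intro measurable_UI_borel) auto
  have "quantile M \<in> L2 UI"
    by (rule L2_norm_Fatou[of "\<lambda>n. quantile (\<sigma> (s n))" _ R]) (use Q nR QM AE_lim in auto)
  then have MP: "M \<in> P2" using distr_UI_P2_iff[OF QM] by (simp add: distr_quantile M)
  have tM: "tail_norm (\<eta> k) M \<le> r k" for k
    unfolding tail_norm_def
  proof (rule L2_norm_Fatou(2)[of "\<lambda>n u. ?h (\<eta> k) u * quantile (\<sigma> (s n)) u"])
    show "AE u in UI. (\<lambda>n. ?h (\<eta> k) u * quantile (\<sigma> (s n)) u) \<longlonglongrightarrow> ?h (\<eta> k) u * quantile M u"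
      using AE_lim by eventually_elim (intro tendsto_intros)
  qed (use Q QM h \<sigma> in \<open>auto intro: L2_tail simp: tail_norm_def\<close>)
  have mid: "(\<lambda>n. L2_norm UI (\<lambda>u. (1 - ?h e u) * (quantile (\<sigma> (s n)) u - quantile M u))) \<longlonglongrightarrow> 0"
    if e: "0 < e" for e
  proof -
    define B where "B = R / sqrt e"
    have B: "\<bar>quantile \<mu> u\<bar> \<le> B" if "\<mu> \<in> P2" "L2_norm UI (quantile \<mu>) \<le> R" "e \<le> u" "u \<le> 1 - e" for \<mu> u
      using quantile_bound[OF that(1) e that(3,4)] that(2) e by (simp add: B_def pos_le_divide_eq)
    have "(\<lambda>n. \<integral>u. ((1 - ?h e u) * (quantile (\<sigma> (s n)) u - quantile M u))\<^sup>2 \<partial>UI) \<longlonglongrightarrow> (\<integral>u. 0 \<partial>UI)"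
    proof (rule integral_dominated_convergence[where w="\<lambda>u. (2 * B)\<^sup>2"])
      show "AE u in UI. (\<lambda>n. ((1 - ?h e u) * (quantile (\<sigma> (s n)) u - quantile M u))\<^sup>2) \<longlonglongrightarrow> 0"
        using AE_lim by eventually_elim (auto intro!: tendsto_eq_intros)
      show "AE u in UI. norm (((1 - ?h e u) * (quantile (\<sigma> (s n)) u - quantile M u))\<^sup>2) \<le> (2 * B)\<^sup>2" for n
      proof (rule AE_I2)
        fix u
        have "\<bar>quantile (\<sigma> (s n)) u - quantile M u\<bar> \<le> \<bar>2 * B\<bar>" if "\<not> u < e" "\<not> 1 - e < u"
          using B[OF \<sigma>(1) nR, of u "s n"] B[OF MP, of u] tM[of 0] \<eta>(2) that
          by (auto simp: tail_norm_ge_1 R_def)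
        then show "norm (((1 - ?h e u) * (quantile (\<sigma> (s n)) u - quantile M u))\<^sup>2) \<le> (2 * B)\<^sup>2"
          unfolding abs_le_square_iff by (auto simp: indicator_def)
      qed
    qed (use L2_measurable[OF Q] QM h in auto)
    then show ?thesis unfolding L2_norm_def using tendsto_real_sqrt by fastforce
  qed
  have "(\<lambda>n. W2 (\<sigma> (s n)) M) \<longlonglongrightarrow> 0"
  proof (rule LIMSEQ_I)
    fix \<epsilon> :: real assume \<epsilon>: "0 < \<epsilon>"
    have "\<forall>\<^sub>F k in sequentially. r k < \<epsilon> / 4" using r \<epsilon> order_tendstoD(2)[of r 0 _ "\<epsilon>/4"] by simp
    then obtain k where k: "r k < \<epsilon> / 4" using eventually_happens[of _ sequentially] by auto
    let ?e = "\<eta> k"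
    let ?m = "\<lambda>n. L2_norm UI (\<lambda>u. (1 - ?h ?e u) * (quantile (\<sigma> (s n)) u - quantile M u))"
    have "\<forall>\<^sub>F n in sequentially. ?m n < \<epsilon> / 4"
      using mid[OF \<eta>(1)] \<epsilon> order_tendstoD(2)[of ?m 0 _ "\<epsilon>/4"] by simp
    then obtain N where N: "\<And>n. n \<ge> N \<Longrightarrow> ?m n < \<epsilon> / 4" by (auto simp: eventually_sequentially)
    have "norm (W2 (\<sigma> (s n)) M - 0) < \<epsilon>" if "n \<ge> N" for n
    proof -
      have L: "(\<lambda>u. quantile (\<sigma> (s n)) u - quantile M u) \<in> L2 UI"
        using \<sigma> MP by (intro L2_diff quantile_L2) auto
      have t: "(\<lambda>u. ?h ?e u * quantile \<mu> u) \<in> L2 UI" if "\<mu> \<in> P2" for \<mu>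
        using that by (intro L2_tail quantile_L2)
      have m: "(\<lambda>u. (1 - ?h ?e u) * (quantile (\<sigma> (s n)) u - quantile M u)) \<in> L2 UI"
        by (intro L2_bounded_mult[where C=1] L borel_measurable_diff borel_measurable_const h) (auto simp: indicator_def)
      have "W2 (\<sigma> (s n)) M = L2_norm UI (\<lambda>u. ((?h ?e u * quantile (\<sigma> (s n)) u - ?h ?e u * quantile M u)
          + (1 - ?h ?e u) * (quantile (\<sigma> (s n)) u - quantile M u)))"
        using \<sigma> MP by (simp add: W2_eq_L2_norm algebra_simps)
      also have "\<dots> \<le> L2_norm UI (\<lambda>u. ?h ?e u * quantile (\<sigma> (s n)) u - ?h ?e u * quantile M u) + ?m n"
        using \<sigma> MP t by (intro L2_norm_triangle m L2_diff) auto
      also have "L2_norm UI (\<lambda>u. ?h ?e u * quantile (\<sigma> (s n)) u - ?h ?e u * quantile M u)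
          \<le> tail_norm ?e (\<sigma> (s n)) + tail_norm ?e M"
        using L2_norm_triangle[OF t[OF \<sigma>(1)] L2_cmult[OF t[OF MP], of "-1"]]
          L2_norm_cmult[of UI "-1" "\<lambda>u. ?h ?e u * quantile M u"]
        by (simp add: tail_norm_def)
      finally have "W2 (\<sigma> (s n)) M \<le> tail_norm ?e (\<sigma> (s n)) + tail_norm ?e M + ?m n" by simp
      then have "W2 (\<sigma> (s n)) M < \<epsilon>"
        using N[OF that] \<sigma>(2)[of k "s n"] tM[of k] k \<epsilon> by linarith
      then show ?thesis by simp
    qed
    then show "\<exists>N. \<forall>n\<ge>N. norm (W2 (\<sigma> (s n)) M - 0) < \<epsilon>" by blast
  qed
  then have "limitin P2.mtopology (\<sigma> \<circ> s) M sequentially"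
    using \<sigma> MP by (simp add: P2.limitin_metric_dist_null)
  then show "\<exists>l s. l \<in> ?K \<and> strict_mono s \<and> limitin P2.mtopology (\<sigma> \<circ> s) l sequentially"
    using MP tM s by (intro exI[of _ M] exI[of _ s]) auto
qed auto

text \<open>Quantile functions clipped to \<open>[-c, c]\<close> lie in the compact set
  \<open>K c\<close>: both ends together have length at most \<open>2 * e\<close>, so their norm is
  at most \<open>c * sqrt (2 * e)\<close>, here with \<open>e = 1 / Suc k\<close>. Finite nets of
  the sets \<open>K c\<close> are countable in total, and clipping converges in \<open>W2\<close>.
  Separability is needed for the measurability of barycenters.\<close>

lemma separable_P2:
  obtains D where "countable D" "D \<subseteq> P2" "\<And>\<mu> \<epsilon>. \<mu> \<in> P2 \<Longrightarrow> \<epsilon> > 0 \<Longrightarrow> \<exists>d\<in>D. W2 \<mu> d < \<epsilon>"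
proof -
  define K where "K c = {\<mu>\<in>P2. \<forall>k. tail_norm (1 / real (Suc k)) \<mu> \<le> real c * sqrt (2 / real (Suc k))}" for c
  have "compactin P2_topology (K c)" for c
    unfolding K_def
  proof (rule compactin_tail_norm)
    have "(\<lambda>k. real c * sqrt (2 / real (Suc k))) \<longlonglongrightarrow> real c * sqrt (2 * 0)"
      using LIMSEQ_inverse_real_of_nat by (intro tendsto_intros) (simp_all add: divide_inverse tendsto_mult_right_zero)
    then show "(\<lambda>k. real c * sqrt (2 / real (Suc k))) \<longlonglongrightarrow> 0" by simp
  qed auto
  then have "P2.mtotally_bounded (K c)" for c
    unfolding P2_topology_def by (rule P2.compactin_imp_mtotally_bounded)
  then have "\<exists>N. finite N \<and> N \<subseteq> K c \<and> K c \<subseteq> (\<Union>x\<in>N. P2.mball x (1 / real (Suc m)))" for c m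
    by (simp add: P2.mtotally_bounded_def)
  then obtain N where N: "\<And>c m. finite (N c m)" "\<And>c m. N c m \<subseteq> K c"
    "\<And>c m. K c \<subseteq> (\<Union>x\<in>N c m. P2.mball x (1 / real (Suc m)))"
    by metis
  have "\<exists>d\<in>(\<Union>c m. N c m). W2 \<mu> d < \<epsilon>" if \<mu>: "\<mu> \<in> P2" and \<epsilon>: "\<epsilon> > 0" for \<mu> \<epsilon>
  proof -
    define g where "g c u = max (- real c) (min (real c) (quantile \<mu> u))" for c :: nat and u
    have ql: "quantile_like (quantile \<mu>)" using \<mu> by (simp add: quantile_like_quantile real_distribution_P2)
    have qg: "quantile_like (g c)" for c
      unfolding quantile_like_def g_def
    proof (intro conjI ballI mono_onI)
      fix u v :: real assume "u \<in> {0<..<1}" "v \<in> {0<..<1}" "u \<le> v"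
      then have "quantile \<mu> u \<le> quantile \<mu> v" using ql by (auto simp: quantile_like_def intro: mono_onD)
      then show "max (- real c) (min (real c) (quantile \<mu> u)) \<le> max (- real c) (min (real c) (quantile \<mu> v))"
        by auto
    qed (use ql in \<open>auto simp: quantile_like_def intro!: continuous_intros\<close>)
    have gmeas: "g c \<in> borel_measurable UI" for c
      using qg mono_on_measurable_UI by (auto simp: quantile_like_def)
    have gL: "g c \<in> L2 UI" for c
    proof -
      have "norm ((g c u)\<^sup>2) \<le> (real c)\<^sup>2" for u
        using abs_le_square_iff[of "g c u" "real c"] by (auto simp: g_def)
      then have "integrable UI (\<lambda>u. (g c u)\<^sup>2)"
        using gmeas by (intro UI.integrable_const_bound[of _ "(real c)\<^sup>2"]) auto
      then show ?thesis using gmeas by (simp add: L2_def)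
    qed
    define \<rho> where "\<rho> c = distr UI borel (g c)" for c
    have \<rho>: "\<rho> c \<in> P2" for c using gL gmeas by (simp add: \<rho>_def distr_UI_P2_iff)
    have q\<rho>: "u \<in> {0<..<1} \<Longrightarrow> quantile (\<rho> c) u = g c u" for c u
      unfolding \<rho>_def by (rule quantile_distr_UI[OF qg])
    have "\<rho> c \<in> K c" for c
    proof -
      have "tail_norm e (\<rho> c) \<le> real c * sqrt (2 * e)" if e: "e > 0" for e
      proof -
        let ?S = "({..<e} \<union> {1 - e<..}) \<inter> {0<..<1}"
        have S: "?S \<in> sets UI" by (auto simp: sets_UI_iff)
        have "emeasure UI ?S \<le> emeasure lborel ({0<..<e} \<union> {1-e<..<1})"
          by (subst emeasure_UI) (auto intro!: emeasure_mono)
        also have "\<dots> \<le> emeasure lborel {0<..<e} + emeasure lborel {1-e<..<1}"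
          by (intro emeasure_subadditive) auto
        also have "\<dots> = ennreal (2 * e)" using e by (simp flip: ennreal_plus)
        finally have mS: "measure UI ?S \<le> 2 * e"
          using e by (simp add: UI.emeasure_eq_measure)
        have "tail_norm e (\<rho> c) \<le> L2_norm UI (\<lambda>u. indicator ?S u * real c)"
          unfolding tail_norm_def
        proof (rule L2_norm_mono)
          show "(\<lambda>u. indicator ?S u * real c) \<in> L2 UI"
            using S by (intro L2_bounded_mult[where C=1] borel_measurable_indicator)
              (auto simp: L2_def indicator_def)
          show "(\<lambda>u. indicator ({..<e} \<union> {1 - e<..}) u * quantile (\<rho> c) u) \<in> borel_measurable UI"
            using L2_measurable[OF L2_tail[OF quantile_L2[OF \<rho>]]] .
          show "AE u in UI. \<bar>indicator ({..<e} \<union> {1 - e<..}) u * quantile (\<rho> c) u\<bar> \<le> \<bar>indicator ?S u * real c\<bar>"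
            by (rule AE_I2) (auto simp: q\<rho> g_def indicator_def)
        qed
        also have "\<dots> = real c * sqrt (measure UI ?S)"
        proof -
          have "(\<lambda>u. (indicator ?S u * real c)\<^sup>2) = (\<lambda>u. indicator ?S u * (real c)\<^sup>2)"
            by (auto simp: indicator_def)
          then show ?thesis using S by (simp add: L2_norm_def real_sqrt_mult Int_assoc)
        qed
        also have "\<dots> \<le> real c * sqrt (2 * e)" using mS by (intro mult_left_mono) auto
        finally show ?thesis .
      qed
      from this[of "1 / real (Suc _)"] show ?thesis using \<rho> by (auto simp: K_def)
    qed
    have "(\<lambda>c. W2 \<mu> (\<rho> c)) \<longlonglongrightarrow> 0"
    proof -
      have "(\<lambda>c. \<integral>u. (quantile \<mu> u - g c u)\<^sup>2 \<partial>UI) \<longlonglongrightarrow> (\<integral>u. 0 \<partial>UI)"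
      proof (rule integral_dominated_convergence[where w="\<lambda>u. (quantile \<mu> u)\<^sup>2"])
        show "AE u in UI. (\<lambda>c. (quantile \<mu> u - g c u)\<^sup>2) \<longlonglongrightarrow> 0"
        proof (rule AE_I2)
          fix u
          have "\<forall>\<^sub>F c in sequentially. (quantile \<mu> u - g c u)\<^sup>2 = 0"
            using eventually_ge_at_top[of "nat \<lceil>\<bar>quantile \<mu> u\<bar>\<rceil>"]
          proof eventually_elim
            case (elim c)
            then have "\<bar>quantile \<mu> u\<bar> \<le> real c" by linarith
            then show ?case by (auto simp: g_def)
          qed
          then show "(\<lambda>c. (quantile \<mu> u - g c u)\<^sup>2) \<longlonglongrightarrow> 0" by (rule tendsto_eventually)
        qed
        show "AE u in UI. norm ((quantile \<mu> u - g c u)\<^sup>2) \<le> (quantile \<mu> u)\<^sup>2" for c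
          by (rule AE_I2) (auto simp: g_def abs_le_square_iff[symmetric])
      qed (use gmeas L2_measurable[OF quantile_L2[OF \<mu>]] quantile_L2[OF \<mu>] in \<open>auto simp: L2_def\<close>)
      moreover have "W2 \<mu> (\<rho> c) = sqrt (\<integral>u. (quantile \<mu> u - g c u)\<^sup>2 \<partial>UI)" for c
        using \<mu> \<rho> by (auto simp: W2_eq_L2_norm L2_norm_def q\<rho> intro!: arg_cong[where f=sqrt] Bochner_Integration.integral_cong)
      ultimately show ?thesis using tendsto_real_sqrt by fastforce
    qed
    then have "\<forall>\<^sub>F c in sequentially. W2 \<mu> (\<rho> c) < \<epsilon> / 2"
      using \<epsilon> order_tendstoD(2)[of "\<lambda>c. W2 \<mu> (\<rho> c)" 0 _ "\<epsilon>/2"] by simp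
    then obtain c where c: "W2 \<mu> (\<rho> c) < \<epsilon> / 2" using eventually_happens[of _ sequentially] by auto
    obtain m where m: "1 / real (Suc m) < \<epsilon> / 2"
      using \<epsilon> by (metis half_gt_zero inverse_eq_divide reals_Archimedean)
    obtain d where d: "d \<in> N c m" "W2 d (\<rho> c) < 1 / real (Suc m)"
      using N(3)[of c m] \<open>\<rho> c \<in> K c\<close> by auto
    have "d \<in> P2" using d N(2)[of c m] by (auto simp: K_def)
    then have "W2 \<mu> d \<le> W2 \<mu> (\<rho> c) + W2 (\<rho> c) d" using \<mu> \<rho> by (intro P2.triangle) auto
    then have "W2 \<mu> d < \<epsilon>" using c d m P2.commute[of d "\<rho> c"] by simp
    then show ?thesis using d by blast
  qed
  moreover have "countable (\<Union>c m. N c m)" using N(1) by (simp add: countable_finite)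
  moreover have "(\<Union>c m. N c m) \<subseteq> P2" using N(2) by (fastforce simp: K_def)
  ultimately show ?thesis using that by blast
qed

section \<open>Absolutely continuous measures\<close>

lemma Wac_subset_P2: "Wac \<subseteq> P2"
  by (auto simp: Wac_def)

lemma Wac_null_sets:
  "\<nu> \<in> Wac \<Longrightarrow> N \<in> null_sets lborel \<Longrightarrow> N \<in> null_sets \<nu>"
  by (auto simp: Wac_def absolutely_continuous_def)

text \<open>The map \<open>quantile (barycenter n \<nu>) u \<mapsto> quantile (\<nu> 1) u\<close> is \<open>n\<close>-Lipschitz, hence it maps
  null sets to null sets.\<close>

proposition barycenter_Wac:
  assumes n: "n \<ge> 1" and \<nu>: "\<And>i. i \<in> {1..n} \<Longrightarrow> \<nu> i \<in> P2" and ac: "\<nu> 1 \<in> Wac"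
  shows "barycenter n \<nu> \<in> Wac"
proof -
  let ?q = "mean_quantile n \<nu>" and ?p = "quantile (\<nu> 1)"
  \<comment> \<open>The increment of \<open>?p\<close> is one of \<open>n\<close> nonnegative
    increments that add up to \<open>n\<close> times that of \<open>?q\<close>.\<close>
  have lip: "\<bar>?p u - ?p v\<bar> \<le> real n * \<bar>?q u - ?q v\<bar>" if "u \<in> {0<..<1}" "v \<in> {0<..<1}" for u v
    using that
  proof (induction u v rule: linorder_wlog)
    case (le u v)
    have mono: "quantile (\<nu> i) u \<le> quantile (\<nu> i) v" if "i \<in> {1..n}" for i
      using mono_onD[OF quantile_mono_on _ _ le(1)] le \<nu>[OF that] by (simp add: real_distribution_P2)
    have "?p v - ?p u \<le> (\<Sum>i=1..n. quantile (\<nu> i) v - quantile (\<nu> i) u)"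
      using n mono member_le_sum[of 1 "{1..n}" "\<lambda>i. quantile (\<nu> i) v - quantile (\<nu> i) u"] by auto
    also have "\<dots> = real n * (?q v - ?q u)"
      using n by (simp add: mean_quantile_def sum_subtractf right_diff_distrib)
    finally show ?case using mono[of 1] n
      by (smt (verit) atLeastAtMost_iff le_numeral_extra(4) mult_left_mono of_nat_0_le_iff)
  qed (simp add: abs_minus_commute)
  have pm: "?p \<in> borel_measurable UI" using n \<nu> by (intro quantile_measurable real_distribution_P2) simp
  have qm: "?q \<in> borel_measurable UI" using mean_quantile_L2[of n \<nu>, OF \<nu>] by (rule L2_measurable)
  have "null_sets lborel \<subseteq> null_sets (distr UI borel ?q)"
  proof
    fix N :: "real set" assume N: "N \<in> null_sets lborel"
    define A where "A = {u\<in>{0<..<1}. ?q u \<in> N}"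
    \<comment> \<open>On \<open>A\<close>, \<open>?p\<close> factors through \<open>?q\<close>: by
      \<open>lip\<close>, equal values of \<open>?q\<close> force equal values of \<open>?p\<close>,
      so the choice made by \<open>SOME\<close> does not matter.\<close>
    have "?p ` A = (\<lambda>y. ?p (SOME u. u \<in> A \<and> ?q u = y)) ` (?q ` A)" (is "_ = ?h ` _")
    proof -
      have "?h (?q u) = ?p u" if "u \<in> A" for u
      proof -
        have "\<exists>u'. u' \<in> A \<and> ?q u' = ?q u" using that by auto
        then have "(SOME u'. u' \<in> A \<and> ?q u' = ?q u) \<in> A \<and> ?q (SOME u'. u' \<in> A \<and> ?q u' = ?q u) = ?q u"
          by (rule someI_ex)
        then show ?thesis using lip[of "SOME u'. u' \<in> A \<and> ?q u' = ?q u" u] that by (auto simp: A_def)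
      qed
      then show ?thesis by (auto simp: image_image)
    qed
    moreover have "negligible (?h ` (?q ` A))"
    proof (rule negligible_locally_Lipschitz_image)
      show "negligible (?q ` A)"
        unfolding negligible_iff_null_sets null_sets_completion_iff2
        using N by (auto simp: A_def)
      fix x assume "x \<in> ?q ` A"
      have "norm (?h y - ?h x) \<le> real n * norm (y - x)" if y: "y \<in> ?q ` A" for y
      proof -
        have s: "(SOME u. u \<in> A \<and> ?q u = z) \<in> A \<and> ?q (SOME u. u \<in> A \<and> ?q u = z) = z" if "z \<in> ?q ` A" for z
          by (rule someI_ex) (use that in auto)
        show ?thesis using s[OF y] s[OF \<open>x \<in> ?q ` A\<close>]
            lip[of "SOME u. u \<in> A \<and> ?q u = y" "SOME u. u \<in> A \<and> ?q u = x"] by (auto simp: A_def)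
      qed
      then show "\<exists>T B. open T \<and> x \<in> T \<and> (\<forall>y\<in>?q ` A \<inter> T. norm (?h y - ?h x) \<le> B * norm (y - x))"
        by (intro exI[of _ UNIV] exI[of _ "real n"]) auto
    qed simp
    ultimately have "negligible (?p ` A)" by simp
    \<comment> \<open>The image of \<open>A\<close> need not be Borel; \<open>N'\<close> is a Borel
      null set around it.\<close>
    then obtain N' where N': "N' \<in> null_sets lborel" "?p ` A \<subseteq> N'"
      unfolding negligible_iff_null_sets null_sets_completion_iff2 by blast
    have "N' \<in> null_sets (distr UI borel ?p)"
      using Wac_null_sets[OF ac N'(1)] n \<nu>[of 1] by (simp add: distr_quantile real_distribution_P2)
    then have "emeasure UI (?p -` N' \<inter> {0<..<1}) = 0"
      using emeasure_distr[OF pm, of N'] N' by (auto simp: null_sets_def)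
    moreover have "?p -` N' \<inter> {0<..<1} \<in> sets UI"
      using measurable_sets[OF pm, of N'] N' by (simp add: null_sets_def)
    moreover have "?q -` N \<inter> {0<..<1} \<subseteq> ?p -` N' \<inter> {0<..<1}"
      using N'(2) by (auto simp: A_def image_subset_iff)
    ultimately have "emeasure UI (?q -` N \<inter> {0<..<1}) = 0"
      using emeasure_mono[of "?q -` N \<inter> {0<..<1}" "?p -` N' \<inter> {0<..<1}" UI] by simp
    then show "N \<in> null_sets (distr UI borel ?q)"
      using emeasure_distr[OF qm, of N] N by (auto simp: null_sets_def)
  qed
  moreover have "barycenter n \<nu> = distr UI borel ?q" by (rule barycenter_eq[OF n \<nu>])
  moreover have "barycenter n \<nu> \<in> P2" by (rule barycenter_P2[OF n \<nu>])
  ultimately show ?thesis by (simp add: Wac_def absolutely_continuous_def)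
qed

section \<open>Quantitative absolute continuity, and functionals that detect a singular part\<close>

text \<open>The epsilon-delta form of absolute continuity. If it failed along sets of length below
  \<open>(1/2)^n\<close>, their limsup would be a null set by Borel-Cantelli, yet continuity from
  above would give it mass at least \<open>\<kappa>\<close>.\<close>

lemma Wac_small_sets:
  assumes \<nu>: "\<nu> \<in> Wac" and \<kappa>: "\<kappa> > 0"
  obtains \<delta> :: real where "\<delta> > 0"
    "\<And>B. B \<in> sets borel \<Longrightarrow> emeasure lborel B < ennreal \<delta> \<Longrightarrow> measure \<nu> B < \<kappa>"
proof (rule ccontr)
  interpret real_distribution \<nu> using \<nu> by (auto simp: Wac_def P2_def)
  assume "\<not> thesis"
  then have "\<exists>B. B \<in> sets borel \<and> emeasure lborel B < ennreal ((1/2)^n) \<and> \<kappa> \<le> measure \<nu> B" for n :: nat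
    using that[of "(1/2)^n"] by (force simp: not_less)
  then obtain B where B: "\<And>n. B n \<in> sets borel" "\<And>n :: nat. emeasure lborel (B n) < ennreal ((1/2)^n)"
    "\<And>n. \<kappa> \<le> measure \<nu> (B n)" by metis
  have fin: "emeasure lborel (B n) < \<infinity>" for n using B(2)[of n] by (simp add: order.strict_trans)
  have "limsup B \<in> null_sets lborel"
  proof (rule borel_cantelli_limsup1)
    show "summable (\<lambda>n. measure lborel (B n))"
    proof (rule summable_comparison_test' [OF summable_geometric, of "1/2" 0])
      show "norm (measure lborel (B n)) \<le> (1/2) ^ n" for n
        using B(2)[of n] by (simp add: measure_def enn2real_leI)
    qed auto
  qed (use B fin in auto)
  then have "measure \<nu> (limsup B) = 0"
    using Wac_null_sets[OF \<nu>] by (simp add: measure_eq_0_null_sets)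
  moreover have "\<kappa> \<le> measure \<nu> (limsup B)"
  proof (rule LIMSEQ_le_const)
    have "limsup B = (\<Inter>n. \<Union>m\<in>{n..}. B m)" by (simp add: limsup_INF_SUP)
    moreover have "decseq (\<lambda>n. \<Union>m\<in>{n..}. B m)" unfolding decseq_def by (intro allI impI UN_mono) auto
    ultimately show "(\<lambda>n. measure \<nu> (\<Union>m\<in>{n..}. B m)) \<longlonglongrightarrow> measure \<nu> (limsup B)"
      using B by (auto intro!: finite_Lim_measure_decseq)
    have "\<kappa> \<le> measure \<nu> (\<Union>m\<in>{n..}. B m)" for n
      using B(3)[of n] by (rule order_trans) (intro finite_measure_mono, use B in auto)
    then show "\<exists>N. \<forall>n\<ge>N. \<kappa> \<le> measure \<nu> (\<Union>m\<in>{n..}. B m)" by blast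
  qed
  ultimately show False using \<kappa> by simp
qed
text \<open>The constant \<open>\<kappa>\<close> must not depend on \<open>\<epsilon>\<close>; it is
  half the mass of a bounded piece \<open>S\<close> of \<open>N\<close>. Countably many short
  intervals cover \<open>S\<close>, and by continuity from below finitely many of them already carry
  more than half of its mass. Half-open intervals are produced because their preimages under a
  quantile function are again half-open, with cdf values as endpoints.\<close>

lemma null_set_short_intervals:
  assumes "real_distribution \<mu>" and N: "N \<in> null_sets lborel" and pos: "0 < measure \<mu> N"
  obtains \<kappa> where "\<kappa> > 0"
    "\<And>\<epsilon>. \<epsilon> > 0 \<Longrightarrow> \<exists>F. finite F \<and> (\<forall>p\<in>F. fst p < snd p) \<and> (\<Sum>p\<in>F. snd p - fst p) \<le> \<epsilon>
        \<and> \<kappa> \<le> measure \<mu> (\<Union>p\<in>F. {fst p<..snd p :: real})"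
proof -
  interpret real_distribution \<mu> by fact
  have Nb: "N \<in> sets borel" using N by (simp add: null_sets_def)
  have "(\<lambda>k. measure \<mu> (N \<inter> {- real k..real k})) \<longlonglongrightarrow> measure \<mu> (\<Union>k. N \<inter> {- real k..real k})"
    using Nb by (intro finite_Lim_measure_incseq) (auto simp: incseq_def)
  also have "(\<Union>k. N \<inter> {- real k..real k}) = N"
  proof -
    have "\<exists>k. - real k \<le> x \<and> x \<le> real k" for x
      using real_arch_simple[of "\<bar>x\<bar>"] by (auto simp: abs_le_iff minus_le_iff)
    then show ?thesis by auto
  qed
  finally have "\<forall>\<^sub>F k in sequentially. 0 < measure \<mu> (N \<inter> {- real k..real k})"
    using pos order_tendstoD(1) by blast
  then obtain k where k: "0 < measure \<mu> (N \<inter> {- real k..real k})"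
    using eventually_happens[of _ sequentially] by auto
  \<comment> \<open>The covering theorem below asks for a set inside a box.\<close>
  define S where "S = N \<inter> {- real k..real k}"
  have "S \<in> null_sets lborel" using N unfolding S_def by (intro null_set_Int2) auto
  then have S0: "S \<in> null_sets lebesgue" using null_sets_completionI by blast
  then have Slm: "S \<in> lmeasurable" and Sm: "measure lebesgue S = 0"
    by (auto simp: negligible_iff_null_sets[symmetric] negligible_imp_measurable negligible_imp_measure0)
  show ?thesis
  proof (rule that)
    show "measure \<mu> S / 2 > 0" using k by (simp add: S_def)
    fix \<epsilon> :: real assume \<epsilon>: "\<epsilon> > 0"
    obtain \<D> where D: "countable \<D>" "\<And>K. K \<in> \<D> \<Longrightarrow> K \<subseteq> cbox (-real k) (real k) \<and> K \<noteq> {} \<and> (\<exists>c d. K = cbox c d)"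
        "pairwise (\<lambda>A B. interior A \<inter> interior B = {}) \<D>"
        "S \<subseteq> \<Union>\<D>" "\<Union>\<D> \<in> lmeasurable" "measure lebesgue (\<Union>\<D>) \<le> measure lebesgue S + \<epsilon> / 2"
      by (rule measurable_outer_intervals_bounded[OF Slm, of "-real k" "real k" "\<epsilon>/2"])
        (use \<epsilon> in \<open>auto simp: S_def\<close>)
    have "S \<noteq> {}" using k by (auto simp: S_def)
    then have Dne: "\<D> \<noteq> {}" using D(4) by auto
    define J where "J i = from_nat_into \<D> i" for i :: nat
    have J: "J i \<in> \<D>" for i unfolding J_def using Dne by (rule from_nat_into)
    have Jb: "J i \<in> sets borel" for i using D(2)[OF J[of i]] by auto
    have UJ: "(\<Union>i. J i) = \<Union>\<D>"
      using range_from_nat_into[OF Dne D(1)] by (simp add: J_def[abs_def])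
    have "(\<lambda>n. measure \<mu> (\<Union>i<n. J i)) \<longlonglongrightarrow> measure \<mu> (\<Union>n. \<Union>i<n. J i)"
      using Jb by (intro finite_Lim_measure_incseq) (auto simp: incseq_def, fastforce)
    also have "(\<Union>n. \<Union>i<n. J i) = \<Union>\<D>" unfolding UJ[symmetric] by auto
    finally have lim: "(\<lambda>n. measure \<mu> (\<Union>i<n. J i)) \<longlonglongrightarrow> measure \<mu> (\<Union>\<D>)" .
    have "measure \<mu> S / 2 < measure \<mu> S" using k by (simp add: S_def)
    also have "\<dots> \<le> measure \<mu> (\<Union>\<D>)"
      using D(4) Jb unfolding UJ[symmetric] by (intro finite_measure_mono) auto
    finally have "\<forall>\<^sub>F n in sequentially. measure \<mu> S / 2 < measure \<mu> (\<Union>i<n. J i)"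
      using order_tendstoD(1)[OF lim] by blast
    then obtain n where n: "measure \<mu> S / 2 < measure \<mu> (\<Union>i<n. J i)"
      using eventually_happens[of _ sequentially] by auto
    define G where "G = J ` {..<n}"
    have G: "finite G" "G \<subseteq> \<D>" using J by (auto simp: G_def)
    have sumG: "(\<Sum>K\<in>G. measure lebesgue K) \<le> \<epsilon> / 2"
    proof -
      \<comment> \<open>The intervals have disjoint interiors, so their overlaps are negligible and
        the lengths add up.\<close>
      have "(\<Sum>K\<in>G. measure lebesgue K) = measure lebesgue (\<Union>G)"
      proof (rule measure_negligible_finite_Union[symmetric])
        show "pairwise (\<lambda>S T. negligible (S \<inter> T)) G"
        proof (rule pairwiseI)
          fix A B assume AB: "A \<in> G" "B \<in> G" "A \<noteq> B"
          then have "interior (A \<inter> B) = {}" using D(3) G by (auto simp: pairwise_def)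
          moreover have "convex (A \<inter> B)"
            using D(2)[of A] D(2)[of B] AB G by (intro convex_Int) auto
          ultimately show "negligible (A \<inter> B)" by (simp add: negligible_convex_interior)
        qed
        show "S \<in> lmeasurable" if "S \<in> G" for S using D(2)[of S] that G by auto
      qed (use G in auto)
      also have "\<dots> \<le> measure lebesgue (\<Union>\<D>)"
        using G D(2) by (intro measure_mono_fmeasurable D(5) Union_mono fmeasurableD finite_Union) auto
      also have "\<dots> \<le> \<epsilon> / 2" using D(6) Sm by simp
      finally show ?thesis .
    qed
    \<comment> \<open>The other half of \<open>\<epsilon>\<close> pays for shifting every left
      endpoint by \<open>\<tau>\<close>, which turns closed and possibly degenerate intervals into
      half-open ones; the \<open>+ 1\<close> guards against an empty \<open>G\<close>.\<close>
    define \<tau> where "\<tau> = \<epsilon> / (2 * (real (card G) + 1))"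
    have \<tau>: "\<tau> > 0" "real (card G) * \<tau> \<le> \<epsilon> / 2" using \<epsilon> by (auto simp: \<tau>_def field_simps)
    have ex: "\<exists>p :: real \<times> real. K = {fst p..snd p} \<and> fst p \<le> snd p" if "K \<in> G" for K
    proof -
      have "K \<in> \<D>" using that G by auto
      from D(2)[OF this] obtain c d where "K = cbox c d" "K \<noteq> {}" by auto
      then show ?thesis by (intro exI[of _ "(c, d)"]) auto
    qed
    then obtain p :: "real set \<Rightarrow> real \<times> real"
      where p: "\<And>K. K \<in> G \<Longrightarrow> K = {fst (p K)..snd (p K)}" "\<And>K. K \<in> G \<Longrightarrow> fst (p K) \<le> snd (p K)"
      by metis
    define F where "F = (\<lambda>K. (fst (p K) - \<tau>, snd (p K))) ` G"
    have pt: "fst (p K) - \<tau> < snd (p K)" if "K \<in> G" for K using p(2)[OF that] \<tau> by linarith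
    have "(\<Sum>p\<in>F. snd p - fst p) \<le> (\<Sum>K\<in>G. snd (p K) - (fst (p K) - \<tau>))"
      unfolding F_def using pt G by (intro order_trans[OF sum_image_le]) (auto simp: comp_def less_imp_le)
    also have "\<dots> = (\<Sum>K\<in>G. measure lebesgue K + \<tau>)"
    proof (intro sum.cong refl)
      fix K assume K: "K \<in> G"
      have "measure lebesgue {fst (p K)..snd (p K)} = snd (p K) - fst (p K)"
        using p(2)[OF K] by simp
      then have "measure lebesgue K = snd (p K) - fst (p K)" using p(1)[OF K] by metis
      then show "snd (p K) - (fst (p K) - \<tau>) = measure lebesgue K + \<tau>" by simp
    qed
    also have "\<dots> \<le> \<epsilon>" using sumG \<tau> by (simp add: sum.distrib)
    finally have "(\<Sum>p\<in>F. snd p - fst p) \<le> \<epsilon>" .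
    moreover have "measure \<mu> S / 2 \<le> measure \<mu> (\<Union>p\<in>F. {fst p<..snd p})"
    proof -
      have "(\<Union>i<n. J i) = \<Union>G" by (auto simp: G_def)
      moreover have "\<Union>G \<subseteq> (\<Union>p\<in>F. {fst p<..snd p})"
      proof
        fix x assume "x \<in> \<Union>G"
        then obtain K where "K \<in> G" "x \<in> K" by auto
        moreover have "fst (p K) \<le> x" "x \<le> snd (p K)"
          using p(1)[OF \<open>K \<in> G\<close>] \<open>x \<in> K\<close> by (metis atLeastAtMost_iff)+
        ultimately show "x \<in> (\<Union>p\<in>F. {fst p<..snd p})"
          using \<tau> unfolding F_def by (intro UN_I[of "(fst (p K) - \<tau>, snd (p K))"]) auto
      qed
      ultimately have "measure \<mu> (\<Union>i<n. J i) \<le> measure \<mu> (\<Union>p\<in>F. {fst p<..snd p})"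
        using G by (intro finite_measure_mono) (auto simp: F_def)
      then show ?thesis using n by simp
    qed
    moreover have "finite F" "\<forall>p\<in>F. fst p < snd p" using G pt by (auto simp: F_def)
    ultimately show "\<exists>F. finite F \<and> (\<forall>p\<in>F. fst p < snd p) \<and> (\<Sum>p\<in>F. snd p - fst p) \<le> \<epsilon>
        \<and> measure \<mu> S / 2 \<le> measure \<mu> (\<Union>p\<in>F. {fst p<..snd p :: real})" by blast
  qed
qed

text \<open>On the quantile function of a measure, the test function of an interval \<open>(a, b)\<close> measures
  the average increment between \<open>(a, a + h)\<close> and \<open>(b - h, b)\<close>.\<close>

definition increment_test :: "real \<Rightarrow> real \<Rightarrow> real \<Rightarrow> real \<Rightarrow> real" where
  "increment_test h a b u = (indicator {b - h<..<b} u - indicator {a<..<a + h} u) / h"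

lemma increment_test_L2: "increment_test h a b \<in> L2_unit"
proof -
  have "(\<lambda>u. 1 / h * (indicator {b - h<..<b} u * 1 - indicator {a<..<a + h} u * 1)) \<in> L2 UI"
    by (intro L2_cmult L2_diff L2_bounded_mult[where C=1] measurable_UI_borel) (auto simp: L2_def indicator_def)
  then show ?thesis unfolding L2_unit_eq increment_test_def[abs_def] by simp
qed

lemma integrable_UI_indicator:
  assumes "f \<in> L2 UI" "S \<in> sets borel"
  shows "integrable UI (\<lambda>u. indicator S u * f u)"
proof -
  have "(\<lambda>u. indicator S u * f u) \<in> L2 UI"
    by (intro L2_bounded_mult[where C=1] assms measurable_UI_borel borel_measurable_indicator)
      (auto simp: indicator_def)
  from L2_mult_integrable[OF this, of "\<lambda>_. 1"] show ?thesis by (simp add: L2_def)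
qed

lemma integral_UI_interval_ge:
  fixes f :: "real \<Rightarrow> real"
  assumes f: "f \<in> L2 UI" and ab: "0 \<le> a" "a \<le> b" "b \<le> 1"
    and bd: "\<And>u. a < u \<Longrightarrow> u < b \<Longrightarrow> l \<le> f u"
  shows "(b - a) * l \<le> (\<integral>u. indicator {a<..<b} u * f u \<partial>UI)"
proof -
  have S: "{a<..<b} \<in> sets UI" using ab by (auto simp: sets_UI_iff)
  have "{a<..<b} \<inter> {0<..<1} = {a<..<b}" using ab by auto
  moreover have "measure UI {a<..<b} = b - a" using ab by (simp add: measure_def emeasure_UI subset_eq)
  ultimately have c: "(b - a) * l = (\<integral>u. indicator {a<..<b} u * l \<partial>UI)" using S by simp
  have i: "integrable UI (\<lambda>u. indicator {a<..<b} u * f u)" by (rule integrable_UI_indicator[OF f]) simp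
  have "integrable UI (\<lambda>u. indicator {a<..<b} u * l)"
    using S by (intro integrable_mult_left integrable_real_indicator) (auto simp: UI.emeasure_finite less_top[symmetric])
  then show ?thesis
    unfolding c using bd by (intro integral_mono i) (auto simp: indicator_def)
qed

lemma integral_UI_interval_le:
  fixes f :: "real \<Rightarrow> real"
  assumes "f \<in> L2 UI" "0 \<le> a" "a \<le> b" "b \<le> 1" "\<And>u. a < u \<Longrightarrow> u < b \<Longrightarrow> f u \<le> m"
  shows "(\<integral>u. indicator {a<..<b} u * f u \<partial>UI) \<le> (b - a) * m"
proof -
  have "(b - a) * (- m) \<le> (\<integral>u. indicator {a<..<b} u * (- 1 * f u) \<partial>UI)"
    using assms by (intro integral_UI_interval_ge L2_cmult) auto
  then show ?thesis by simp
qed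

text \<open>The upper bound serves the singular measure, whose quantile function maps the levels
  between \<open>a\<close> and \<open>b\<close> into one short interval. The lower bound serves
  arbitrary measures and is monotonicity on the two windows, which \<open>a + 2 * h \<le> b\<close>
  keeps apart.\<close>

lemma inner_increment_test:
  assumes \<nu>: "\<nu> \<in> P2" and h: "0 < h" and ab: "0 \<le> a" "a + 2 * h \<le> b" "b \<le> 1"
  shows "\<And>c d. (\<And>u. a < u \<Longrightarrow> u < b \<Longrightarrow> c \<le> quantile \<nu> u \<and> quantile \<nu> u \<le> d) \<Longrightarrow>
      inner_L2 (increment_test h a b) (quantile \<nu>) \<le> d - c"
    and "quantile \<nu> (b - h) - quantile \<nu> (a + h) \<le> inner_L2 (increment_test h a b) (quantile \<nu>)"
proof -
  let ?Q = "quantile \<nu>"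
  have Q: "?Q \<in> L2 UI" by (rule quantile_L2[OF \<nu>])
  have mono: "?Q u \<le> ?Q v" if "0 < u" "u \<le> v" "v < 1" for u v
    using mono_onD[OF quantile_mono_on[OF real_distribution_P2[OF \<nu>]], of u v] that by simp
  have i: "integrable UI (\<lambda>u. indicator {s<..<t} u * ?Q u)" for s t
    by (rule integrable_UI_indicator[OF Q]) simp
  have "inner_L2 (increment_test h a b) ?Q
      = (\<integral>u. (indicator {b-h<..<b} u * ?Q u - indicator {a<..<a+h} u * ?Q u) / h \<partial>UI)"
    unfolding inner_L2_eq increment_test_def
    by (intro Bochner_Integration.integral_cong refl) (simp add: left_diff_distrib)
  also have "\<dots> = ((\<integral>u. indicator {b-h<..<b} u * ?Q u \<partial>UI) - (\<integral>u. indicator {a<..<a+h} u * ?Q u \<partial>UI)) / h"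
    using i by simp
  finally have eq: "h * inner_L2 (increment_test h a b) ?Q
      = (\<integral>u. indicator {b-h<..<b} u * ?Q u \<partial>UI) - (\<integral>u. indicator {a<..<a+h} u * ?Q u \<partial>UI)"
    using h by simp
  show "inner_L2 (increment_test h a b) ?Q \<le> d - c"
    if "\<And>u. a < u \<Longrightarrow> u < b \<Longrightarrow> c \<le> ?Q u \<and> ?Q u \<le> d" for c d
  proof -
    have "(\<integral>u. indicator {b-h<..<b} u * ?Q u \<partial>UI) \<le> (b - (b - h)) * d"
      using h ab that by (intro integral_UI_interval_le[OF Q]) auto
    moreover have "((a + h) - a) * c \<le> (\<integral>u. indicator {a<..<a+h} u * ?Q u \<partial>UI)"
      using h ab that by (intro integral_UI_interval_ge[OF Q]) auto
    ultimately have "h * inner_L2 (increment_test h a b) ?Q \<le> h * (d - c)"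
      unfolding eq by (simp add: algebra_simps)
    then show ?thesis using h by simp
  qed
  have "(b - (b - h)) * ?Q (b - h) \<le> (\<integral>u. indicator {b-h<..<b} u * ?Q u \<partial>UI)"
    using h ab by (intro integral_UI_interval_ge[OF Q] mono) auto
  moreover have "(\<integral>u. indicator {a<..<a+h} u * ?Q u \<partial>UI) \<le> ((a + h) - a) * ?Q (a + h)"
    using h ab by (intro integral_UI_interval_le[OF Q] mono) auto
  ultimately have "h * (?Q (b - h) - ?Q (a + h)) \<le> h * inner_L2 (increment_test h a b) ?Q"
    unfolding eq by (simp add: algebra_simps)
  then show "?Q (b - h) - ?Q (a + h) \<le> inner_L2 (increment_test h a b) ?Q" using h by simp
qed

lemma inner_L2_sum_left:
  assumes "\<And>i. i \<in> I \<Longrightarrow> \<alpha> i \<in> L2_unit" "\<beta> \<in> L2_unit"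
  shows "inner_L2 (\<lambda>u. \<Sum>i\<in>I. \<alpha> i u) \<beta> = (\<Sum>i\<in>I. inner_L2 (\<alpha> i) \<beta>)"
proof -
  have "integrable UI (\<lambda>u. \<alpha> i u * \<beta> u)" if "i \<in> I" for i
    using assms that by (intro L2_mult_integrable) (auto simp: L2_unit_eq)
  then show ?thesis by (simp add: inner_L2_eq sum_distrib_right Bochner_Integration.integral_sum)
qed

lemma inner_L2_cmult_left: "inner_L2 (\<lambda>u. c * \<alpha> u) \<beta> = c * inner_L2 \<alpha> \<beta>"
  unfolding inner_L2_eq by (simp add: mult.assoc)

lemma measure_distr_quantile:
  assumes "real_distribution \<mu>" "B \<in> sets borel"
  shows "measure \<mu> B = measure UI {u\<in>{0<..<1}. quantile \<mu> u \<in> B}"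
    and "{u\<in>{0<..<1}. quantile \<mu> u \<in> B} \<in> sets UI"
proof -
  have eq: "quantile \<mu> -` B \<inter> space UI = {u\<in>{0<..<1}. quantile \<mu> u \<in> B}" by auto
  show "measure \<mu> B = measure UI {u\<in>{0<..<1}. quantile \<mu> u \<in> B}"
    using measure_distr[OF quantile_measurable[OF assms(1)] assms(2)] unfolding eq
    by (simp add: distr_quantile assms)
  show "{u\<in>{0<..<1}. quantile \<mu> u \<in> B} \<in> sets UI"
    using measurable_sets[OF quantile_measurable[OF assms(1)] assms(2)] unfolding eq .
qed

lemma measure_UI_le:
  assumes "A \<in> sets borel" "emeasure lborel A \<le> ennreal c" "0 \<le> c"
  shows "measure UI (A \<inter> {0<..<1}) \<le> c"
proof -
  have "emeasure UI (A \<inter> {0<..<1}) \<le> emeasure lborel A"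
    using assms by (subst emeasure_UI) (auto intro: emeasure_mono)
  also note assms(2)
  finally show ?thesis using assms(3) by (simp add: UI.emeasure_eq_measure)
qed

text \<open>The functional adds up increments over the intervals of levels that \<open>\<mu>\<close>
  sends into the short covering intervals. Levels do not depend on the measure: the trimmed
  intervals keep total length at least half the mass covered, and the quantile function of any other
  \<open>\<nu>\<close> maps them into a set \<open>B\<close> no longer than the value of the
  functional. A small value thus forces \<open>\<nu>\<close> to charge a short set.\<close>

proposition non_ac_test_functions:
  assumes \<mu>: "\<mu> \<in> P2" "\<mu> \<notin> Wac"
  obtains \<kappa> where "\<kappa> > 0"
    "\<And>\<epsilon>. \<epsilon> > 0 \<Longrightarrow> \<exists>\<alpha>\<in>L2_unit. inner_L2 \<alpha> (quantile \<mu>) \<le> \<epsilon> \<and>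
      (\<forall>\<nu>\<in>P2. 0 \<le> inner_L2 \<alpha> (quantile \<nu>) \<and> (\<exists>B\<in>sets borel. \<kappa> \<le> measure \<nu> B \<and>
         emeasure lborel B \<le> ennreal (inner_L2 \<alpha> (quantile \<nu>))))"
proof -
  have rd: "real_distribution \<mu>" using \<mu> by (simp add: real_distribution_P2)
  interpret real_distribution \<mu> by fact
  obtain N where N: "N \<in> null_sets lborel" "N \<notin> null_sets \<mu>"
    using \<mu> by (auto simp: Wac_def absolutely_continuous_def)
  then have "0 < measure \<mu> N"
    by (auto simp: null_sets_def emeasure_eq_measure less_le)
  then obtain \<kappa> where \<kappa>: "\<kappa> > 0"
    "\<And>\<epsilon>. \<epsilon> > 0 \<Longrightarrow> \<exists>F. finite F \<and> (\<forall>p\<in>F. fst p < snd p) \<and> (\<Sum>p\<in>F. snd p - fst p) \<le> \<epsilon>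
        \<and> \<kappa> \<le> measure \<mu> (\<Union>p\<in>F. {fst p<..snd p :: real})"
    using null_set_short_intervals[OF rd N(1)] by blast
  show ?thesis
  proof (rule that)
    show "\<kappa> / 2 > 0" using \<kappa> by simp
    fix \<epsilon> :: real assume "\<epsilon> > 0"
    from \<kappa>(2)[OF this] obtain F where F: "finite F" "\<And>p. p \<in> F \<Longrightarrow> fst p < snd p"
      "(\<Sum>p\<in>F. snd p - fst p) \<le> \<epsilon>" "\<kappa> \<le> measure \<mu> (\<Union>p\<in>F. {fst p<..snd p :: real})" by blast
    define a b where "a p = cdf \<mu> (fst p)" and "b p = cdf \<mu> (snd p)" for p :: "real \<times> real"
    \<comment> \<open>Removing two windows of length \<open>h\<close> from each of the
      \<open>card F\<close> intervals costs at most \<open>\<kappa> / 2\<close>.\<close>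
    define h where "h = \<kappa> / (4 * (real (card F) + 1))"
    have h: "h > 0" "real (card F) * (2 * h) \<le> \<kappa> / 2" using \<kappa> by (auto simp: h_def field_simps)
    \<comment> \<open>Intervals too short for two windows are dropped; they lie inside the removed
      sets \<open>R p\<close>, so this loss is already accounted for.\<close>
    define G where "G = {p\<in>F. a p + 2 * h \<le> b p}"
    have G: "finite G" "G \<subseteq> F" using F by (auto simp: G_def)
    have ab: "0 \<le> a p" "b p \<le> 1" for p by (auto simp: a_def b_def cdf_nonneg cdf_bounded_prob)
    have Gab: "a p + 2 * h \<le> b p" if "p \<in> G" for p using that by (simp add: G_def)
    have iff: "quantile \<mu> u \<in> {fst p<..snd p} \<longleftrightarrow> a p < u \<and> u \<le> b p" if "0 < u" "u < 1" for u p
      using quantile_le_iff[OF rd that, of "snd p"] quantile_le_iff[OF rd that, of "fst p"]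
      by (auto simp: a_def b_def)
    define \<alpha> where "\<alpha> u = (\<Sum>p\<in>G. increment_test h (a p) (b p) u)" for u
    have \<alpha>: "\<alpha> \<in> L2_unit"
      using increment_test_L2 unfolding \<alpha>_def[abs_def] L2_unit_eq by (intro L2_sum)
    have inner: "inner_L2 \<alpha> (quantile \<nu>) = (\<Sum>p\<in>G. inner_L2 (increment_test h (a p) (b p)) (quantile \<nu>))"
      if "\<nu> \<in> P2" for \<nu>
      unfolding \<alpha>_def[abs_def] using that
      by (intro inner_L2_sum_left increment_test_L2) (simp add: L2_unit_eq quantile_L2)
    have "inner_L2 \<alpha> (quantile \<mu>) \<le> (\<Sum>p\<in>G. snd p - fst p)"
      unfolding inner[OF \<mu>(1)]
    proof (intro sum_mono inner_increment_test(1)[OF \<mu>(1) h(1) ab(1) Gab ab(2)])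
      fix p u assume "p \<in> G" "a p < u" "u < b p"
      then show "fst p \<le> quantile \<mu> u \<and> quantile \<mu> u \<le> snd p"
        using iff[of u p] ab[of p] by auto
    qed
    also have "\<dots> \<le> (\<Sum>p\<in>F. snd p - fst p)" using F G by (intro sum_mono2) (auto simp: less_imp_le)
    also note F(3)
    finally have "inner_L2 \<alpha> (quantile \<mu>) \<le> \<epsilon>" .
    moreover have "0 \<le> inner_L2 \<alpha> (quantile \<nu>) \<and> (\<exists>B\<in>sets borel. \<kappa> / 2 \<le> measure \<nu> B \<and>
         emeasure lborel B \<le> ennreal (inner_L2 \<alpha> (quantile \<nu>)))" if \<nu>: "\<nu> \<in> P2" for \<nu>
    proof -
      let ?Q = "quantile \<nu>"
      have mono: "?Q u \<le> ?Q v" if "0 < u" "u \<le> v" "v < 1" for u v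
        using mono_onD[OF quantile_mono_on[OF real_distribution_P2[OF \<nu>]], of u v] that by simp
      have incr: "?Q (a p + h) \<le> ?Q (b p - h)" if "p \<in> G" for p
        using that h ab[of p] Gab[of p] by (intro mono) auto
      define B where "B = (\<Union>p\<in>G. {?Q (a p + h)..?Q (b p - h)})"
      define V where "V = (\<Union>p\<in>G. {a p + h..b p - h}) \<inter> {0<..<1}"
      define R where "R p = ({a p<..<a p + h} \<union> {b p - h<..b p}) \<inter> {0<..<1}" for p
      have B: "B \<in> sets borel" using G by (auto simp: B_def)
      have sum_le: "(\<Sum>p\<in>G. ?Q (b p - h) - ?Q (a p + h)) \<le> inner_L2 \<alpha> ?Q"
        unfolding inner[OF \<nu>] by (intro sum_mono inner_increment_test(2)[OF \<nu> h(1) ab(1) Gab ab(2)])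
      have "emeasure lborel B \<le> (\<Sum>p\<in>G. emeasure lborel {?Q (a p + h)..?Q (b p - h)})"
        unfolding B_def using G by (intro emeasure_subadditive_finite) auto
      also have "\<dots> = (\<Sum>p\<in>G. ennreal (?Q (b p - h) - ?Q (a p + h)))"
        using incr by (intro sum.cong) auto
      also have "\<dots> = ennreal (\<Sum>p\<in>G. ?Q (b p - h) - ?Q (a p + h))"
        using incr by (intro sum_ennreal) auto
      also have "\<dots> \<le> ennreal (inner_L2 \<alpha> ?Q)" using sum_le by (rule ennreal_leI)
      finally have eB: "emeasure lborel B \<le> ennreal (inner_L2 \<alpha> ?Q)" .
      have "0 \<le> (\<Sum>p\<in>G. ?Q (b p - h) - ?Q (a p + h))" using incr by (intro sum_nonneg) auto
      then have nonneg: "0 \<le> inner_L2 \<alpha> ?Q" using sum_le by simp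
      have Vs: "V \<in> sets UI" "R p \<in> sets UI" for p using G by (auto simp: V_def R_def sets_UI_iff)
      have mR: "measure UI (R p) \<le> 2 * h" for p
        unfolding R_def
      proof (rule measure_UI_le)
        have "emeasure lborel ({a p<..<a p + h} \<union> {b p - h<..b p})
            \<le> emeasure lborel {a p<..<a p + h} + emeasure lborel {b p - h<..b p}"
          by (intro emeasure_subadditive) auto
        also have "\<dots> = ennreal (2 * h)" using h by (simp flip: ennreal_plus)
        finally show "emeasure lborel ({a p<..<a p + h} \<union> {b p - h<..b p}) \<le> ennreal (2 * h)" .
      qed (use h in auto)
      have Fb: "(\<Union>p\<in>F. {fst p<..snd p}) \<in> sets borel" using F(1) by (intro sets.finite_UN) auto
      have "\<kappa> \<le> measure UI {u\<in>{0<..<1}. quantile \<mu> u \<in> (\<Union>p\<in>F. {fst p<..snd p})}"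
        using F(4) unfolding measure_distr_quantile(1)[OF rd Fb] .
      also have "\<dots> \<le> measure UI (V \<union> (\<Union>p\<in>F. R p))"
      proof (rule UI.finite_measure_mono)
        show "{u\<in>{0<..<1}. quantile \<mu> u \<in> (\<Union>p\<in>F. {fst p<..snd p})} \<subseteq> V \<union> (\<Union>p\<in>F. R p)"
        proof
          fix u assume "u \<in> {u\<in>{0<..<1}. quantile \<mu> u \<in> (\<Union>p\<in>F. {fst p<..snd p})}"
          then obtain p where u: "0 < u" "u < 1" and p: "p \<in> F" "quantile \<mu> u \<in> {fst p<..snd p}" by auto
          have "a p < u" "u \<le> b p" using iff[OF u] p by auto
          show "u \<in> V \<union> (\<Union>p\<in>F. R p)"
          proof (cases "a p + h \<le> u \<and> u \<le> b p - h")
            case True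
            then have "p \<in> G" using p by (simp add: G_def)
            then show ?thesis using True u by (auto simp: V_def)
          next
            case False
            then have "u \<in> R p" using u \<open>a p < u\<close> \<open>u \<le> b p\<close> by (auto simp: R_def)
            then show ?thesis using p(1) by blast
          qed
        qed
      qed (use Vs F(1) in \<open>intro sets.Un sets.finite_UN\<close>)
      also have "\<dots> \<le> measure UI V + measure UI (\<Union>p\<in>F. R p)"
        using Vs F(1) by (intro measure_Un_le sets.finite_UN)
      also have "measure UI (\<Union>p\<in>F. R p) \<le> (\<Sum>p\<in>F. measure UI (R p))"
        using Vs F(1) by (intro measure_UNION_le)
      also have "\<dots> \<le> real (card F) * (2 * h)" using mR by (intro sum_bounded_above) 
      also note h(2)
      finally have "\<kappa> / 2 \<le> measure UI V" by simp
      also have "\<dots> \<le> measure UI {u\<in>{0<..<1}. ?Q u \<in> B}"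
      proof (rule UI.finite_measure_mono)
        show "V \<subseteq> {u\<in>{0<..<1}. ?Q u \<in> B}"
        proof
          fix u assume "u \<in> V"
          then obtain p where p: "p \<in> G" "a p + h \<le> u" "u \<le> b p - h" "0 < u" "u < 1" by (auto simp: V_def)
          then have "?Q (a p + h) \<le> ?Q u" "?Q u \<le> ?Q (b p - h)"
            using h ab[of p] by (auto intro!: mono)
          then show "u \<in> {u\<in>{0<..<1}. ?Q u \<in> B}" using p by (auto simp: B_def)
        qed
      qed (rule measure_distr_quantile(2)[OF real_distribution_P2[OF \<nu>] B])
      also have "\<dots> = measure \<nu> B" by (rule measure_distr_quantile(1)[OF real_distribution_P2[OF \<nu>] B, symmetric])
      finally show ?thesis using B eB nonneg by blast
    qed
    ultimately show "\<exists>\<alpha>\<in>L2_unit. inner_L2 \<alpha> (quantile \<mu>) \<le> \<epsilon> \<and>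
      (\<forall>\<nu>\<in>P2. 0 \<le> inner_L2 \<alpha> (quantile \<nu>) \<and> (\<exists>B\<in>sets borel. \<kappa> / 2 \<le> measure \<nu> B \<and>
         emeasure lborel B \<le> ennreal (inner_L2 \<alpha> (quantile \<nu>))))"
      using \<alpha> by blast
  qed
qed

section \<open>Laws on the Wasserstein space\<close>

locale wasserstein_law = prob_space P for P :: "real measure measure" +
  assumes sets_P: "sets P = sets (borel_of P2_topology)"
    and exp_moment: "\<exists>\<mu>\<in>P2. \<exists>l::real. l > 0 \<and> (\<integral>\<^sup>+\<rho>. ennreal (exp (l * (W2 \<mu> \<rho>)\<^sup>2)) \<partial>P) < \<infinity>"
    and prob_Wac: "measure P Wac = 1"
begin

lemma space_P [simp]: "space P = P2"
  using sets_eq_imp_space_eq[OF sets_P] by (simp add: space_borel_of)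

lemma measurable_P: "f \<in> borel_measurable (borel_of P2_topology) \<Longrightarrow> f \<in> borel_measurable P"
  using measurable_cong_sets[OF sets_P refl] by blast

lemma openin_sets_P: "openin P2_topology U \<Longrightarrow> U \<in> sets P"
  by (simp add: sets_P borel_of_open)

text \<open>Measurability follows from the hypothesis that \<open>Wac\<close> has measure 1, because
  \<open>measure\<close> is 0 on sets outside the sigma-algebra.\<close>

lemma Wac_sets [measurable]: "Wac \<in> sets P"
  using prob_Wac measure_notin_sets by fastforce

lemma AE_Wac: "AE \<nu> in P. \<nu> \<in> Wac"
  using prob_Wac Wac_sets prob_eq_1[OF Wac_sets] by simp

lemma inner_measurable: "\<alpha> \<in> L2_unit \<Longrightarrow> (\<lambda>\<nu>. inner_L2 \<alpha> (quantile \<nu>)) \<in> borel_measurable P"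
  by (intro measurable_P inner_L2_measurable)

lemma tail_measurable [measurable]: "tail_norm e \<in> borel_measurable P"
  by (intro measurable_P tail_norm_measurable)

text \<open>The norm is at most that of the centre plus the distance \<open>w\<close> to it, and
  completing the square gives
  \<open>\<bar>t\<bar> * w \<le> t\<^sup>2 / (4 * l) + l * w\<^sup>2\<close>; thus one
  square-exponential moment yields all exponential moments.\<close>

lemma exp_norm_integrable: "integrable P (\<lambda>\<nu>. exp (t * tail_norm 1 \<nu>))"
proof -
  obtain \<mu> l where \<mu>: "\<mu> \<in> P2" and l: "l > 0" and fin: "(\<integral>\<^sup>+\<rho>. ennreal (exp (l * (W2 \<mu> \<rho>)\<^sup>2)) \<partial>P) < \<infinity>"
    using exp_moment by blast
  have "W2 \<mu> \<in> borel_measurable (borel_of P2_topology)"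
  proof (rule Lipschitz_measurable_borel_of_P2)
    show "\<bar>W2 \<mu> \<rho> - W2 \<mu> \<rho>'\<bar> \<le> 1 * W2 \<rho> \<rho>'" if "\<rho> \<in> P2" "\<rho>' \<in> P2" for \<rho> \<rho>'
      using P2.triangle[OF \<mu> that] P2.triangle[OF \<mu> that(2,1)] P2.commute[of \<rho> \<rho>'] by simp
  qed
  then have [measurable]: "W2 \<mu> \<in> borel_measurable P" by (rule measurable_P)
  have "integrable P (\<lambda>\<rho>. exp (l * (W2 \<mu> \<rho>)\<^sup>2))"
    using fin by (intro integrableI_nonneg) auto
  then have int: "integrable P (\<lambda>\<rho>. exp (\<bar>t\<bar> * tail_norm 1 \<mu> + t\<^sup>2 / (4 * l)) * exp (l * (W2 \<mu> \<rho>)\<^sup>2))"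
    by simp
  show ?thesis
  proof (rule Bochner_Integration.integrable_bound[OF int])
    have "exp (t * tail_norm 1 \<rho>) \<le> exp (\<bar>t\<bar> * tail_norm 1 \<mu> + t\<^sup>2 / (4 * l)) * exp (l * (W2 \<mu> \<rho>)\<^sup>2)"
      if \<rho>: "\<rho> \<in> P2" for \<rho>
    proof -
      let ?w = "W2 \<mu> \<rho>"
      have "t * tail_norm 1 \<rho> \<le> \<bar>t\<bar> * tail_norm 1 \<rho>" by (intro mult_right_mono) (auto simp: tail_norm_nonneg)
      also have "\<dots> \<le> \<bar>t\<bar> * (tail_norm 1 \<mu> + ?w)"
        using tail_norm_diff_le[OF \<mu> \<rho>, of 1] by (intro mult_left_mono) auto
      finally have "t * tail_norm 1 \<rho> \<le> \<bar>t\<bar> * (tail_norm 1 \<mu> + ?w)" .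
      moreover have "\<bar>t\<bar> * ?w \<le> t\<^sup>2 / (4 * l) + l * ?w\<^sup>2"
      proof -
        have "0 \<le> (\<bar>t\<bar> - 2 * l * ?w)\<^sup>2" by simp
        then have "4 * l * (\<bar>t\<bar> * ?w) \<le> 4 * l * (t\<^sup>2 / (4 * l) + l * ?w\<^sup>2)"
          using l by (simp add: power2_diff algebra_simps power2_eq_square)
        then show ?thesis using l by simp
      qed
      ultimately have "t * tail_norm 1 \<rho> \<le> (\<bar>t\<bar> * tail_norm 1 \<mu> + t\<^sup>2 / (4 * l)) + l * ?w\<^sup>2"
        by (simp add: distrib_left)
      then show ?thesis unfolding exp_add[symmetric] by simp
    qed
    then show "AE \<rho> in P. norm (exp (t * tail_norm 1 \<rho>))
        \<le> norm (exp (\<bar>t\<bar> * tail_norm 1 \<mu> + t\<^sup>2 / (4 * l)) * exp (l * (W2 \<mu> \<rho>)\<^sup>2))"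
      by (intro AE_I2) simp
  qed measurable
qed

lemma inner_bound:
  assumes "\<alpha> \<in> L2_unit" "\<nu> \<in> P2"
  shows "\<bar>inner_L2 \<alpha> (quantile \<nu>)\<bar> \<le> L2_norm UI \<alpha> * tail_norm 1 \<nu>"
  using assms unfolding inner_L2_eq tail_norm_ge_1[OF order_refl]
  by (intro L2_Cauchy_Schwarz quantile_L2) (simp add: L2_unit_eq)

lemma exp_bound_integrable:
  assumes "f \<in> borel_measurable P" "\<And>\<nu>. \<nu> \<in> P2 \<Longrightarrow> \<bar>f \<nu>\<bar> \<le> exp (t * tail_norm 1 \<nu>)"
  shows "integrable P f"
  using assms by (intro Bochner_Integration.integrable_bound[OF exp_norm_integrable[of t]]) auto

lemma exp_inner_integrable:
  assumes \<alpha>: "\<alpha> \<in> L2_unit"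
  shows "integrable P (\<lambda>\<nu>. exp (inner_L2 \<alpha> (quantile \<nu>)))"
proof (rule exp_bound_integrable[where t="L2_norm UI \<alpha>"])
  show "(\<lambda>\<nu>. exp (inner_L2 \<alpha> (quantile \<nu>))) \<in> borel_measurable P"
    using inner_measurable[OF \<alpha>] by measurable
  show "\<bar>exp (inner_L2 \<alpha> (quantile \<nu>))\<bar> \<le> exp (L2_norm UI \<alpha> * tail_norm 1 \<nu>)" if "\<nu> \<in> P2" for \<nu>
    using inner_bound[OF \<alpha> that] by simp
qed

lemma integral_exp_pos:
  fixes f :: "real measure \<Rightarrow> real"
  assumes "integrable P (\<lambda>\<nu>. exp (f \<nu>))"
  shows "0 < (\<integral>\<nu>. exp (f \<nu>) \<partial>P)"
proof -
  have "0 \<noteq> (\<integral>\<nu>. exp (f \<nu>) \<partial>P)"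
  proof
    assume "0 = (\<integral>\<nu>. exp (f \<nu>) \<partial>P)"
    then have "AE \<nu> in P. exp (f \<nu>) = 0"
      using integral_nonneg_eq_0_iff_AE[OF assms] by simp
    then show False by simp
  qed
  moreover have "0 \<le> (\<integral>\<nu>. exp (f \<nu>) \<partial>P)" by simp
  ultimately show ?thesis by linarith
qed

definition log_mgf :: "(real \<Rightarrow> real) \<Rightarrow> real" where
  "log_mgf \<alpha> = ln (\<integral>\<nu>. exp (inner_L2 \<alpha> (quantile \<nu>)) \<partial>P)"

lemma exp_log_mgf: "\<alpha> \<in> L2_unit \<Longrightarrow> exp (log_mgf \<alpha>) = (\<integral>\<nu>. exp (inner_L2 \<alpha> (quantile \<nu>)) \<partial>P)"
  unfolding log_mgf_def by (intro exp_ln integral_exp_pos exp_inner_integrable)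

lemma elog_log_mgf:
  assumes \<alpha>: "\<alpha> \<in> L2_unit"
  shows "elog (\<integral>\<^sup>+\<nu>\<in>Wac. ennreal (exp (inner_L2 \<alpha> (quantile \<nu>))) \<partial>P) = ereal (log_mgf \<alpha>)"
proof -
  have "(\<integral>\<^sup>+\<nu>\<in>Wac. ennreal (exp (inner_L2 \<alpha> (quantile \<nu>))) \<partial>P) = (\<integral>\<^sup>+\<nu>. ennreal (exp (inner_L2 \<alpha> (quantile \<nu>))) \<partial>P)"
    using AE_Wac by (intro nn_integral_cong_AE) (auto elim!: eventually_mono)
  also have "\<dots> = ennreal (exp (log_mgf \<alpha>))"
    unfolding exp_log_mgf[OF \<alpha>] using \<alpha> by (intro nn_integral_eq_integral exp_inner_integrable) auto
  finally show ?thesis by (simp add: elog_def)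
qed

lemma I_rate_eq: "I_rate P \<mu> = (SUP \<alpha>\<in>L2_unit. ereal (inner_L2 \<alpha> (quantile \<mu>) - log_mgf \<alpha>))"
  unfolding I_rate_def by (intro SUP_cong) (auto simp: elog_log_mgf)

lemma L2_unit_zero: "(\<lambda>_. 0) \<in> L2_unit"
  by (simp add: L2_unit_eq L2_def)

lemma I_rate_nonneg: "0 \<le> I_rate P \<mu>"
proof -
  have "ereal (inner_L2 (\<lambda>_. 0) (quantile \<mu>) - log_mgf (\<lambda>_. 0)) = 0"
    by (simp add: log_mgf_def inner_L2_eq prob_space[unfolded space_P])
  then show ?thesis unfolding I_rate_eq using L2_unit_zero by (metis (no_types, lifting) SUP_upper)
qed

text \<open>Multiples of the test functions at a measure that is not absolutely continuous show that the
  rate function, extended to \<^const>\<open>P2\<close> by the same formula, is infinite there; hence the effective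
  domain lies in \<^const>\<open>Wac\<close> although \<^const>\<open>Wac\<close> is not closed.\<close>

proposition rate_infinite_off_Wac:
  assumes \<mu>: "\<mu> \<in> P2" "\<mu> \<notin> Wac"
  shows "\<exists>\<alpha>\<in>L2_unit. c < inner_L2 \<alpha> (quantile \<mu>) - log_mgf \<alpha>"
proof -
  obtain \<kappa> where \<kappa>: "\<kappa> > 0" and
    test: "\<And>\<epsilon>. \<epsilon> > 0 \<Longrightarrow> \<exists>\<alpha>\<in>L2_unit. inner_L2 \<alpha> (quantile \<mu>) \<le> \<epsilon> \<and>
      (\<forall>\<nu>\<in>P2. 0 \<le> inner_L2 \<alpha> (quantile \<nu>) \<and> (\<exists>B\<in>sets borel. \<kappa> \<le> measure \<nu> B \<and>
         emeasure lborel B \<le> ennreal (inner_L2 \<alpha> (quantile \<nu>))))"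
    using non_ac_test_functions[OF \<mu>] by blast
  have "\<exists>\<alpha>. \<alpha>\<in>L2_unit \<and> inner_L2 \<alpha> (quantile \<mu>) \<le> 1 / real (Suc k) \<and>
      (\<forall>\<nu>\<in>P2. 0 \<le> inner_L2 \<alpha> (quantile \<nu>) \<and> (\<exists>B\<in>sets borel. \<kappa> \<le> measure \<nu> B \<and>
         emeasure lborel B \<le> ennreal (inner_L2 \<alpha> (quantile \<nu>))))" for k
    using test[of "1 / real (Suc k)"] by auto
  then obtain \<alpha> where \<alpha>: "\<And>k. \<alpha> k \<in> L2_unit" "\<And>k. inner_L2 (\<alpha> k) (quantile \<mu>) \<le> 1 / real (Suc k)"
    "\<And>k \<nu>. \<nu> \<in> P2 \<Longrightarrow> 0 \<le> inner_L2 (\<alpha> k) (quantile \<nu>) \<and> (\<exists>B\<in>sets borel. \<kappa> \<le> measure \<nu> B \<and>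
         emeasure lborel B \<le> ennreal (inner_L2 (\<alpha> k) (quantile \<nu>)))"
    by metis
  \<comment> \<open>On \<open>Wac\<close> this infimum is positive, though not uniformly in
    \<open>\<nu>\<close>. Being free of \<open>k\<close>, it majorises
    \<open>exp (- t * inner_L2 (\<alpha> k) (quantile \<nu>))\<close> by
    \<open>exp (- t * D \<nu>)\<close> for all \<open>k\<close> at once, so \<open>t\<close> can
    tend to infinity before the index is chosen.\<close>
  define D where "D \<nu> = (INF k. inner_L2 (\<alpha> k) (quantile \<nu>))" for \<nu>
  have bdd: "bdd_below (range (\<lambda>k. inner_L2 (\<alpha> k) (quantile \<nu>)))" if "\<nu> \<in> P2" for \<nu>
    using \<alpha>(3)[OF that] by (intro bdd_belowI[of _ 0]) auto
  have D_le: "D \<nu> \<le> inner_L2 (\<alpha> k) (quantile \<nu>)" if "\<nu> \<in> P2" for \<nu> k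
    unfolding D_def using bdd[OF that] by (intro cINF_lower) auto
  have D_nonneg: "0 \<le> D \<nu>" if "\<nu> \<in> P2" for \<nu>
    unfolding D_def using \<alpha>(3)[OF that] by (intro cINF_greatest) auto
  have D_pos: "0 < D \<nu>" if \<nu>: "\<nu> \<in> Wac" for \<nu>
  proof -
    have \<nu>P: "\<nu> \<in> P2" using \<nu> Wac_subset_P2 by auto
    obtain \<delta> where \<delta>: "\<delta> > 0" "\<And>B. B \<in> sets borel \<Longrightarrow> emeasure lborel B < ennreal \<delta> \<Longrightarrow> measure \<nu> B < \<kappa>"
      using Wac_small_sets[OF \<nu> \<kappa>] by blast
    \<comment> \<open>A value below \<open>\<delta>\<close> would put mass \<open>\<kappa>\<close>
      on a set shorter than \<open>\<delta>\<close>.\<close>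
    have "\<delta> \<le> inner_L2 (\<alpha> k) (quantile \<nu>)" for k
    proof (rule ccontr)
      assume "\<not> \<delta> \<le> inner_L2 (\<alpha> k) (quantile \<nu>)"
      then have lt: "ennreal (inner_L2 (\<alpha> k) (quantile \<nu>)) < ennreal \<delta>"
        using \<delta> by (intro ennreal_lessI) auto
      obtain B where "B \<in> sets borel" "\<kappa> \<le> measure \<nu> B" "emeasure lborel B \<le> ennreal (inner_L2 (\<alpha> k) (quantile \<nu>))"
        using \<alpha>(3)[OF \<nu>P] by blast
      then show False using \<delta>(2)[of B] le_less_trans[OF _ lt] by force
    qed
    then have "\<delta> \<le> D \<nu>" unfolding D_def by (intro cINF_greatest) auto
    then show ?thesis using \<delta> by simp
  qed
  have [measurable]: "D \<in> borel_measurable P"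
    unfolding D_def[abs_def] using bdd \<alpha>(1) by (intro borel_measurable_cINF inner_measurable) auto
  have "(\<lambda>t. \<integral>\<nu>. exp (- (real t * D \<nu>)) \<partial>P) \<longlonglongrightarrow> (\<integral>\<nu>. 0 \<partial>P)"
  proof (rule integral_dominated_convergence[where w="\<lambda>_. 1"])
    show "AE \<nu> in P. (\<lambda>t. exp (- (real t * D \<nu>))) \<longlonglongrightarrow> 0"
      using AE_Wac
    proof eventually_elim
      case (elim \<nu>)
      have "(\<lambda>t. exp (- D \<nu>) ^ t) \<longlonglongrightarrow> 0" using D_pos[OF elim] by (intro LIMSEQ_realpow_zero) auto
      moreover have "exp (- D \<nu>) ^ t = exp (- (real t * D \<nu>))" for t by (simp add: exp_of_nat_mult[symmetric])
      ultimately show ?case by simp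
    qed
    show "AE \<nu> in P. norm (exp (- (real t * D \<nu>))) \<le> 1" for t
      using D_nonneg by (intro AE_I2) auto
  qed auto
  then have "\<forall>\<^sub>F t in sequentially. (\<integral>\<nu>. exp (- (real t * D \<nu>)) \<partial>P) < exp (- (c + 1))"
    by (intro order_tendstoD(2)[of _ 0]) auto
  then obtain t where t: "(\<integral>\<nu>. exp (- (real t * D \<nu>)) \<partial>P) < exp (- (c + 1))"
    using eventually_happens[of _ sequentially] by auto
  \<comment> \<open>The number \<open>t\<close> is both factor and index: the value at
    \<open>\<mu>\<close> is then at least \<open>- t / (t + 1)\<close>, hence at least
    \<open>-1\<close>, and the \<open>c + 1\<close> in the choice of \<open>t\<close> makes up for
    this.\<close>
  let ?\<beta> = "\<lambda>u. (- real t) * \<alpha> t u"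
  have \<beta>: "?\<beta> \<in> L2_unit" using \<alpha>(1) L2_cmult unfolding L2_unit_eq by blast
  have in\<beta>: "inner_L2 ?\<beta> q = - (real t * inner_L2 (\<alpha> t) q)" for q
    unfolding inner_L2_cmult_left by simp
  have "exp (log_mgf ?\<beta>) \<le> (\<integral>\<nu>. exp (- (real t * D \<nu>)) \<partial>P)"
    unfolding exp_log_mgf[OF \<beta>]
  proof (rule integral_mono[OF exp_inner_integrable[OF \<beta>]])
    show "integrable P (\<lambda>\<nu>. exp (- (real t * D \<nu>)))"
      using D_nonneg by (intro integrable_const_bound[of _ 1] AE_I2) auto
    show "exp (inner_L2 ?\<beta> (quantile \<nu>)) \<le> exp (- (real t * D \<nu>))" if "\<nu> \<in> space P" for \<nu>
      unfolding in\<beta> using D_le[of \<nu> t] that by (auto intro!: mult_left_mono)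
  qed
  then have "log_mgf ?\<beta> < - (c + 1)" using t by (metis exp_less_cancel_iff le_less_trans)
  moreover have "inner_L2 ?\<beta> (quantile \<mu>) \<ge> - 1"
  proof -
    have "real t * inner_L2 (\<alpha> t) (quantile \<mu>) \<le> real t * (1 / real (Suc t))"
      using \<alpha>(2) by (intro mult_left_mono) auto
    also have "\<dots> \<le> 1" by simp
    finally show ?thesis unfolding in\<beta> by simp
  qed
  ultimately have "c < inner_L2 ?\<beta> (quantile \<mu>) - log_mgf ?\<beta>" by simp
  then show ?thesis using \<beta> by blast
qed

text \<open>The form in which the covering argument uses the rate: a strict half-space around every
  point of a closure in \<open>P2\<close>, where a lower bound on the rate is known on
  \<open>Wac\<close> alone.\<close>

lemma rate_test_function:
  assumes "\<mu> \<in> P2" "\<mu> \<in> Wac \<Longrightarrow> ereal c < I_rate P \<mu>"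
  shows "\<exists>\<alpha>\<in>L2_unit. c < inner_L2 \<alpha> (quantile \<mu>) - log_mgf \<alpha>"
  using assms rate_infinite_off_Wac[of \<mu> c] by (cases "\<mu> \<in> Wac") (auto simp: I_rate_eq less_SUP_iff)

end

section \<open>Independent samples\<close>

locale wasserstein_sample = law: wasserstein_law P + prob_space M
  for P :: "real measure measure" and M :: "'w measure" +
  fixes \<nu> :: "nat \<Rightarrow> 'w \<Rightarrow> real measure"
  assumes indep: "indep_vars (\<lambda>_. P) \<nu> {1..}"
    and distr_sample: "\<And>i. i \<ge> 1 \<Longrightarrow> distr M P (\<nu> i) = P"
begin

abbreviation bary :: "nat \<Rightarrow> 'w \<Rightarrow> real measure" where
  "bary n \<omega> \<equiv> barycenter n (\<lambda>i. \<nu> i \<omega>)"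

lemma sample_measurable: "i \<ge> 1 \<Longrightarrow> \<nu> i \<in> measurable M P"
  using indep by (simp add: indep_vars_def)

lemma sample_P2: "i \<ge> 1 \<Longrightarrow> \<omega> \<in> space M \<Longrightarrow> \<nu> i \<omega> \<in> P2"
  using measurable_space[OF sample_measurable] law.space_P by blast

lemma sample_integral:
  fixes f :: "real measure \<Rightarrow> real"
  assumes "i \<ge> 1" "f \<in> borel_measurable P"
  shows "(\<integral>\<omega>. f (\<nu> i \<omega>) \<partial>M) = (\<integral>\<mu>. f \<mu> \<partial>P)"
    and "integrable M (\<lambda>\<omega>. f (\<nu> i \<omega>)) \<longleftrightarrow> integrable P f"
  using integral_distr[OF sample_measurable[OF assms(1)] assms(2)]
    integrable_distr_eq[OF sample_measurable[OF assms(1)] assms(2)]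
  by (simp_all add: distr_sample[OF assms(1)])

lemma sample_prod:
  fixes f :: "nat \<Rightarrow> real measure \<Rightarrow> real"
  assumes f: "\<And>i. i \<in> {1..n} \<Longrightarrow> integrable P (f i)"
  shows "(\<integral>\<omega>. (\<Prod>i=1..n. f i (\<nu> i \<omega>)) \<partial>M) = (\<Prod>i=1..n. \<integral>\<mu>. f i \<mu> \<partial>P)"
    and "integrable M (\<lambda>\<omega>. \<Prod>i=1..n. f i (\<nu> i \<omega>))"
proof -
  have m: "f i \<in> borel_measurable P" if "i \<in> {1..n}" for i using f[OF that] by simp
  have "indep_vars (\<lambda>_. P) \<nu> {1..n}" using indep by (rule indep_vars_subset) auto
  then have ind: "indep_vars (\<lambda>_. borel) (\<lambda>i \<omega>. f i (\<nu> i \<omega>)) {1..n}"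
    by (rule indep_vars_compose2) (use m in auto)
  have int: "integrable M (\<lambda>\<omega>. f i (\<nu> i \<omega>))" if "i \<in> {1..n}" for i
    using sample_integral(2)[OF _ m[OF that]] f[OF that] that by simp
  have "(\<integral>\<omega>. (\<Prod>i=1..n. f i (\<nu> i \<omega>)) \<partial>M) = (\<Prod>i=1..n. \<integral>\<omega>. f i (\<nu> i \<omega>) \<partial>M)"
    by (rule indep_vars_lebesgue_integral[OF _ ind]) (use int in auto)
  also have "\<dots> = (\<Prod>i=1..n. \<integral>\<mu>. f i \<mu> \<partial>P)"
    using m by (intro prod.cong refl sample_integral(1)) auto
  finally show "(\<integral>\<omega>. (\<Prod>i=1..n. f i (\<nu> i \<omega>)) \<partial>M) = (\<Prod>i=1..n. \<integral>\<mu>. f i \<mu> \<partial>P)" .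
  show "integrable M (\<lambda>\<omega>. \<Prod>i=1..n. f i (\<nu> i \<omega>))"
    by (rule indep_vars_integrable[OF _ ind]) (use int in auto)
qed

lemma sum_sample_measurable:
  fixes f :: "real measure \<Rightarrow> real"
  assumes "f \<in> borel_measurable P"
  shows "(\<lambda>\<omega>. \<Sum>i=1..n. f (\<nu> i \<omega>)) \<in> borel_measurable M"
  by (intro borel_measurable_sum measurable_compose[OF sample_measurable assms]) simp

text \<open>The functional is general because the inequality serves both the half-spaces of the
  upper bound and the tail norms of exponential tightness.\<close>

lemma Chernoff:
  fixes X :: "real measure \<Rightarrow> real"
  assumes X: "X \<in> borel_measurable P" "integrable P (\<lambda>\<mu>. exp (X \<mu>))"
  shows "prob {\<omega>\<in>space M. real n * a \<le> (\<Sum>i=1..n. X (\<nu> i \<omega>))}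
    \<le> exp (- (real n * (a - ln (\<integral>\<mu>. exp (X \<mu>) \<partial>P))))"
proof -
  let ?S = "\<lambda>\<omega>. \<Sum>i=1..n. X (\<nu> i \<omega>)" and ?L = "\<integral>\<mu>. exp (X \<mu>) \<partial>P"
  let ?A = "{\<omega>\<in>space M. real n * a \<le> ?S \<omega>}"
  have [measurable]: "?S \<in> borel_measurable M" by (rule sum_sample_measurable[OF X(1)])
  have A: "?A \<in> sets M" by measurable
  have L: "?L > 0" by (rule law.integral_exp_pos[OF X(2)])
  have e: "exp (?S \<omega> - real n * a) = exp (- (real n * a)) * (\<Prod>i=1..n. exp (X (\<nu> i \<omega>)))" for \<omega>
    by (simp add: exp_diff exp_sum exp_minus divide_inverse mult.commute)
  have int: "integrable M (\<lambda>\<omega>. exp (?S \<omega> - real n * a))"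
    unfolding e using sample_prod(2)[of n "\<lambda>_ \<mu>. exp (X \<mu>)"] X(2) by simp
  have "prob ?A = (\<integral>\<omega>. indicator ?A \<omega> \<partial>M)" using A by simp
  also have "\<dots> \<le> (\<integral>\<omega>. exp (?S \<omega> - real n * a) \<partial>M)"
    by (intro integral_mono int integrable_real_indicator A)
      (auto simp: indicator_def less_top[symmetric] emeasure_finite)
  also have "\<dots> = exp (- (real n * a)) * ?L ^ n"
    unfolding e using sample_prod(1)[of n "\<lambda>_ \<mu>. exp (X \<mu>)"] X(2) by simp
  also have "?L ^ n = exp (real n * ln ?L)" using L by (simp add: exp_of_nat_mult)
  finally show ?thesis by (simp add: exp_add[symmetric] algebra_simps)
qed

lemma inner_bary:
  assumes "n \<ge> 1" "\<alpha> \<in> L2_unit" "\<omega> \<in> space M"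
  shows "real n * inner_L2 \<alpha> (quantile (bary n \<omega>)) = (\<Sum>i=1..n. inner_L2 \<alpha> (quantile (\<nu> i \<omega>)))"
proof -
  have "\<nu> i \<omega> \<in> P2" if "i \<in> {1..n}" for i using sample_P2 assms that by simp
  from inner_L2_barycenter[of n "\<lambda>i. \<nu> i \<omega>", OF assms(1) this assms(2)] show ?thesis
    using assms(1) by simp
qed

lemma bary_P2:
  assumes "n \<ge> 1" "\<omega> \<in> space M"
  shows "bary n \<omega> \<in> P2"
  using sample_P2 assms by (intro barycenter_P2) auto

lemma AE_bary_Wac:
  assumes "n \<ge> 1"
  shows "AE \<omega> in M. bary n \<omega> \<in> Wac"
proof -
  have eq: "{\<mu>\<in>P2. \<mu> \<in> Wac} = Wac" using Wac_subset_P2 by auto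
  have "AE \<mu> in distr M P (\<nu> 1). \<mu> \<in> Wac" by (simp only: distr_sample[OF order_refl] law.AE_Wac)
  then have "AE \<omega> in M. \<nu> 1 \<omega> \<in> Wac"
    by (subst (asm) AE_distr_iff[OF sample_measurable]) (simp_all add: eq)
  then show ?thesis
  proof (rule AE_mp, intro AE_I2 impI)
    fix \<omega> assume "\<omega> \<in> space M" "\<nu> 1 \<omega> \<in> Wac"
    then show "bary n \<omega> \<in> Wac" using sample_P2 assms by (intro barycenter_Wac) auto
  qed
qed

lemma inner_bary_measurable:
  assumes "n \<ge> 1" "\<alpha> \<in> L2_unit"
  shows "(\<lambda>\<omega>. inner_L2 \<alpha> (quantile (bary n \<omega>))) \<in> borel_measurable M"
proof -
  have "(\<lambda>\<omega>. 1 / real n * (\<Sum>i=1..n. inner_L2 \<alpha> (quantile (\<nu> i \<omega>)))) \<in> borel_measurable M"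
    using sum_sample_measurable[OF law.inner_measurable[OF assms(2)], of n] by measurable
  moreover have "inner_L2 \<alpha> (quantile (bary n \<omega>)) = 1 / real n * (\<Sum>i=1..n. inner_L2 \<alpha> (quantile (\<nu> i \<omega>)))"
    if "\<omega> \<in> space M" for \<omega>
    using inner_bary[OF assms that] assms(1) by (simp add: field_simps)
  ultimately show ?thesis by (simp cong: measurable_cong)
qed

end

section \<open>Borel measurability of maps into the Wasserstein space\<close>

lemma W2_power2:
  assumes "\<mu> \<in> P2" "\<rho> \<in> P2"
  shows "(W2 \<mu> \<rho>)\<^sup>2 = (tail_norm 1 \<mu>)\<^sup>2 + (tail_norm 1 \<rho>)\<^sup>2 - 2 * inner_L2 (quantile \<mu>) (quantile \<rho>)"
  using L2_norm_diff_power2[OF quantile_L2[OF assms(1)] quantile_L2[OF assms(2)]] assms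
  by (simp add: W2_eq_L2_norm tail_norm_ge_1 inner_L2_eq)

text \<open>Separability writes the norm as a countable supremum of affine functionals, so weak
  measurability implies measurability.\<close>

proposition measurable_borel_of_P2I:
  assumes f: "\<And>\<omega>. \<omega> \<in> space N \<Longrightarrow> f \<omega> \<in> P2"
    and weak: "\<And>\<alpha>. \<alpha> \<in> L2_unit \<Longrightarrow> (\<lambda>\<omega>. inner_L2 \<alpha> (quantile (f \<omega>))) \<in> borel_measurable N"
  shows "f \<in> measurable N (borel_of P2_topology)"
proof -
  obtain D where D: "countable D" "D \<subseteq> P2" "\<And>\<mu> \<epsilon>. \<mu> \<in> P2 \<Longrightarrow> \<epsilon> > 0 \<Longrightarrow> \<exists>d\<in>D. W2 \<mu> d < \<epsilon>"
    using separable_P2 by blast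
  have Dq: "quantile d \<in> L2_unit" if "d \<in> P2" for d using that by (simp add: L2_unit_eq quantile_L2)
  \<comment> \<open>The affine minorant of the squared norm that touches it at \<open>d\<close>. The
    gap at \<open>\<mu>\<close> is the squared distance from \<open>d\<close>, so the minorants from
    a dense set have the squared norm as supremum.\<close>
  let ?g = "\<lambda>d \<mu>. 2 * inner_L2 (quantile d) (quantile \<mu>) - (tail_norm 1 d)\<^sup>2"
  have g: "?g d \<mu> = (tail_norm 1 \<mu>)\<^sup>2 - (W2 d \<mu>)\<^sup>2" if "d \<in> P2" "\<mu> \<in> P2" for d \<mu>
    using W2_power2[OF that] by simp
  have norm: "(tail_norm 1 \<mu>)\<^sup>2 = (SUP d\<in>D. ?g d \<mu>)" if \<mu>: "\<mu> \<in> P2" for \<mu>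
  proof (rule antisym)
    have bdd: "bdd_above ((\<lambda>d. ?g d \<mu>) ` D)"
      using D(2) g[OF _ \<mu>] by (intro bdd_aboveI[of _ "(tail_norm 1 \<mu>)\<^sup>2"]) auto
    have ne: "D \<noteq> {}" using D(3)[OF \<mu>, of 1] by auto
    show "(SUP d\<in>D. ?g d \<mu>) \<le> (tail_norm 1 \<mu>)\<^sup>2"
      using D(2) g[OF _ \<mu>] by (intro cSUP_least ne) auto
    show "(tail_norm 1 \<mu>)\<^sup>2 \<le> (SUP d\<in>D. ?g d \<mu>)"
    proof (rule field_le_epsilon)
      fix e :: real assume e: "e > 0"
      then obtain d where d: "d \<in> D" "W2 \<mu> d < sqrt e" using D(3)[OF \<mu>, of "sqrt e"] by auto
      have "(W2 d \<mu>)\<^sup>2 < (sqrt e)\<^sup>2"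
        using d P2.commute[of d \<mu>] by (intro power_strict_mono) auto
      then have "(tail_norm 1 \<mu>)\<^sup>2 \<le> ?g d \<mu> + e" using g[of d \<mu>] d D(2) \<mu> e by auto
      also have "?g d \<mu> \<le> (SUP d\<in>D. ?g d \<mu>)" using d bdd by (intro cSUP_upper)
      finally show "(tail_norm 1 \<mu>)\<^sup>2 \<le> (SUP d\<in>D. ?g d \<mu>) + e" by simp
    qed
  qed
  have [measurable]: "(\<lambda>\<omega>. (tail_norm 1 (f \<omega>))\<^sup>2) \<in> borel_measurable N"
  proof (rule measurable_cong[THEN iffD1])
    show "(SUP d\<in>D. ?g d (f \<omega>)) = (tail_norm 1 (f \<omega>))\<^sup>2" if "\<omega> \<in> space N" for \<omega>
      using norm[OF f[OF that]] by simp
    show "(\<lambda>\<omega>. SUP d\<in>D. ?g d (f \<omega>)) \<in> borel_measurable N"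
    proof (rule borel_measurable_cSUP[OF D(1)])
      show "(\<lambda>\<omega>. ?g d (f \<omega>)) \<in> borel_measurable N" if "d \<in> D" for d
        using weak[OF Dq[of d]] that D(2) by auto
      show "bdd_above ((\<lambda>d. ?g d (f \<omega>)) ` D)" if "\<omega> \<in> space N" for \<omega>
        using D(2) g[OF _ f[OF that]] by (intro bdd_aboveI[of _ "(tail_norm 1 (f \<omega>))\<^sup>2"]) auto
    qed
  qed
  \<comment> \<open>By \<open>W2_power2\<close> the squared distance from a fixed \<open>d\<close>
    consists of the norm, measurable by now, and one inner product.\<close>
  have ball: "{\<omega>\<in>space N. W2 d (f \<omega>) < r} \<in> sets N" if d: "d \<in> P2" for d r
  proof (cases "r > 0")
    case True
    have [measurable]: "(\<lambda>\<omega>. inner_L2 (quantile d) (quantile (f \<omega>))) \<in> borel_measurable N"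
      by (rule weak[OF Dq[OF d]])
    have "{\<omega>\<in>space N. (tail_norm 1 d)\<^sup>2 + (tail_norm 1 (f \<omega>))\<^sup>2 - 2 * inner_L2 (quantile d) (quantile (f \<omega>)) < r\<^sup>2} \<in> sets N"
      by measurable
    also have "{\<omega>\<in>space N. (tail_norm 1 d)\<^sup>2 + (tail_norm 1 (f \<omega>))\<^sup>2 - 2 * inner_L2 (quantile d) (quantile (f \<omega>)) < r\<^sup>2}
        = {\<omega>\<in>space N. W2 d (f \<omega>) < r}"
      using True W2_power2[OF d f] power_less_imp_less_base[of "W2 d (f _)" 2 r]
        power_strict_mono[of "W2 d (f _)" r 2] by (auto simp flip: W2_power2[OF d f])
    finally show ?thesis .
  next
    case False
    have "{\<omega>\<in>space N. W2 d (f \<omega>) < r} = {}"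
      using False P2.nonneg by (auto simp: not_less intro: order_trans)
    then show ?thesis by (simp only: sets.empty_sets)
  qed
  have "f -` U \<inter> space N \<in> sets N" if U: "openin P2_topology U" for U
  proof -
    let ?I = "{(d, k). d \<in> D \<and> P2.mball d (1 / real (Suc k)) \<subseteq> U}"
    have "f -` U \<inter> space N = (\<Union>(d, k)\<in>?I. {\<omega>\<in>space N. W2 d (f \<omega>) < 1 / real (Suc k)})"
    proof (intro equalityI subsetI)
      fix \<omega> assume \<omega>: "\<omega> \<in> f -` U \<inter> space N"
      then obtain r where r: "r > 0" "P2.mball (f \<omega>) r \<subseteq> U"
        using U unfolding P2_topology_def P2.openin_mtopology by blast
      obtain k where k: "1 / real (Suc k) < r / 2"
        using r by (metis half_gt_zero inverse_eq_divide reals_Archimedean)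
      obtain d where d: "d \<in> D" "W2 (f \<omega>) d < 1 / real (Suc k)" using D(3)[of "f \<omega>" "1 / real (Suc k)"] f \<omega> by auto
      have "P2.mball d (1 / real (Suc k)) \<subseteq> P2.mball (f \<omega>) r"
      proof
        fix x assume "x \<in> P2.mball d (1 / real (Suc k))"
        then have x: "x \<in> P2" "d \<in> P2" "W2 d x < 1 / real (Suc k)" by auto
        have "W2 (f \<omega>) x \<le> W2 (f \<omega>) d + W2 d x" using x f \<omega> by (intro P2.triangle) auto
        then have "W2 (f \<omega>) x < r" using d x k by linarith
        then show "x \<in> P2.mball (f \<omega>) r" using x f \<omega> by auto
      qed
      then have "(d, k) \<in> ?I" using d r by blast
      then show "\<omega> \<in> (\<Union>(d, k)\<in>?I. {\<omega>\<in>space N. W2 d (f \<omega>) < 1 / real (Suc k)})"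
        using \<omega> d P2.commute[of d "f \<omega>"] by (intro UN_I[of "(d, k)"]) auto
    next
      fix \<omega> assume "\<omega> \<in> (\<Union>(d, k)\<in>?I. {\<omega>\<in>space N. W2 d (f \<omega>) < 1 / real (Suc k)})"
      then obtain d k where "d \<in> D" "P2.mball d (1 / real (Suc k)) \<subseteq> U" "\<omega> \<in> space N" "W2 d (f \<omega>) < 1 / real (Suc k)"
        by auto
      moreover have "f \<omega> \<in> P2.mball d (1 / real (Suc k))"
        using calculation D(2) f by auto
      ultimately show "\<omega> \<in> f -` U \<inter> space N" by auto
    qed
    moreover have "countable ?I"
      by (rule countable_subset[of _ "D \<times> UNIV"]) (use D(1) in auto)
    ultimately show ?thesis using ball D(2) by (auto intro!: sets.countable_UN')
  qed
  moreover have "{U. openin P2_topology U} \<subseteq> Pow P2"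
    using openin_subset[of P2_topology] by auto
  ultimately show ?thesis
    unfolding borel_of_def using f by (intro measurable_measure_of) auto
qed

section \<open>Exponential tightness and the upper bound\<close>

lemma tail_norm_le: "\<mu> \<in> P2 \<Longrightarrow> tail_norm e \<mu> \<le> tail_norm 1 \<mu>"
  unfolding tail_norm_ge_1[OF order_refl] unfolding tail_norm_def
  by (intro L2_norm_mono L2_measurable[OF L2_tail] quantile_L2) (auto simp: indicator_def)

lemma tail_norm_tendsto_0:
  assumes "\<mu> \<in> P2"
  shows "(\<lambda>j. tail_norm (1 / real (Suc j)) \<mu>) \<longlonglongrightarrow> 0"
proof -
  let ?h = "\<lambda>j. indicator ({..<1 / real (Suc j)} \<union> {1 - 1 / real (Suc j)<..}) :: real \<Rightarrow> real"
  have Q: "quantile \<mu> \<in> L2 UI" by (rule quantile_L2[OF assms])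
  have "(\<lambda>j. \<integral>u. (?h j u * quantile \<mu> u)\<^sup>2 \<partial>UI) \<longlonglongrightarrow> (\<integral>u. 0 \<partial>UI)"
  proof (rule integral_dominated_convergence[where w="\<lambda>u. (quantile \<mu> u)\<^sup>2"])
    show "(\<lambda>u. (?h j u * quantile \<mu> u)\<^sup>2) \<in> borel_measurable UI" for j
      using L2_measurable[OF L2_tail[OF Q]] by simp
    show "AE u in UI. (\<lambda>j. (?h j u * quantile \<mu> u)\<^sup>2) \<longlonglongrightarrow> 0"
    proof (rule AE_I2)
      fix u assume "u \<in> space UI"
      then have "0 < min u (1 - u)" by simp
      then have "\<forall>\<^sub>F j in sequentially. inverse (real (Suc j)) < min u (1 - u)"
        using order_tendstoD(2)[OF LIMSEQ_inverse_real_of_nat] by blast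
      then have "\<forall>\<^sub>F j in sequentially. (?h j u * quantile \<mu> u)\<^sup>2 = 0"
        by eventually_elim (auto simp: inverse_eq_divide indicator_def)
      then show "(\<lambda>j. (?h j u * quantile \<mu> u)\<^sup>2) \<longlonglongrightarrow> 0" by (rule tendsto_eventually)
    qed
    show "AE u in UI. norm ((?h j u * quantile \<mu> u)\<^sup>2) \<le> (quantile \<mu> u)\<^sup>2" for j
      by (rule AE_I2) (auto simp: indicator_def)
  qed (use Q in \<open>auto simp: L2_def\<close>)
  then show ?thesis
    unfolding tail_norm_def L2_norm_def using tendsto_real_sqrt by fastforce
qed

context wasserstein_law
begin

lemma exp_tail_integrable:
  assumes "0 \<le> t"
  shows "integrable P (\<lambda>\<mu>. exp (t * tail_norm e \<mu>))"
proof (rule exp_bound_integrable[where t=t])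
  show "\<bar>exp (t * tail_norm e \<mu>)\<bar> \<le> exp (t * tail_norm 1 \<mu>)" if "\<mu> \<in> P2" for \<mu>
    using mult_left_mono[OF tail_norm_le[OF that] assms] by simp
qed measurable

text \<open>Tail norms vanish pointwise as the ends shrink, so their moment generating function
  tends to 1. The point is the order of choices: \<open>t\<close> may be as large as desired, while
  the cumulant stays below a fixed constant.\<close>

lemma tail_mgf_le:
  assumes t: "0 \<le> t"
  obtains e where "0 < e" "ln (\<integral>\<mu>. exp (t * tail_norm e \<mu>) \<partial>P) \<le> 1"
proof -
  have "(\<lambda>j. \<integral>\<mu>. exp (t * tail_norm (1 / real (Suc j)) \<mu>) \<partial>P) \<longlonglongrightarrow> (\<integral>\<mu>. exp (t * 0) \<partial>P)"
  proof (rule integral_dominated_convergence[where w="\<lambda>\<mu>. exp (t * tail_norm 1 \<mu>)"])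
    show "AE \<mu> in P. (\<lambda>j. exp (t * tail_norm (1 / real (Suc j)) \<mu>)) \<longlonglongrightarrow> exp (t * 0)"
      by (intro AE_I2 tendsto_intros tail_norm_tendsto_0) simp
    show "AE \<mu> in P. norm (exp (t * tail_norm (1 / real (Suc j)) \<mu>)) \<le> exp (t * tail_norm 1 \<mu>)" for j
      using t by (intro AE_I2) (auto intro!: mult_left_mono tail_norm_le)
  qed (use exp_norm_integrable in auto)
  then have "\<forall>\<^sub>F j in sequentially. (\<integral>\<mu>. exp (t * tail_norm (1 / real (Suc j)) \<mu>) \<partial>P) < exp 1"
    using prob_space[unfolded space_P] by (intro order_tendstoD(2)) auto
  then obtain j where j: "(\<integral>\<mu>. exp (t * tail_norm (1 / real (Suc j)) \<mu>) \<partial>P) < exp 1"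
    using eventually_happens[of _ sequentially] by auto
  have "ln (\<integral>\<mu>. exp (t * tail_norm (1 / real (Suc j)) \<mu>) \<partial>P) \<le> ln (exp 1)"
    using j integral_exp_pos[OF exp_tail_integrable[OF t]] by (intro ln_mono) auto
  then show ?thesis by (intro that[of "1 / real (Suc j)"]) auto
qed

end

lemma compactin_P2_sets:
  assumes "compactin P2_topology K"
  shows "K \<in> sets (borel_of P2_topology)"
proof -
  have "closedin P2_topology K"
    using assms compactin_imp_closedin[OF P2.Hausdorff_space_mtopology] by (simp add: P2_topology_def)
  then have "openin P2_topology (P2 - K)" "K \<subseteq> P2" by (auto simp: closedin_def)
  then have "P2 - (P2 - K) \<in> sets (borel_of P2_topology)"
    using sets.compl_sets[OF borel_of_open, of P2_topology "P2 - K"] unfolding space_borel_of topspace_P2 by blast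
  then show ?thesis using \<open>K \<subseteq> P2\<close> by (simp add: double_diff)
qed

context wasserstein_sample
begin

lemma bary_measurable: "n \<ge> 1 \<Longrightarrow> bary n \<in> measurable M P"
  unfolding measurable_cong_sets[OF refl law.sets_P]
  by (intro measurable_borel_of_P2I bary_P2 inner_bary_measurable)

lemma bary_sets: "n \<ge> 1 \<Longrightarrow> E \<in> sets P \<Longrightarrow> {\<omega>\<in>space M. bary n \<omega> \<in> E} \<in> sets M"
  using measurable_sets[OF bary_measurable, of n E] by (simp add: vimage_def Int_def conj_commute)

text \<open>Infinitely many tail constraints are imposed at once, so their failure probabilities
  must be summable in \<open>k\<close> on top of the factor \<open>exp (- n * L)\<close>. The 2 is
  the sum of the geometric series of ratio 1/2, which majorises that of ratio
  \<open>exp (- n)\<close>.\<close>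

proposition exponentially_tight:
  assumes L: "0 \<le> L"
  obtains K where "compactin P2_topology K"
    "\<And>n. n \<ge> 1 \<Longrightarrow> prob {\<omega>\<in>space M. bary n \<omega> \<notin> K} \<le> 2 * exp (- (real n * L))"
proof -
  have "\<exists>e. 0 < e \<and> ln (\<integral>\<mu>. exp (real k * (L + real k + 1) * tail_norm e \<mu>) \<partial>P) \<le> 1" for k
    using law.tail_mgf_le[of "real k * (L + real k + 1)"] L by (metis add_nonneg_nonneg mult_nonneg_nonneg of_nat_0_le_iff zero_le_one)
  then obtain e where e: "\<And>k. 0 < e k"
    "\<And>k. ln (\<integral>\<mu>. exp (real k * (L + real k + 1) * tail_norm (e k) \<mu>) \<partial>P) \<le> 1" by metis
  \<comment> \<open>With threshold \<open>1 / k\<close> the Chernoff exponent is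
    \<open>t k / k = L + k + 1\<close> minus a cumulant of at most 1, hence at least
    \<open>L + k\<close>: the \<open>L\<close> is the required rate, the \<open>k\<close> gives
    summability.\<close>
  define t where "t k = (if k = 0 then 1 else real k * (L + real k + 1))" for k
  define \<eta> where "\<eta> k = (if k = 0 then 1 else e k)" for k
  \<comment> \<open>Index 0 bounds the full norm; its threshold is chosen so that the Chernoff
    exponent with parameter 1 is exactly \<open>L\<close>.\<close>
  define r where "r k = (if k = 0 then L + ln (\<integral>\<mu>. exp (tail_norm 1 \<mu>) \<partial>P) else 1 / real k)" for k
  let ?K = "{\<mu>\<in>P2. \<forall>k. tail_norm (\<eta> k) \<mu> \<le> r k}"
  have t: "0 < t k" for k using L by (auto simp: t_def intro!: mult_pos_pos add_nonneg_pos)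
  have "r \<longlonglongrightarrow> 0"
  proof (rule tendsto_cong[THEN iffD2])
    show "(\<lambda>k. 1 / real k) \<longlonglongrightarrow> 0" by (rule lim_1_over_n)
    show "\<forall>\<^sub>F k in sequentially. r k = 1 / real k"
      using eventually_gt_at_top[of 0] by eventually_elim (simp add: r_def)
  qed
  then have K: "compactin P2_topology ?K"
    using e by (intro compactin_tail_norm) (auto simp: \<eta>_def)
  define B where "B n k = {\<omega>\<in>space M. real n * (t k * r k) \<le> (\<Sum>i=1..n. t k * tail_norm (\<eta> k) (\<nu> i \<omega>))}" for n k
  have B_sets: "B n k \<in> sets M" for n k
  proof -
    have [measurable]: "(\<lambda>\<omega>. \<Sum>i=1..n. t k * tail_norm (\<eta> k) (\<nu> i \<omega>)) \<in> borel_measurable M"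
      by (rule sum_sample_measurable) measurable
    show ?thesis unfolding B_def by measurable
  qed
  have B_le: "prob (B n k) \<le> exp (- (real n * L)) * (1/2) ^ k" if n: "n \<ge> 1" for n k
  proof -
    have "prob (B n k) \<le> exp (- (real n * (t k * r k - ln (\<integral>\<mu>. exp (t k * tail_norm (\<eta> k) \<mu>) \<partial>P))))"
      unfolding B_def using t[of k] by (intro Chernoff law.exp_tail_integrable) auto
    also have "\<dots> \<le> exp (- (real n * (L + real k)))"
    proof -
      have "L + real k \<le> t k * r k - ln (\<integral>\<mu>. exp (t k * tail_norm (\<eta> k) \<mu>) \<partial>P)"
        using e(2)[of k] by (cases "k = 0") (auto simp: t_def r_def \<eta>_def)
      then show ?thesis by (simp add: mult_left_mono)
    qed
    also have "\<dots> = exp (- (real n * L)) * exp (- real n) ^ k"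
      by (simp add: exp_of_nat_mult[symmetric] exp_add[symmetric] algebra_simps)
    also have "\<dots> \<le> exp (- (real n * L)) * (1/2) ^ k"
    proof (intro mult_left_mono power_mono)
      have "exp (- real n) \<le> exp (- 1)" using n by simp
      also have "exp (- 1 :: real) \<le> 1 / 2"
        using exp_ge_add_one_self[of "1::real"] by (simp add: exp_minus field_simps)
      finally show "exp (- real n) \<le> 1 / 2" .
    qed auto
    finally show ?thesis .
  qed
  show ?thesis
  proof (rule that[OF K])
    fix n :: nat assume n: "n \<ge> 1"
    have sub: "{\<omega>\<in>space M. bary n \<omega> \<notin> ?K} \<subseteq> (\<Union>k. B n k)"
    proof
      fix \<omega> assume \<omega>: "\<omega> \<in> {\<omega>\<in>space M. bary n \<omega> \<notin> ?K}"
      then obtain k where k: "r k < tail_norm (\<eta> k) (bary n \<omega>)"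
        using bary_P2[OF n] by (auto simp: not_le)
      have "tail_norm (\<eta> k) (bary n \<omega>) \<le> 1 / real n * (\<Sum>i=1..n. tail_norm (\<eta> k) (\<nu> i \<omega>))"
        using sample_P2 \<omega> by (intro tail_norm_barycenter n) auto
      then have "real n * tail_norm (\<eta> k) (bary n \<omega>) \<le> (\<Sum>i=1..n. tail_norm (\<eta> k) (\<nu> i \<omega>))"
        using n by (simp add: field_simps)
      moreover have "real n * r k \<le> real n * tail_norm (\<eta> k) (bary n \<omega>)"
        using k by (intro mult_left_mono) auto
      ultimately have "real n * r k \<le> (\<Sum>i=1..n. tail_norm (\<eta> k) (\<nu> i \<omega>))" by linarith
      then have "t k * (real n * r k) \<le> t k * (\<Sum>i=1..n. tail_norm (\<eta> k) (\<nu> i \<omega>))"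
        using t[of k] by (intro mult_left_mono) auto
      then have "\<omega> \<in> B n k" using \<omega> by (simp add: B_def sum_distrib_left[symmetric] mult.left_commute)
      then show "\<omega> \<in> (\<Union>k. B n k)" by blast
    qed
    have s: "summable (\<lambda>k. exp (- (real n * L)) * (1/2 :: real) ^ k)"
      by (intro summable_mult summable_geometric) auto
    have sB: "summable (\<lambda>k. prob (B n k))"
      by (rule summable_comparison_test'[OF s, of 0]) (use B_le[OF n] in auto)
    have "prob {\<omega>\<in>space M. bary n \<omega> \<notin> ?K} \<le> prob (\<Union>k. B n k)"
      using B_sets by (intro finite_measure_mono sub) auto
    also have "\<dots> \<le> (\<Sum>k. prob (B n k))"
      using B_sets by (intro finite_measure_subadditive_countably sB) auto
    also have "\<dots> \<le> (\<Sum>k. exp (- (real n * L)) * (1/2) ^ k)"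
      by (intro suminf_le sB s B_le n)
    also have "\<dots> = exp (- (real n * L)) * 2"
      using suminf_mult[OF summable_geometric[of "1/2::real"]] suminf_geometric[of "1/2::real"] by simp
    finally show "prob {\<omega>\<in>space M. bary n \<omega> \<notin> ?K} \<le> 2 * exp (- (real n * L))" by simp
  qed
qed

lemma halfspace_prob_le:
  assumes "n \<ge> 1" "\<alpha> \<in> L2_unit"
  shows "prob {\<omega>\<in>space M. c < inner_L2 \<alpha> (quantile (bary n \<omega>)) - law.log_mgf \<alpha>} \<le> exp (- (real n * c))"
proof -
  let ?X = "\<lambda>\<mu>. inner_L2 \<alpha> (quantile \<mu>)"
  have [measurable]: "(\<lambda>\<omega>. \<Sum>i=1..n. ?X (\<nu> i \<omega>)) \<in> borel_measurable M"
    by (rule sum_sample_measurable[OF law.inner_measurable[OF assms(2)]])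
  have "prob {\<omega>\<in>space M. c < ?X (bary n \<omega>) - law.log_mgf \<alpha>}
      \<le> prob {\<omega>\<in>space M. real n * (c + law.log_mgf \<alpha>) \<le> (\<Sum>i=1..n. ?X (\<nu> i \<omega>))}"
  proof (rule finite_measure_mono)
    show "{\<omega>\<in>space M. c < ?X (bary n \<omega>) - law.log_mgf \<alpha>}
      \<subseteq> {\<omega>\<in>space M. real n * (c + law.log_mgf \<alpha>) \<le> (\<Sum>i=1..n. ?X (\<nu> i \<omega>))}"
    proof
      fix \<omega> assume \<omega>: "\<omega> \<in> {\<omega>\<in>space M. c < ?X (bary n \<omega>) - law.log_mgf \<alpha>}"
      then have "real n * (c + law.log_mgf \<alpha>) \<le> real n * ?X (bary n \<omega>)" by (intro mult_left_mono) auto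
      then show "\<omega> \<in> {\<omega>\<in>space M. real n * (c + law.log_mgf \<alpha>) \<le> (\<Sum>i=1..n. ?X (\<nu> i \<omega>))}"
        using \<omega> inner_bary[OF assms, of \<omega>] by simp
    qed
  qed measurable
  also have "\<dots> \<le> exp (- (real n * ((c + law.log_mgf \<alpha>) - ln (\<integral>\<mu>. exp (?X \<mu>) \<partial>P))))"
    by (intro Chernoff law.inner_measurable law.exp_inner_integrable assms)
  finally show ?thesis by (simp add: law.log_mgf_def)
qed

text \<open>The closure is taken in \<open>P2\<close>, where its intersection with the compact set
  is compact. The constant \<open>C\<close> counts the half-spaces and the mass outside the compact
  set; it disappears under \<open>1 / n\<close> times the logarithm.\<close>

proposition upper_bound:
  assumes E: "E \<in> sets P"
    and rate: "\<And>\<mu>. \<mu> \<in> P2_topology closure_of E \<Longrightarrow> \<exists>\<alpha>\<in>L2_unit. c < inner_L2 \<alpha> (quantile \<mu>) - law.log_mgf \<alpha>"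
  obtains C where "C > 0" "\<And>n. n \<ge> 1 \<Longrightarrow> prob {\<omega>\<in>space M. bary n \<omega> \<in> E} \<le> C * exp (- (real n * c))"
proof (cases "0 \<le> c")
  case False
  \<comment> \<open>For negative \<open>c\<close> the right-hand side is at least 1.\<close>
  have "prob {\<omega>\<in>space M. bary n \<omega> \<in> E} \<le> 1 * exp (- (real n * c))" for n
  proof -
    have "1 \<le> exp (- (real n * c))" using False by (simp add: mult_nonneg_nonpos)
    then show ?thesis using order_trans[OF prob_le_1] by simp
  qed
  then show ?thesis using that[of 1] by simp
next
  case True
  obtain K where K: "compactin P2_topology K"
    "\<And>n. n \<ge> 1 \<Longrightarrow> prob {\<omega>\<in>space M. bary n \<omega> \<notin> K} \<le> 2 * exp (- (real n * c))"
    using exponentially_tight[OF True] by blast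
  let ?H = "\<lambda>\<alpha>. {\<mu>\<in>P2. inner_L2 \<alpha> (quantile \<mu>) \<in> {c + law.log_mgf \<alpha><..}}"
  have "compactin P2_topology (P2_topology closure_of E \<inter> K)"
    by (rule closed_Int_compactin[OF closedin_closure_of K(1)])
  moreover have "\<And>U. U \<in> ?H ` L2_unit \<Longrightarrow> openin P2_topology U"
    using openin_inner_L2[OF _ open_greaterThan] by blast
  moreover have "P2_topology closure_of E \<inter> K \<subseteq> \<Union>(?H ` L2_unit)"
  proof
    fix \<mu> assume \<mu>: "\<mu> \<in> P2_topology closure_of E \<inter> K"
    then have "\<mu> \<in> P2" using compactin_subset_topspace[OF K(1)] by auto
    moreover obtain \<alpha> where "\<alpha> \<in> L2_unit" "c < inner_L2 \<alpha> (quantile \<mu>) - law.log_mgf \<alpha>" using rate \<mu> by blast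
    ultimately show "\<mu> \<in> \<Union>(?H ` L2_unit)" by (intro UnionI[OF imageI]) auto
  qed
  ultimately obtain F where F: "finite F" "F \<subseteq> ?H ` L2_unit" "P2_topology closure_of E \<inter> K \<subseteq> \<Union>F"
    using compactinD[of P2_topology "P2_topology closure_of E \<inter> K" "?H ` L2_unit"] by blast
  obtain A where "A \<subseteq> L2_unit" "finite A" "F = ?H ` A"
    using finite_subset_image[OF F(1,2)] by blast
  with F(3) have A: "A \<subseteq> L2_unit" "finite A" "P2_topology closure_of E \<inter> K \<subseteq> \<Union>(?H ` A)" by simp_all
  have "prob {\<omega>\<in>space M. bary n \<omega> \<in> E} \<le> (2 + real (card A)) * exp (- (real n * c))" if n: "n \<ge> 1" for n
  proof -
    let ?N = "{\<omega>\<in>space M. bary n \<omega> \<notin> K}"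
    let ?S = "\<lambda>\<alpha>. {\<omega>\<in>space M. c < inner_L2 \<alpha> (quantile (bary n \<omega>)) - law.log_mgf \<alpha>}"
    have N: "?N \<in> sets M"
    proof -
      have "{\<omega>\<in>space M. bary n \<omega> \<in> K} \<in> sets M"
        using compactin_P2_sets[OF K(1)] by (intro bary_sets n) (simp add: law.sets_P)
      from sets.compl_sets[OF this] show ?thesis by (rule back_subst[of "\<lambda>x. x \<in> sets M"]) auto
    qed
    have S: "?S \<alpha> \<in> sets M" if "\<alpha> \<in> A" for \<alpha>
    proof -
      have [measurable]: "(\<lambda>\<omega>. inner_L2 \<alpha> (quantile (bary n \<omega>))) \<in> borel_measurable M"
        using A that by (intro inner_bary_measurable n) auto
      show ?thesis by measurable
    qed
    have "E \<subseteq> P2" using sets.sets_into_space[OF E] by simp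
    then have EC: "E \<subseteq> P2_topology closure_of E" by (simp add: closure_of_subset)
    have "{\<omega>\<in>space M. bary n \<omega> \<in> E} \<subseteq> ?N \<union> (\<Union>\<alpha>\<in>A. ?S \<alpha>)"
    proof
      fix \<omega> assume \<omega>: "\<omega> \<in> {\<omega>\<in>space M. bary n \<omega> \<in> E}"
      show "\<omega> \<in> ?N \<union> (\<Union>\<alpha>\<in>A. ?S \<alpha>)"
      proof (cases "bary n \<omega> \<in> K")
        case True
        then have "bary n \<omega> \<in> \<Union>(?H ` A)" using \<omega> EC A(3) by blast
        then show ?thesis using \<omega> by (auto simp: less_diff_eq)
      qed (use \<omega> in auto)
    qed
    then have "prob {\<omega>\<in>space M. bary n \<omega> \<in> E} \<le> prob (?N \<union> (\<Union>\<alpha>\<in>A. ?S \<alpha>))"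
      using N S A by (intro finite_measure_mono sets.Un sets.finite_UN) auto
    also have "\<dots> \<le> prob ?N + prob (\<Union>\<alpha>\<in>A. ?S \<alpha>)"
      using N S A by (intro measure_Un_le sets.finite_UN) auto
    also have "prob (\<Union>\<alpha>\<in>A. ?S \<alpha>) \<le> (\<Sum>\<alpha>\<in>A. prob (?S \<alpha>))"
      using S A by (intro measure_UNION_le) auto
    also have "\<dots> \<le> real (card A) * exp (- (real n * c))"
      using A halfspace_prob_le[OF n] by (intro sum_bounded_above) auto
    also note K(2)[OF n]
    finally show ?thesis by (simp add: distrib_right)
  qed
  then show ?thesis by (intro that[of "2 + real (card A)"]) auto
qed

end

section \<open>Exponential tilting\<close>

lemma expm1_bound:
  fixes z :: real
  shows "\<bar>exp z - 1\<bar> \<le> \<bar>z\<bar> * exp \<bar>z\<bar>"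
proof (cases "0 \<le> z")
  case True
  have "exp z * (1 - z) \<le> exp z * exp (- z)"
    using exp_ge_add_one_self[of "- z"] by (intro mult_left_mono) auto
  then show ?thesis using True by (simp add: exp_minus algebra_simps)
next
  case False
  have "1 - exp z \<le> - z" using exp_ge_add_one_self[of z] by linarith
  also have "\<dots> \<le> - z * exp (- z)" using False by (simp add: mult_le_cancel_left1)
  finally show ?thesis using False by simp
qed

text \<open>If the tilted moment generating function lies above that of a Gaussian with mean \<open>y\<close> and
  negative variance, both agree at the origin, so their derivatives there do.\<close>

lemma mgf_tangent_ge:
  fixes X w :: "'a \<Rightarrow> real"
  assumes [measurable]: "X \<in> borel_measurable N" "w \<in> borel_measurable N"
    and w: "\<And>x. 0 \<le> w x" "integrable N w" "(\<integral>x. w x \<partial>N) = 1"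
    and int: "integrable N (\<lambda>x. w x * exp (2 * \<bar>X x\<bar>))"
    and ge: "\<And>s. 0 < s \<Longrightarrow> s < 1 \<Longrightarrow> exp (s * y - \<sigma> * s\<^sup>2) \<le> (\<integral>x. w x * exp (s * X x) \<partial>N)"
  shows "y \<le> (\<integral>x. w x * X x \<partial>N)"
proof -
  \<comment> \<open>The offset 2 keeps every \<open>s m\<close> strictly between 0 and 1, where
    \<open>ge\<close> applies.\<close>
  define s where "s m = 1 / real (m + 2)" for m :: nat
  have s: "0 < s m" "s m < 1" for m by (auto simp: s_def)
  have s0: "s \<longlonglongrightarrow> 0"
    unfolding s_def[abs_def] using LIMSEQ_ignore_initial_segment[OF lim_1_over_n, of 2] by simp
  have ints: "integrable N (\<lambda>x. w x * exp (s m * X x))" for m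
  proof (rule Bochner_Integration.integrable_bound[OF int])
    have "s m * X x \<le> 2 * \<bar>X x\<bar>" for x
    proof -
      have "s m * X x \<le> s m * \<bar>X x\<bar>" using s[of m] by (intro mult_left_mono) auto
      also have "\<dots> \<le> 2 * \<bar>X x\<bar>" using s[of m] by (intro mult_right_mono) auto
      finally show ?thesis .
    qed
    then show "AE x in N. norm (w x * exp (s m * X x)) \<le> norm (w x * exp (2 * \<bar>X x\<bar>))"
      using w(1) by (intro AE_I2) (auto simp: abs_mult intro!: mult_left_mono)
  qed measurable
  have lim: "(\<lambda>m. \<integral>x. w x * ((exp (s m * X x) - 1) / s m) \<partial>N) \<longlonglongrightarrow> (\<integral>x. w x * X x \<partial>N)"
  proof (rule integral_dominated_convergence[OF _ _ int])
    show "AE x in N. (\<lambda>m. w x * ((exp (s m * X x) - 1) / s m)) \<longlonglongrightarrow> w x * X x"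
    proof (intro AE_I2 tendsto_mult tendsto_const)
      fix x
      have "((\<lambda>h. exp (h * X x)) has_real_derivative X x) (at 0)"
        by (auto intro!: derivative_eq_intros)
      then have "((\<lambda>h. (exp (h * X x) - 1) / h) \<longlongrightarrow> X x) (at 0)"
        by (simp add: has_field_derivative_iff)
      moreover have "filterlim s (at 0) sequentially"
        using s0 s by (intro filterlim_atI always_eventually) (auto simp: less_imp_neq[symmetric])
      ultimately show "(\<lambda>m. (exp (s m * X x) - 1) / s m) \<longlonglongrightarrow> X x"
        by (rule filterlim_compose)
    qed
    \<comment> \<open>As \<open>s m < 1\<close>, the difference quotient is at most
      \<open>\<bar>X x\<bar> * exp \<bar>X x\<bar>\<close>, and
      \<open>\<bar>X x\<bar> \<le> exp \<bar>X x\<bar>\<close> turns this into the majorant that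
      \<open>int\<close> provides.\<close>
    show "AE x in N. norm (w x * ((exp (s m * X x) - 1) / s m)) \<le> w x * exp (2 * \<bar>X x\<bar>)" for m
    proof (rule AE_I2)
      fix x
      have "\<bar>exp (s m * X x) - 1\<bar> \<le> \<bar>s m * X x\<bar> * exp \<bar>s m * X x\<bar>" by (rule expm1_bound)
      also have "\<dots> = s m * (\<bar>X x\<bar> * exp (s m * \<bar>X x\<bar>))" using s[of m] by (simp add: abs_mult)
      finally have "\<bar>exp (s m * X x) - 1\<bar> / s m \<le> \<bar>X x\<bar> * exp (s m * \<bar>X x\<bar>)"
        using s[of m] by (simp add: divide_le_eq mult.commute)
      also have "\<dots> \<le> exp \<bar>X x\<bar> * exp \<bar>X x\<bar>"
      proof (intro mult_mono)
        show "\<bar>X x\<bar> \<le> exp \<bar>X x\<bar>" using exp_ge_add_one_self[of "\<bar>X x\<bar>"] by linarith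
        show "exp (s m * \<bar>X x\<bar>) \<le> exp \<bar>X x\<bar>" using s[of m] by (simp add: mult_left_le_one_le)
      qed auto
      also have "\<dots> = exp (2 * \<bar>X x\<bar>)" by (simp add: exp_add[symmetric])
      finally have "\<bar>exp (s m * X x) - 1\<bar> / s m \<le> exp (2 * \<bar>X x\<bar>)" .
      from mult_left_mono[OF this w(1)[of x]]
      show "norm (w x * ((exp (s m * X x) - 1) / s m)) \<le> w x * exp (2 * \<bar>X x\<bar>)"
        using w(1)[of x] s[of m] by (simp add: abs_mult)
    qed
  qed measurable
  have ge_m: "y - \<sigma> * s m \<le> (\<integral>x. w x * ((exp (s m * X x) - 1) / s m) \<partial>N)" for m
  proof -
    have "(\<integral>x. w x * ((exp (s m * X x) - 1) / s m) \<partial>N) = (\<integral>x. (w x * exp (s m * X x) - w x) / s m \<partial>N)"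
      by (intro Bochner_Integration.integral_cong refl) (simp add: right_diff_distrib)
    also have "\<dots> = ((\<integral>x. w x * exp (s m * X x) \<partial>N) - 1) / s m"
      using ints w by simp
    also have "\<dots> \<ge> (exp (s m * y - \<sigma> * (s m)\<^sup>2) - 1) / s m"
      using ge[OF s] s[of m] by (intro divide_right_mono) auto
    moreover have "(exp (s m * y - \<sigma> * (s m)\<^sup>2) - 1) / s m \<ge> (s m * y - \<sigma> * (s m)\<^sup>2) / s m"
    proof (rule divide_right_mono)
      show "s m * y - \<sigma> * (s m)\<^sup>2 \<le> exp (s m * y - \<sigma> * (s m)\<^sup>2) - 1"
        using exp_ge_add_one_self[of "s m * y - \<sigma> * (s m)\<^sup>2"] by linarith
    qed (use s[of m] in simp)
    moreover have "(s m * y - \<sigma> * (s m)\<^sup>2) / s m = y - \<sigma> * s m"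
      using s[of m] by (simp add: field_simps power2_eq_square)
    ultimately show ?thesis by linarith
  qed
  have "(\<lambda>m. y - \<sigma> * s m) \<longlonglongrightarrow> y - \<sigma> * 0" by (intro tendsto_intros s0)
  then show ?thesis using lim ge_m by (intro LIMSEQ_le[of "\<lambda>m. y - \<sigma> * s m" y]) auto
qed

section \<open>Tilting by finitely many functionals\<close>

lemma sum_fun_upd_add:
  fixes c v :: "nat \<Rightarrow> real"
  assumes "j < d"
  shows "(\<Sum>i<d. (c(j := c j + s)) i * v i) = (\<Sum>i<d. c i * v i) + s * v j"
proof -
  have "(c(j := c j + s)) i * v i = c i * v i + (if i = j then s * v j else 0)" for i
    by (simp add: algebra_simps)
  then show ?thesis using assms by (simp add: sum.distrib)
qed

text \<open>Coefficient vectors are functions on \<open>nat\<close> that vanish from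
  \<open>d\<close> on, so that the dimension can be a variable; compactness of a box is then
  Tychonoff's theorem.\<close>

lemma compact_box_fun:
  "compact (PiE UNIV (\<lambda>j::nat. if j < d then {-R..R::real} else {0}))"
proof -
  have "compactin (product_topology (\<lambda>_. euclidean) UNIV) (PiE UNIV (\<lambda>j::nat. if j < d then {-R..R::real} else {0}))"
    by (simp add: compactin_PiE)
  then show ?thesis by (simp add: euclidean_product_topology)
qed

context wasserstein_law
begin

abbreviation combine :: "nat \<Rightarrow> (nat \<Rightarrow> real \<Rightarrow> real) \<Rightarrow> (nat \<Rightarrow> real) \<Rightarrow> real \<Rightarrow> real" where
  "combine d \<alpha> c \<equiv> (\<lambda>u. \<Sum>j<d. c j * \<alpha> j u)"

lemma combine_L2: "(\<And>j. j < d \<Longrightarrow> \<alpha> j \<in> L2_unit) \<Longrightarrow> combine d \<alpha> c \<in> L2_unit"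
  unfolding L2_unit_eq by (intro L2_sum L2_cmult) simp

lemma inner_combine:
  assumes "\<And>j. j < d \<Longrightarrow> \<alpha> j \<in> L2_unit" "\<nu> \<in> P2"
  shows "inner_L2 (combine d \<alpha> c) (quantile \<nu>) = (\<Sum>j<d. c j * inner_L2 (\<alpha> j) (quantile \<nu>))"
  using inner_L2_sum_left[of "{..<d}" "\<lambda>j u. c j * \<alpha> j u" "quantile \<nu>"] assms
  by (simp add: inner_L2_cmult_left L2_unit_eq L2_cmult quantile_L2)

text \<open>Sequences suffice in the product topology. Bounded coefficients bound the exponent by a
  fixed multiple of the norm, whose exponential is integrable.\<close>

lemma continuous_on_combine_mgf:
  assumes \<alpha>: "\<And>j. j < d \<Longrightarrow> \<alpha> j \<in> L2_unit"
  shows "continuous_on (PiE UNIV (\<lambda>j. if j < d then {-R..R} else {0}))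
    (\<lambda>c. \<integral>\<nu>. exp (inner_L2 (combine d \<alpha> c) (quantile \<nu>)) \<partial>P)"
proof (rule continuous_on_sequentiallyI)
  let ?S = "PiE UNIV (\<lambda>j::nat. if j < d then {-R..R} else {0})"
  fix c :: "nat \<Rightarrow> nat \<Rightarrow> real" and a assume c: "\<forall>n. c n \<in> ?S" and lim: "c \<longlonglongrightarrow> a"
  have coord: "(\<lambda>n. c n j) \<longlonglongrightarrow> a j" for j
    using continuous_on_tendsto_compose[OF continuous_on_product_coordinates lim, of j] by simp
  have cR: "\<bar>c n j\<bar> \<le> R" if "j < d" for n j
    using c PiE_mem[of "c n" UNIV "\<lambda>j. if j < d then {-R..R} else {0}" j] that by (auto simp: abs_le_iff)
  define B where "B = (\<Sum>j<d. R * L2_norm UI (\<alpha> j))"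
  show "(\<lambda>n. \<integral>\<nu>. exp (inner_L2 (combine d \<alpha> (c n)) (quantile \<nu>)) \<partial>P)
      \<longlonglongrightarrow> (\<integral>\<nu>. exp (inner_L2 (combine d \<alpha> a) (quantile \<nu>)) \<partial>P)"
  proof (rule integral_dominated_convergence[OF _ _ exp_norm_integrable[of B]])
    show "(\<lambda>\<nu>. exp (inner_L2 (combine d \<alpha> b) (quantile \<nu>))) \<in> borel_measurable P" for b
      using exp_inner_integrable[OF combine_L2[OF \<alpha>]] by simp
    then show "(\<lambda>\<nu>. exp (inner_L2 (combine d \<alpha> (c n)) (quantile \<nu>))) \<in> borel_measurable P" for n .
    show "AE \<nu> in P. (\<lambda>n. exp (inner_L2 (combine d \<alpha> (c n)) (quantile \<nu>)))
        \<longlonglongrightarrow> exp (inner_L2 (combine d \<alpha> a) (quantile \<nu>))"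
      by (rule AE_I2) (simp add: inner_combine[OF \<alpha>], intro tendsto_intros coord)
    show "AE \<nu> in P. norm (exp (inner_L2 (combine d \<alpha> (c n)) (quantile \<nu>))) \<le> exp (B * tail_norm 1 \<nu>)" for n
    proof (rule AE_I2)
      fix \<nu> assume "\<nu> \<in> space P"
      then have \<nu>: "\<nu> \<in> P2" by simp
      have "c n j * inner_L2 (\<alpha> j) (quantile \<nu>) \<le> R * L2_norm UI (\<alpha> j) * tail_norm 1 \<nu>" if j: "j < d" for j
      proof -
        have "c n j * inner_L2 (\<alpha> j) (quantile \<nu>) \<le> \<bar>c n j\<bar> * \<bar>inner_L2 (\<alpha> j) (quantile \<nu>)\<bar>"
          by (metis abs_ge_self abs_mult)
        also have "\<dots> \<le> R * (L2_norm UI (\<alpha> j) * tail_norm 1 \<nu>)"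
          using cR[OF j, of n] by (intro mult_mono inner_bound \<alpha> \<nu> j) auto
        finally show ?thesis by (simp add: mult.assoc)
      qed
      then have "(\<Sum>j<d. c n j * inner_L2 (\<alpha> j) (quantile \<nu>)) \<le> B * tail_norm 1 \<nu>"
        unfolding B_def sum_distrib_right by (intro sum_mono) auto
      then show "norm (exp (inner_L2 (combine d \<alpha> (c n)) (quantile \<nu>))) \<le> exp (B * tail_norm 1 \<nu>)"
        by (simp add: inner_combine[OF \<alpha> \<nu>])
    qed
  qed
qed

text \<open>The density of the exponentially tilted law (Esscher transform). The tilted law is never
  formed as a measure; it appears as a weight in integrals against \<open>P\<close>.\<close>

definition tilt :: "(real \<Rightarrow> real) \<Rightarrow> real measure \<Rightarrow> real" where
  "tilt \<gamma> \<nu> = exp (inner_L2 \<gamma> (quantile \<nu>) - log_mgf \<gamma>)"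

lemma tilt_pos: "0 < tilt \<gamma> \<nu>"
  by (simp add: tilt_def)

lemma tilt_integrable:
  assumes "\<gamma> \<in> L2_unit"
  shows "integrable P (tilt \<gamma>)" and "(\<integral>\<nu>. tilt \<gamma> \<nu> \<partial>P) = 1"
  unfolding tilt_def[abs_def] exp_diff exp_log_mgf[OF assms]
  using exp_inner_integrable[OF assms] integral_exp_pos[OF exp_inner_integrable[OF assms]] by auto

lemma tilt_exp_inner_integrable:
  assumes \<gamma>: "\<gamma> \<in> L2_unit" and \<alpha>: "\<alpha> \<in> L2_unit"
  shows "integrable P (\<lambda>\<nu>. tilt \<gamma> \<nu> * exp (t * \<bar>inner_L2 \<alpha> (quantile \<nu>)\<bar>))"
proof -
  have "integrable P (\<lambda>\<nu>. exp (inner_L2 \<gamma> (quantile \<nu>)) * exp (t * \<bar>inner_L2 \<alpha> (quantile \<nu>)\<bar>))"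
  proof (rule exp_bound_integrable)
    show "(\<lambda>\<nu>. exp (inner_L2 \<gamma> (quantile \<nu>)) * exp (t * \<bar>inner_L2 \<alpha> (quantile \<nu>)\<bar>)) \<in> borel_measurable P"
      using inner_measurable[OF \<gamma>] inner_measurable[OF \<alpha>] by measurable
    fix \<nu> assume \<nu>: "\<nu> \<in> P2"
    have "t * \<bar>inner_L2 \<alpha> (quantile \<nu>)\<bar> \<le> \<bar>t\<bar> * (L2_norm UI \<alpha> * tail_norm 1 \<nu>)"
      using inner_bound[OF \<alpha> \<nu>] by (intro mult_mono) auto
    then show "\<bar>exp (inner_L2 \<gamma> (quantile \<nu>)) * exp (t * \<bar>inner_L2 \<alpha> (quantile \<nu>)\<bar>)\<bar>
        \<le> exp ((L2_norm UI \<gamma> + \<bar>t\<bar> * L2_norm UI \<alpha>) * tail_norm 1 \<nu>)"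
      using inner_bound[OF \<gamma> \<nu>] by (simp add: exp_add[symmetric] distrib_right mult.assoc)
  qed
  then show ?thesis by (simp add: tilt_def exp_diff)
qed

text \<open>The tilt is a minimiser of the cumulant function with a Tikhonov penalty, which makes it
  coercive without any assumption on the support of the law.\<close>

proposition tilt_exists:
  assumes \<alpha>: "\<And>j. j < d \<Longrightarrow> \<alpha> j \<in> L2_unit" and \<sigma>: "\<sigma> > 0"
    and rate: "\<And>c. (\<Sum>j<d. c j * x j) - log_mgf (combine d \<alpha> c) \<le> I"
  obtains c where "\<And>j. j < d \<Longrightarrow>
      (\<integral>\<nu>. tilt (combine d \<alpha> c) \<nu> * inner_L2 (\<alpha> j) (quantile \<nu>) \<partial>P) = x j - \<sigma> * c j"
    and "\<And>j. j < d \<Longrightarrow> \<sigma> * (c j)\<^sup>2 \<le> 2 * I"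
proof -
  let ?\<Lambda> = "\<lambda>c. log_mgf (combine d \<alpha> c)"
  define G where "G c = ?\<Lambda> c + \<sigma> / 2 * (\<Sum>j<d. (c j)\<^sup>2) - (\<Sum>j<d. c j * x j)" for c
  \<comment> \<open>Coordinates of the minimiser turn out to be at most
    \<open>sqrt (2 * I / \<sigma>)\<close> in modulus; the extra 1 keeps perturbations by
    \<open>\<bar>s\<bar> < 1\<close> inside the box.\<close>
  define R where "R = sqrt (2 * I / \<sigma>) + 1"
  define S where "S = PiE UNIV (\<lambda>j::nat. if j < d then {-R..R} else {0})"
  have zero: "?\<Lambda> (\<lambda>_. 0) = 0" using prob_space[unfolded space_P] by (simp add: log_mgf_def inner_L2_eq)
  have I: "0 \<le> I" using rate[of "\<lambda>_. 0"] zero by simp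
  have R: "0 \<le> R" using I \<sigma> by (simp add: R_def)
  have "continuous_on S (\<lambda>c. \<integral>\<nu>. exp (inner_L2 (combine d \<alpha> c) (quantile \<nu>)) \<partial>P)"
    unfolding S_def by (rule continuous_on_combine_mgf[OF \<alpha>])
  then have "continuous_on S ?\<Lambda>"
    unfolding log_mgf_def
    by (rule continuous_on_ln) (use integral_exp_pos[OF exp_inner_integrable[OF combine_L2[OF \<alpha>]]] in \<open>auto simp: less_imp_neq[symmetric]\<close>)
  moreover have "continuous_on S (\<lambda>c. c j)" for j
    by (rule continuous_on_subset[OF continuous_on_product_coordinates]) auto
  ultimately have "continuous_on S G" unfolding G_def[abs_def] by (intro continuous_intros)
  moreover have "compact S" unfolding S_def by (rule compact_box_fun)
  moreover have S0: "(\<lambda>_. 0) \<in> S" using R by (auto simp: S_def)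
  ultimately obtain c where cS: "c \<in> S" and min: "\<And>b. b \<in> S \<Longrightarrow> G c \<le> G b"
    using continuous_attains_inf[of S G] by auto
  have "G c \<le> 0" using min[OF S0] zero by (simp add: G_def)
  \<comment> \<open>In \<open>G c \<le> 0\<close> the linear term minus the cumulant is at most
    \<open>I\<close> by \<open>rate\<close>, so the penalty is at most \<open>I\<close> too.\<close>
  then have sq: "\<sigma> * (\<Sum>j<d. (c j)\<^sup>2) \<le> 2 * I" using rate[of c] by (simp add: G_def)
  have csq: "\<sigma> * (c j)\<^sup>2 \<le> 2 * I" if j: "j < d" for j
  proof -
    have "(c j)\<^sup>2 \<le> (\<Sum>j<d. (c j)\<^sup>2)" using j by (intro member_le_sum) auto
    then show ?thesis using sq \<sigma> by (meson mult_le_cancel_left_pos order_trans)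
  qed
  have cb: "\<bar>c j\<bar> \<le> R - 1" if j: "j < d" for j
    using csq[OF j] \<sigma> by (simp add: R_def real_le_rsqrt pos_le_divide_eq mult.commute)
  let ?\<gamma> = "combine d \<alpha> c"
  have \<gamma>: "?\<gamma> \<in> L2_unit" by (rule combine_L2[OF \<alpha>])
  \<comment> \<open>Minimality is tested against a shift of the single coordinate \<open>j\<close>
    by \<open>s\<close>. The penalty changes by
    \<open>s * (\<sigma> * c j) + \<sigma> / 2 * s\<^sup>2\<close>, the linear term by
    \<open>s * x j\<close>, and the change of the cumulant is the logarithm of the tilted moment
    generating function.\<close>
  have key: "exp (s * (x j - \<sigma> * c j) - \<sigma> / 2 * s\<^sup>2)
      \<le> (\<integral>\<nu>. tilt ?\<gamma> \<nu> * exp (s * inner_L2 (\<alpha> j) (quantile \<nu>)) \<partial>P)" if j: "j < d" and s: "\<bar>s\<bar> < 1" for s j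
  proof -
    let ?b = "c(j := c j + s)"
    have "c i \<in> (if i < d then {-R..R} else {0})" for i
      using cS unfolding S_def by (rule PiE_mem) simp
    then have "?b i \<in> (if i < d then {-R..R} else {0})" for i
      using cb[OF j] s j by (cases "i = j") auto
    then have "?b \<in> S" unfolding S_def PiE_iff by simp
    then have "G c \<le> G ?b" by (rule min)
    moreover
    have "(\<Sum>i<d. (?b i)\<^sup>2) = (\<Sum>i<d. (c i)\<^sup>2) + 2 * s * c j + s\<^sup>2"
    proof -
      have "(?b i)\<^sup>2 = (c i)\<^sup>2 + (if i = j then 2 * s * c j + s\<^sup>2 else 0)" for i
        by (simp add: power2_sum)
      then show ?thesis using j by (simp add: sum.distrib)
    qed
    then have "\<sigma> / 2 * (\<Sum>i<d. (?b i)\<^sup>2) = \<sigma> / 2 * (\<Sum>i<d. (c i)\<^sup>2) + s * (\<sigma> * c j) + \<sigma> / 2 * s\<^sup>2"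
      by (simp only: distrib_left) simp
    ultimately have le: "s * (x j - \<sigma> * c j) - \<sigma> / 2 * s\<^sup>2 \<le> ?\<Lambda> ?b - ?\<Lambda> c"
      unfolding G_def sum_fun_upd_add[OF j] right_diff_distrib by linarith
    have "exp (?\<Lambda> ?b - ?\<Lambda> c) = (\<integral>\<nu>. exp (inner_L2 (combine d \<alpha> ?b) (quantile \<nu>)) / exp (?\<Lambda> c) \<partial>P)"
      by (simp add: exp_diff exp_log_mgf[OF combine_L2[OF \<alpha>]])
    also have "\<dots> = (\<integral>\<nu>. tilt ?\<gamma> \<nu> * exp (s * inner_L2 (\<alpha> j) (quantile \<nu>)) \<partial>P)"
    proof (intro Bochner_Integration.integral_cong refl)
      fix \<nu> assume "\<nu> \<in> space P"
      then have \<nu>: "\<nu> \<in> P2" by simp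
      have ic: "inner_L2 (combine d \<alpha> b) (quantile \<nu>) = (\<Sum>j<d. b j * inner_L2 (\<alpha> j) (quantile \<nu>))" for b
        by (rule inner_combine[OF \<alpha> \<nu>])
      have "inner_L2 (combine d \<alpha> ?b) (quantile \<nu>)
          = inner_L2 (combine d \<alpha> c) (quantile \<nu>) + s * inner_L2 (\<alpha> j) (quantile \<nu>)"
        unfolding ic by (rule sum_fun_upd_add[OF j])
      then show "exp (inner_L2 (combine d \<alpha> ?b) (quantile \<nu>)) / exp (?\<Lambda> c)
          = tilt ?\<gamma> \<nu> * exp (s * inner_L2 (\<alpha> j) (quantile \<nu>))"
        unfolding tilt_def by (simp only: exp_add exp_diff times_divide_eq_left)
    qed
    finally have "exp (?\<Lambda> ?b - ?\<Lambda> c) = (\<integral>\<nu>. tilt ?\<gamma> \<nu> * exp (s * inner_L2 (\<alpha> j) (quantile \<nu>)) \<partial>P)" .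
    moreover have "exp (s * (x j - \<sigma> * c j) - \<sigma> / 2 * s\<^sup>2) \<le> exp (?\<Lambda> ?b - ?\<Lambda> c)"
      using le by (simp only: exp_le_cancel_iff)
    ultimately show ?thesis by (simp only:)
  qed
  show ?thesis
  proof (rule that[of c])
    fix j assume j: "j < d"
    show "\<sigma> * (c j)\<^sup>2 \<le> 2 * I" by (rule csq[OF j])
    let ?X = "\<lambda>\<nu>. inner_L2 (\<alpha> j) (quantile \<nu>)"
    have [measurable]: "?X \<in> borel_measurable P" by (rule inner_measurable[OF \<alpha>[OF j]])
    have [measurable]: "tilt ?\<gamma> \<in> borel_measurable P" using tilt_integrable[OF \<gamma>] by simp
    note int = tilt_exp_inner_integrable[OF \<gamma> \<alpha>[OF j], of 2]
    have "x j - \<sigma> * c j \<le> (\<integral>\<nu>. tilt ?\<gamma> \<nu> * ?X \<nu> \<partial>P)"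
      by (rule mgf_tangent_ge[of _ _ _ _ "\<sigma> / 2"])
        (use tilt_integrable[OF \<gamma>] int key[OF j] in \<open>auto simp: less_imp_le[OF tilt_pos]\<close>)
    \<comment> \<open>The estimate \<open>key\<close> allows both signs of \<open>s\<close>, so the
      tangent argument for \<open>- ?X\<close> gives the reverse inequality.\<close>
    moreover have "- (x j - \<sigma> * c j) \<le> (\<integral>\<nu>. tilt ?\<gamma> \<nu> * - ?X \<nu> \<partial>P)"
    proof (rule mgf_tangent_ge[of _ _ _ _ "\<sigma> / 2"])
      show "exp (s * - (x j - \<sigma> * c j) - \<sigma> / 2 * s\<^sup>2) \<le> (\<integral>\<nu>. tilt ?\<gamma> \<nu> * exp (s * - ?X \<nu>) \<partial>P)"
        if "0 < s" "s < 1" for s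
      proof -
        have "\<bar>- s\<bar> < 1" using that by simp
        from key[OF j this] show ?thesis by (simp only: minus_mult_commute power2_minus)
      qed
    qed (use tilt_integrable[OF \<gamma>] int in \<open>auto simp: less_imp_le[OF tilt_pos]\<close>)
    ultimately show "(\<integral>\<nu>. tilt ?\<gamma> \<nu> * ?X \<nu> \<partial>P) = x j - \<sigma> * c j" by simp
  qed
qed

end

section \<open>The lower bound\<close>

lemma sum_power2_expand:
  fixes z :: "'a \<Rightarrow> real"
  shows "(\<Sum>i\<in>A. z i)\<^sup>2 = (\<Sum>i\<in>A. \<Sum>k\<in>A. z i * z k)"
  by (simp add: power2_eq_square sum_product)

context wasserstein_sample
begin

text \<open>Under the product tilt the samples are independent with mean \<open>0\<close>, so the second moment of
  their sum grows linearly.\<close>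

lemma tilted_second_moment:
  fixes w Z :: "real measure \<Rightarrow> real"
  assumes w: "integrable P w" "(\<integral>\<mu>. w \<mu> \<partial>P) = 1"
    and wZ: "integrable P (\<lambda>\<mu>. w \<mu> * Z \<mu>)" "(\<integral>\<mu>. w \<mu> * Z \<mu> \<partial>P) = 0"
    and wZ2: "integrable P (\<lambda>\<mu>. w \<mu> * (Z \<mu>)\<^sup>2)"
  shows "(\<integral>\<omega>. (\<Prod>l=1..n. w (\<nu> l \<omega>)) * (\<Sum>i=1..n. Z (\<nu> i \<omega>))\<^sup>2 \<partial>M)
      = real n * (\<integral>\<mu>. w \<mu> * (Z \<mu>)\<^sup>2 \<partial>P)" (is "?lhs = _")
    and "integrable M (\<lambda>\<omega>. (\<Prod>l=1..n. w (\<nu> l \<omega>)) * (\<Sum>i=1..n. Z (\<nu> i \<omega>))\<^sup>2)"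
proof -
  \<comment> \<open>One factor per sample: the product over \<open>l\<close> is the total weight
    times \<open>Z\<close> at samples \<open>i\<close> and \<open>k\<close>. For
    \<open>i = k\<close> both conditions fire at the same \<open>l\<close> and produce the
    square.\<close>
  define g where "g i k l \<mu> = w \<mu> * (if l = i then Z \<mu> else 1) * (if l = k then Z \<mu> else 1)"
    for i k l :: nat and \<mu>
  have gi: "integrable P (g i k l)" for i k l
    using w wZ wZ2 unfolding g_def[abs_def]
    by (cases "l = i"; cases "l = k") (auto simp: power2_eq_square mult.assoc)
  have gval: "(\<integral>\<mu>. g i k l \<mu> \<partial>P)
      = (if l = i then if l = k then (\<integral>\<mu>. w \<mu> * (Z \<mu>)\<^sup>2 \<partial>P) else 0 else if l = k then 0 else 1)" for i k l
    using w wZ unfolding g_def[abs_def]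
    by (cases "l = i"; cases "l = k") (auto simp: power2_eq_square mult.assoc)
  have split: "(\<Prod>l=1..n. w (\<nu> l \<omega>)) * (Z (\<nu> i \<omega>) * Z (\<nu> k \<omega>)) = (\<Prod>l=1..n. g i k l (\<nu> l \<omega>))"
    if "i \<in> {1..n}" "k \<in> {1..n}" for i k \<omega>
    using that by (simp add: g_def prod.distrib prod.delta)
  have expand: "(\<Prod>l=1..n. w (\<nu> l \<omega>)) * (\<Sum>i=1..n. Z (\<nu> i \<omega>))\<^sup>2
      = (\<Sum>i=1..n. \<Sum>k=1..n. \<Prod>l=1..n. g i k l (\<nu> l \<omega>))" for \<omega>
    unfolding sum_power2_expand sum_distrib_left by (intro sum.cong refl split)
  have int: "integrable M (\<lambda>\<omega>. \<Prod>l=1..n. g i k l (\<nu> l \<omega>))" for i k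
    by (rule sample_prod(2)[OF gi])
  have pair: "(\<integral>\<omega>. (\<Prod>l=1..n. g i k l (\<nu> l \<omega>)) \<partial>M) = (if i = k then (\<integral>\<mu>. w \<mu> * (Z \<mu>)\<^sup>2 \<partial>P) else 0)"
    if "i \<in> {1..n}" "k \<in> {1..n}" for i k
  proof -
    have "(\<integral>\<omega>. (\<Prod>l=1..n. g i k l (\<nu> l \<omega>)) \<partial>M) = (\<Prod>l=1..n. \<integral>\<mu>. g i k l \<mu> \<partial>P)"
      by (rule sample_prod(1)[OF gi])
    also have "\<dots> = (if i = k then (\<integral>\<mu>. w \<mu> * (Z \<mu>)\<^sup>2 \<partial>P) else 0)"
    proof (cases "i = k")
      case True
      then have "(\<Prod>l=1..n. \<integral>\<mu>. g i k l \<mu> \<partial>P) = (\<Prod>l=1..n. if l = i then (\<integral>\<mu>. w \<mu> * (Z \<mu>)\<^sup>2 \<partial>P) else 1)"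
        by (intro prod.cong refl) (simp add: gval)
      then show ?thesis using True that by (simp add: prod.delta)
    next
      case False
      have "(\<integral>\<mu>. g i k i \<mu> \<partial>P) = 0" using False by (simp add: gval)
      then have "(\<Prod>l=1..n. \<integral>\<mu>. g i k l \<mu> \<partial>P) = 0" using that by (intro prod_zero bexI[of _ i]) auto
      then show ?thesis using False by simp
    qed
    finally show ?thesis .
  qed
  show "integrable M (\<lambda>\<omega>. (\<Prod>l=1..n. w (\<nu> l \<omega>)) * (\<Sum>i=1..n. Z (\<nu> i \<omega>))\<^sup>2)"
    unfolding expand by (intro Bochner_Integration.integrable_sum int)
  have "?lhs = (\<Sum>i=1..n. \<Sum>k=1..n. \<integral>\<omega>. (\<Prod>l=1..n. g i k l (\<nu> l \<omega>)) \<partial>M)"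
    unfolding expand by (simp only: Bochner_Integration.integral_sum Bochner_Integration.integrable_sum int)
  also have "\<dots> = (\<Sum>i=1..n. \<Sum>k=1..n. if i = k then (\<integral>\<mu>. w \<mu> * (Z \<mu>)\<^sup>2 \<partial>P) else 0)"
    by (intro sum.cong refl pair)
  also have "\<dots> = real n * (\<integral>\<mu>. w \<mu> * (Z \<mu>)\<^sup>2 \<partial>P)" by simp
  finally show "?lhs = real n * (\<integral>\<mu>. w \<mu> * (Z \<mu>)\<^sup>2 \<partial>P)" .
qed

text \<open>A change of measure with the product weight \<open>?W\<close>. The weight of the
  complement of the event is at most \<open>C / n\<close> by Chebyshev; on the event the weight is
  at most \<open>exp (n * ?a)\<close>, since every coordinate of the barycenter is there within
  \<open>\<delta>\<close> of the tilted mean.\<close>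

proposition tilted_lower_bound:
  assumes \<alpha>: "\<And>j. j < d \<Longrightarrow> \<alpha> j \<in> L2_unit" and \<delta>: "\<delta> > 0"
    and mean: "\<And>j. j < d \<Longrightarrow>
      (\<integral>\<mu>. law.tilt (law.combine d \<alpha> c) \<mu> * inner_L2 (\<alpha> j) (quantile \<mu>) \<partial>P) = y j"
  obtains C where "\<And>n. n \<ge> 1 \<Longrightarrow>
     (1 - C / real n) * exp (- (real n * ((\<Sum>j<d. c j * y j) + \<delta> * (\<Sum>j<d. \<bar>c j\<bar>) - law.log_mgf (law.combine d \<alpha> c))))
     \<le> prob {\<omega>\<in>space M. \<forall>j<d. \<bar>inner_L2 (\<alpha> j) (quantile (bary n \<omega>)) - y j\<bar> < \<delta>}"
proof -
  let ?\<gamma> = "law.combine d \<alpha> c"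
  define w where "w = law.tilt ?\<gamma>"
  have \<gamma>: "?\<gamma> \<in> L2_unit" by (rule law.combine_L2[OF \<alpha>])
  have w: "integrable P w" "(\<integral>\<mu>. w \<mu> \<partial>P) = 1" unfolding w_def by (rule law.tilt_integrable[OF \<gamma>])+
  have w_pos: "0 < w \<mu>" for \<mu> by (simp add: w_def law.tilt_pos)
  have [measurable]: "w \<in> borel_measurable P" using w(1) by simp
  define X where "X j \<mu> = inner_L2 (\<alpha> j) (quantile \<mu>)" for j \<mu>
  have Xm: "X j \<in> borel_measurable P" if "j < d" for j
    unfolding X_def[abs_def] by (rule law.inner_measurable[OF \<alpha>[OF that]])
  have wX: "integrable P (\<lambda>\<mu>. w \<mu> * X j \<mu>)" "integrable P (\<lambda>\<mu>. w \<mu> * (X j \<mu>)\<^sup>2)" if j: "j < d" for j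
  proof -
    note [measurable] = Xm[OF j]
    have int: "integrable P (\<lambda>\<mu>. w \<mu> * exp (2 * \<bar>X j \<mu>\<bar>))"
      unfolding w_def X_def by (rule law.tilt_exp_inner_integrable[OF \<gamma> \<alpha>[OF j]])
    have e1: "\<bar>x\<bar> \<le> exp (2 * \<bar>x\<bar>)" and e2: "x\<^sup>2 \<le> exp (2 * \<bar>x\<bar>)" for x :: real
    proof -
      have le: "\<bar>x\<bar> \<le> exp \<bar>x\<bar>" using exp_ge_add_one_self[of "\<bar>x\<bar>"] by linarith
      also have "\<dots> \<le> exp (2 * \<bar>x\<bar>)" by simp
      finally show "\<bar>x\<bar> \<le> exp (2 * \<bar>x\<bar>)" .
      have "\<bar>x\<bar> * \<bar>x\<bar> \<le> exp \<bar>x\<bar> * exp \<bar>x\<bar>" using le by (intro mult_mono) auto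
      then show "x\<^sup>2 \<le> exp (2 * \<bar>x\<bar>)" by (simp add: exp_add[symmetric] power2_eq_square)
    qed
    show "integrable P (\<lambda>\<mu>. w \<mu> * X j \<mu>)"
      by (rule Bochner_Integration.integrable_bound[OF int])
        (use w_pos e1 in \<open>auto simp: abs_mult less_imp_le intro!: AE_I2 mult_left_mono\<close>)
    show "integrable P (\<lambda>\<mu>. w \<mu> * (X j \<mu>)\<^sup>2)"
      by (rule Bochner_Integration.integrable_bound[OF int])
        (use w_pos e2 in \<open>auto simp: abs_mult less_imp_le intro!: AE_I2 mult_left_mono\<close>)
  qed
  define Z where "Z j \<mu> = X j \<mu> - y j" for j \<mu>
  define V where "V j = (\<integral>\<mu>. w \<mu> * (Z j \<mu>)\<^sup>2 \<partial>P)" for j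
  have wZ: "integrable P (\<lambda>\<mu>. w \<mu> * Z j \<mu>)" "(\<integral>\<mu>. w \<mu> * Z j \<mu> \<partial>P) = 0"
    "integrable P (\<lambda>\<mu>. w \<mu> * (Z j \<mu>)\<^sup>2)" if j: "j < d" for j
  proof -
    have "w \<mu> * (Z j \<mu>)\<^sup>2 = w \<mu> * (X j \<mu>)\<^sup>2 - 2 * y j * (w \<mu> * X j \<mu>) + (y j)\<^sup>2 * w \<mu>" for \<mu>
      by (simp add: Z_def power2_eq_square algebra_simps)
    then show "integrable P (\<lambda>\<mu>. w \<mu> * (Z j \<mu>)\<^sup>2)" using wX[OF j] w by simp
    show "integrable P (\<lambda>\<mu>. w \<mu> * Z j \<mu>)"
      using wX[OF j] w by (simp add: Z_def right_diff_distrib)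
    have "(\<integral>\<mu>. w \<mu> * X j \<mu> \<partial>P) = y j" using mean[OF j] by (simp add: w_def X_def)
    then show "(\<integral>\<mu>. w \<mu> * Z j \<mu> \<partial>P) = 0"
      using wX[OF j] w by (simp add: Z_def right_diff_distrib)
  qed
  define C where "C = (\<Sum>j<d. V j) / \<delta>\<^sup>2"
  let ?a = "(\<Sum>j<d. c j * y j) + \<delta> * (\<Sum>j<d. \<bar>c j\<bar>) - law.log_mgf ?\<gamma>"
  have "(1 - C / real n) * exp (- (real n * ?a))
     \<le> prob {\<omega>\<in>space M. \<forall>j<d. \<bar>inner_L2 (\<alpha> j) (quantile (bary n \<omega>)) - y j\<bar> < \<delta>}" if n: "n \<ge> 1" for n
  proof -
    let ?A = "{\<omega>\<in>space M. \<forall>j<d. \<bar>inner_L2 (\<alpha> j) (quantile (bary n \<omega>)) - y j\<bar> < \<delta>}"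
    let ?W = "\<lambda>\<omega>. \<Prod>l=1..n. w (\<nu> l \<omega>)"
    let ?S = "\<lambda>j \<omega>. \<Sum>i=1..n. Z j (\<nu> i \<omega>)"
    have A: "?A \<in> sets M"
    proof -
      have "{\<omega>\<in>space M. \<bar>inner_L2 (\<alpha> j) (quantile (bary n \<omega>)) - y j\<bar> < \<delta>} \<in> sets M" if "j < d" for j
        using inner_bary_measurable[OF n \<alpha>[OF that]] by measurable
      then have "{\<omega>\<in>space M. \<forall>j\<in>{..<d}. \<bar>inner_L2 (\<alpha> j) (quantile (bary n \<omega>)) - y j\<bar> < \<delta>} \<in> sets M"
        by (intro sets.sets_Collect_finite_All) auto
      then show ?thesis unfolding Ball_def lessThan_iff .
    qed
    have Wint: "integrable M ?W" "(\<integral>\<omega>. ?W \<omega> \<partial>M) = 1"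
      using sample_prod[of n "\<lambda>_. w"] w by auto
    have S: "?S j \<omega> = real n * (inner_L2 (\<alpha> j) (quantile (bary n \<omega>)) - y j)" if "j < d" "\<omega> \<in> space M" for j \<omega>
      using inner_bary[OF n \<alpha>[OF that(1)] that(2)] by (simp add: Z_def X_def sum_subtractf right_diff_distrib)
    note mom = tilted_second_moment[OF w wZ]
    have Sint: "integrable M (\<lambda>\<omega>. ?W \<omega> * (?S j \<omega>)\<^sup>2)" "(\<integral>\<omega>. ?W \<omega> * (?S j \<omega>)\<^sup>2 \<partial>M) = real n * V j" if "j < d" for j
      unfolding V_def using mom[OF that that that, of n] by auto
    have Wpos: "0 \<le> ?W \<omega>" for \<omega> using w_pos by (intro prod_nonneg) (auto simp: less_imp_le)
    \<comment> \<open>Off the event some coordinate deviates by \<open>\<delta>\<close>, so a single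
      summand already outweighs \<open>?W \<omega>\<close>.\<close>
    have chebyshev: "?W \<omega> - (\<Sum>j<d. ?W \<omega> * (?S j \<omega>)\<^sup>2 / (real n * \<delta>)\<^sup>2) \<le> ?W \<omega> * indicator ?A \<omega>"
      if \<omega>: "\<omega> \<in> space M" for \<omega>
    proof (cases "\<omega> \<in> ?A")
      case True
      have "0 \<le> (\<Sum>j<d. ?W \<omega> * (?S j \<omega>)\<^sup>2 / (real n * \<delta>)\<^sup>2)"
        using Wpos by (intro sum_nonneg) auto
      then show ?thesis using True by simp
    next
      case False
      then obtain j where j: "j < d" "\<delta> \<le> \<bar>inner_L2 (\<alpha> j) (quantile (bary n \<omega>)) - y j\<bar>" using \<omega> by (auto simp: not_less)
      then have "real n * \<delta> \<le> \<bar>?S j \<omega>\<bar>" unfolding S[OF j(1) \<omega>] by (simp add: abs_mult mult_left_mono)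
      then have "(real n * \<delta>)\<^sup>2 \<le> \<bar>?S j \<omega>\<bar>\<^sup>2" using \<delta> by (intro power_mono) auto
      then have "?W \<omega> * 1 \<le> ?W \<omega> * ((?S j \<omega>)\<^sup>2 / (real n * \<delta>)\<^sup>2)"
        using \<delta> n by (intro mult_left_mono Wpos) (simp add: pos_le_divide_eq)
      also have "\<dots> \<le> (\<Sum>j<d. ?W \<omega> * (?S j \<omega>)\<^sup>2 / (real n * \<delta>)\<^sup>2)"
        using j Wpos member_le_sum[of j "{..<d}" "\<lambda>j. ?W \<omega> * (?S j \<omega>)\<^sup>2 / (real n * \<delta>)\<^sup>2"] by auto
      finally show ?thesis using False by simp
    qed
    have density: "?W \<omega> * indicator ?A \<omega> \<le> exp (real n * ?a) * indicator ?A \<omega>" if \<omega>: "\<omega> \<in> space M" for \<omega>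
    proof (cases "\<omega> \<in> ?A")
      case True
      have "?W \<omega> = exp (\<Sum>l=1..n. inner_L2 ?\<gamma> (quantile (\<nu> l \<omega>)) - law.log_mgf ?\<gamma>)"
        by (simp add: w_def law.tilt_def exp_sum)
      also have "(\<Sum>l=1..n. inner_L2 ?\<gamma> (quantile (\<nu> l \<omega>)) - law.log_mgf ?\<gamma>)
          = real n * (inner_L2 ?\<gamma> (quantile (bary n \<omega>)) - law.log_mgf ?\<gamma>)"
        using inner_bary[OF n \<gamma> \<omega>] by (simp add: sum_subtractf right_diff_distrib)
      also have "inner_L2 ?\<gamma> (quantile (bary n \<omega>)) = (\<Sum>j<d. c j * inner_L2 (\<alpha> j) (quantile (bary n \<omega>)))"
        by (rule law.inner_combine[OF \<alpha> bary_P2[OF n \<omega>]])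
      also have "exp (real n * ((\<Sum>j<d. c j * inner_L2 (\<alpha> j) (quantile (bary n \<omega>))) - law.log_mgf ?\<gamma>)) \<le> exp (real n * ?a)"
      proof -
        have "c j * inner_L2 (\<alpha> j) (quantile (bary n \<omega>)) \<le> c j * y j + \<delta> * \<bar>c j\<bar>" if "j < d" for j
        proof -
          have "c j * (inner_L2 (\<alpha> j) (quantile (bary n \<omega>)) - y j) \<le> \<bar>c j\<bar> * \<bar>inner_L2 (\<alpha> j) (quantile (bary n \<omega>)) - y j\<bar>"
            by (simp add: abs_mult[symmetric])
          also have "\<dots> \<le> \<bar>c j\<bar> * \<delta>" using True that by (intro mult_left_mono) (auto simp: less_imp_le)
          finally show ?thesis by (simp add: algebra_simps)
        qed
        then have "(\<Sum>j<d. c j * inner_L2 (\<alpha> j) (quantile (bary n \<omega>))) \<le> (\<Sum>j<d. c j * y j + \<delta> * \<bar>c j\<bar>)"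
          by (intro sum_mono) auto
        then show ?thesis by (simp add: sum.distrib sum_distrib_left mult_left_mono)
      qed
      finally show ?thesis using True by simp
    qed simp
    have iA: "integrable M (indicator ?A :: 'w \<Rightarrow> real)"
      by (rule integrable_real_indicator[OF A])
        (simp only: emeasure_eq_measure ennreal_less_top infinity_ennreal_def)
    have Sint': "integrable M (\<lambda>\<omega>. ?W \<omega> * (?S j \<omega>)\<^sup>2 / (real n * \<delta>)\<^sup>2)"
      "(\<integral>\<omega>. ?W \<omega> * (?S j \<omega>)\<^sup>2 / (real n * \<delta>)\<^sup>2 \<partial>M) = real n * V j / (real n * \<delta>)\<^sup>2"
      if "j < d" for j
      using Sint(1)[OF that] by (rule integrable_divide) (simp only: integral_divide_zero Sint(2)[OF that])
    have sumint: "integrable M (\<lambda>\<omega>. \<Sum>j<d. ?W \<omega> * (?S j \<omega>)\<^sup>2 / (real n * \<delta>)\<^sup>2)"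
      by (rule Bochner_Integration.integrable_sum) (rule Sint'(1), simp)
    have "1 - C / real n = (\<integral>\<omega>. ?W \<omega> - (\<Sum>j<d. ?W \<omega> * (?S j \<omega>)\<^sup>2 / (real n * \<delta>)\<^sup>2) \<partial>M)"
    proof -
      have "(\<integral>\<omega>. ?W \<omega> - (\<Sum>j<d. ?W \<omega> * (?S j \<omega>)\<^sup>2 / (real n * \<delta>)\<^sup>2) \<partial>M)
          = 1 - (\<Sum>j<d. real n * V j / (real n * \<delta>)\<^sup>2)"
      proof -
        have "(\<integral>\<omega>. (\<Sum>j<d. ?W \<omega> * (?S j \<omega>)\<^sup>2 / (real n * \<delta>)\<^sup>2) \<partial>M)
            = (\<Sum>j<d. \<integral>\<omega>. ?W \<omega> * (?S j \<omega>)\<^sup>2 / (real n * \<delta>)\<^sup>2 \<partial>M)"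
          by (rule Bochner_Integration.integral_sum) (rule Sint'(1), simp)
        also have "\<dots> = (\<Sum>j<d. real n * V j / (real n * \<delta>)\<^sup>2)"
          by (rule sum.cong[OF refl], rule Sint'(2)) simp
        finally show ?thesis
          by (simp only: Bochner_Integration.integral_diff[OF Wint(1) sumint] Wint(2))
      qed
      also have "(\<Sum>j<d. real n * V j / (real n * \<delta>)\<^sup>2) = C / real n"
        unfolding C_def sum_divide_distrib using n \<delta>
        by (intro sum.cong refl) (simp add: power2_eq_square)
      finally show ?thesis by simp
    qed
    also have "\<dots> \<le> (\<integral>\<omega>. exp (real n * ?a) * indicator ?A \<omega> \<partial>M)"
    proof (rule integral_mono)
      show "integrable M (\<lambda>\<omega>. ?W \<omega> - (\<Sum>j<d. ?W \<omega> * (?S j \<omega>)\<^sup>2 / (real n * \<delta>)\<^sup>2))"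
        by (rule Bochner_Integration.integrable_diff[OF Wint(1) sumint])
      show "integrable M (\<lambda>\<omega>. exp (real n * ?a) * indicator ?A \<omega>)"
        by (rule integrable_mult_right) (rule iA)
    qed (use order_trans[OF chebyshev density] in blast)
    also have "\<dots> = exp (real n * ?a) * prob ?A"
      by (simp only: integral_mult_right_zero Bochner_Integration.integral_indicator sets.Int_space_eq2[OF A])
    finally have "(1 - C / real n) * exp (- (real n * ?a)) \<le> exp (real n * ?a) * prob ?A * exp (- (real n * ?a))"
      by (intro mult_right_mono) auto
    also have "\<dots> = prob ?A" by (simp add: exp_minus)
    finally show ?thesis .
  qed
  then show ?thesis by (rule that)
qed

end

context wasserstein_sample
begin

lemma rate_bound_nonneg:
  assumes "\<And>\<gamma>. \<gamma> \<in> L2_unit \<Longrightarrow> inner_L2 \<gamma> (quantile f) - law.log_mgf \<gamma> \<le> I"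
  shows "0 \<le> I"
  using assms[OF law.L2_unit_zero] by (simp add: law.log_mgf_def inner_L2_eq law.prob_space[unfolded law.space_P])

text \<open>The radius 1 is a normalisation, as functionals can be rescaled. One half of it absorbs
  the bias \<open>\<sigma> * c j\<close> of the tilted mean, the other half the fluctuation
  \<open>\<delta>\<close>.\<close>

lemma cylinder_lower_bound:
  fixes d :: nat
  assumes \<alpha>: "\<And>j. j < d \<Longrightarrow> \<alpha> j \<in> L2_unit" and f: "f \<in> P2" and \<epsilon>: "\<epsilon> > 0"
    and rate: "\<And>\<gamma>. \<gamma> \<in> L2_unit \<Longrightarrow> inner_L2 \<gamma> (quantile f) - law.log_mgf \<gamma> \<le> I"
  shows "\<forall>\<^sub>F n in sequentially. exp (- (real n * (I + \<epsilon>)))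
    \<le> prob {\<omega>\<in>space M. \<forall>j<d. \<bar>inner_L2 (\<alpha> j) (quantile (bary n \<omega>)) - inner_L2 (\<alpha> j) (quantile f)\<bar> < 1}"
proof -
  define x where "x j = inner_L2 (\<alpha> j) (quantile f)" for j
  have I: "0 \<le> I" by (rule rate_bound_nonneg[OF rate])
  \<comment> \<open>The squared bias is at most \<open>2 * \<sigma> * I\<close>, which this choice
    brings below 1/4; the \<open>+ 1\<close> covers \<open>I = 0\<close>.\<close>
  define \<sigma> where "\<sigma> = 1 / (8 * (I + 1))"
  have \<sigma>: "\<sigma> > 0" "2 * \<sigma> * I \<le> 1 / 4" using I by (auto simp: \<sigma>_def field_simps)
  have ratec: "(\<Sum>j<d. c j * x j) - law.log_mgf (law.combine d \<alpha> c) \<le> I" for c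
  proof -
    have "inner_L2 (law.combine d \<alpha> c) (quantile f) = (\<Sum>j<d. c j * x j)"
      unfolding x_def by (rule law.inner_combine[OF \<alpha> f])
    moreover have "law.combine d \<alpha> c \<in> L2_unit" by (rule law.combine_L2[OF \<alpha>])
    ultimately show ?thesis using rate by fastforce
  qed
  have "\<exists>c. (\<forall>j<d. (\<integral>\<nu>. law.tilt (law.combine d \<alpha> c) \<nu> * inner_L2 (\<alpha> j) (quantile \<nu>) \<partial>P) = x j - \<sigma> * c j)
      \<and> (\<forall>j<d. \<sigma> * (c j)\<^sup>2 \<le> 2 * I)"
    by (rule law.tilt_exists[OF \<alpha> \<sigma>(1) ratec]; blast)
  then obtain c where c: "\<And>j. j < d \<Longrightarrow>
      (\<integral>\<nu>. law.tilt (law.combine d \<alpha> c) \<nu> * inner_L2 (\<alpha> j) (quantile \<nu>) \<partial>P) = x j - \<sigma> * c j"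
    and c2: "\<And>j. j < d \<Longrightarrow> \<sigma> * (c j)\<^sup>2 \<le> 2 * I" by blast
  have shift: "\<bar>\<sigma> * c j\<bar> \<le> 1 / 2" if j: "j < d" for j
  proof -
    have "(\<sigma> * c j)\<^sup>2 = \<sigma> * (\<sigma> * (c j)\<^sup>2)" by (simp add: power2_eq_square)
    also have "\<dots> \<le> \<sigma> * (2 * I)" using c2[OF j] \<sigma> by (intro mult_left_mono) auto
    also have "\<dots> \<le> (1 / 2)\<^sup>2" using \<sigma>(2) by (simp add: power2_eq_square)
    finally show ?thesis using abs_le_square_iff[of "\<sigma> * c j" "1/2"] by simp
  qed
  let ?\<Lambda> = "law.log_mgf (law.combine d \<alpha> c)"
  define q where "q = (\<Sum>j<d. \<bar>c j\<bar>)"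
  have s: "0 \<le> q" unfolding q_def by (intro sum_nonneg) auto
  \<comment> \<open>The second bound keeps the loss \<open>\<delta> * q\<close> in the exponent
    below \<open>\<epsilon> / 2\<close>.\<close>
  define \<delta> where "\<delta> = min (1 / 2) (\<epsilon> / (2 * (1 + q)))"
  have "\<delta> > 0" using \<epsilon> s by (simp add: \<delta>_def add_pos_nonneg)
  moreover have "\<delta> \<le> 1 / 2" unfolding \<delta>_def by (rule min.cobounded1)
  ultimately have \<delta>: "\<delta> > 0" "\<delta> \<le> 1 / 2" .
  have "\<delta> * q \<le> \<epsilon> / (2 * (1 + q)) * q" using s by (intro mult_right_mono) (auto simp: \<delta>_def)
  also have "\<dots> \<le> \<epsilon> / 2" using s \<epsilon> by (simp add: field_simps)
  finally have \<delta>s: "\<delta> * q \<le> \<epsilon> / 2" .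
  define a where "a = (\<Sum>j<d. c j * (x j - \<sigma> * c j)) + \<delta> * q - ?\<Lambda>"
  have a: "a \<le> I + \<epsilon> / 2"
  proof -
    \<comment> \<open>The bias can only lower the exponent: it contributes
      \<open>- \<sigma> * (c j)\<^sup>2\<close>.\<close>
    have "(\<Sum>j<d. c j * (x j - \<sigma> * c j)) \<le> (\<Sum>j<d. c j * x j)"
      using \<sigma>(1) by (intro sum_mono) (simp add: right_diff_distrib mult.left_commute[of _ \<sigma>])
    then show ?thesis using ratec[of c] \<delta>s unfolding a_def by linarith
  qed
  have "\<exists>C. \<forall>n\<ge>1. (1 - C / real n) * exp (- (real n * a))
     \<le> prob {\<omega>\<in>space M. \<forall>j<d. \<bar>inner_L2 (\<alpha> j) (quantile (bary n \<omega>)) - (x j - \<sigma> * c j)\<bar> < \<delta>}"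
    unfolding a_def q_def by (rule tilted_lower_bound[OF \<alpha> \<delta>(1) c]; blast)
  then obtain C where C: "\<And>n. n \<ge> 1 \<Longrightarrow> (1 - C / real n) * exp (- (real n * a))
     \<le> prob {\<omega>\<in>space M. \<forall>j<d. \<bar>inner_L2 (\<alpha> j) (quantile (bary n \<omega>)) - (x j - \<sigma> * c j)\<bar> < \<delta>}"
    by blast
  show ?thesis
    using eventually_ge_at_top[of "nat \<lceil>max 1 (max (2 * C) (2 / \<epsilon>))\<rceil>"]
  proof eventually_elim
    case (elim n)
    then have "max 1 (max (2 * C) (2 / \<epsilon>)) \<le> real n" by linarith
    then have n: "1 \<le> real n" "2 * C \<le> real n" "2 / \<epsilon> \<le> real n" by auto
    then have n1: "n \<ge> 1" by simp
    \<comment> \<open>The condition \<open>n \<ge> 2 * C\<close> makes the prefactor at least 1/2,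
      and \<open>n \<ge> 2 / \<epsilon>\<close> brings the exponential below 1/2.\<close>
    have half: "exp (- (real n * (\<epsilon> / 2))) \<le> 1 - C / real n"
    proof -
      have "2 \<le> 1 + real n * (\<epsilon> / 2)" using n(3) \<epsilon> by (simp add: field_simps)
      also have "\<dots> \<le> exp (real n * (\<epsilon> / 2))" by (rule exp_ge_add_one_self)
      finally have "exp (- (real n * (\<epsilon> / 2))) \<le> 1 / 2" by (simp add: exp_minus field_simps)
      moreover have "C / real n \<le> 1 / 2" using n by (simp add: field_simps)
      ultimately show ?thesis by linarith
    qed
    have "exp (- (real n * (I + \<epsilon>))) = exp (- (real n * (\<epsilon> / 2))) * exp (- (real n * (I + \<epsilon> / 2)))"
      by (simp add: exp_add[symmetric] algebra_simps)
    also have "\<dots> \<le> (1 - C / real n) * exp (- (real n * a))"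
    proof (rule mult_mono[OF half])
      show "exp (- (real n * (I + \<epsilon> / 2))) \<le> exp (- (real n * a))" using a by (simp add: mult_left_mono)
      show "0 \<le> 1 - C / real n" using half by (rule order_trans[OF exp_ge_zero])
    qed simp
    also note C[OF n1]
    also have "prob {\<omega>\<in>space M. \<forall>j<d. \<bar>inner_L2 (\<alpha> j) (quantile (bary n \<omega>)) - (x j - \<sigma> * c j)\<bar> < \<delta>}
      \<le> prob {\<omega>\<in>space M. \<forall>j<d. \<bar>inner_L2 (\<alpha> j) (quantile (bary n \<omega>)) - x j\<bar> < 1}"
    proof (rule finite_measure_mono)
      show "{\<omega>\<in>space M. \<forall>j<d. \<bar>inner_L2 (\<alpha> j) (quantile (bary n \<omega>)) - (x j - \<sigma> * c j)\<bar> < \<delta>}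
        \<subseteq> {\<omega>\<in>space M. \<forall>j<d. \<bar>inner_L2 (\<alpha> j) (quantile (bary n \<omega>)) - x j\<bar> < 1}"
      proof (intro subsetI CollectI conjI allI impI)
        fix \<omega> j assume \<omega>: "\<omega> \<in> {\<omega>\<in>space M. \<forall>j<d. \<bar>inner_L2 (\<alpha> j) (quantile (bary n \<omega>)) - (x j - \<sigma> * c j)\<bar> < \<delta>}"
          and j: "j < d"
        then have "\<bar>inner_L2 (\<alpha> j) (quantile (bary n \<omega>)) - (x j - \<sigma> * c j)\<bar> < \<delta>" by simp
        then show "\<bar>inner_L2 (\<alpha> j) (quantile (bary n \<omega>)) - x j\<bar> < 1"
          using shift[OF j] \<delta>(2) unfolding abs_less_iff abs_le_iff by linarith
      qed auto
      have "{\<omega>\<in>space M. \<bar>inner_L2 (\<alpha> j) (quantile (bary n \<omega>)) - x j\<bar> < 1} \<in> sets M" if "j < d" for j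
        using inner_bary_measurable[OF n1 \<alpha>[OF that]] by measurable
      then have "{\<omega>\<in>space M. \<forall>j\<in>{..<d}. \<bar>inner_L2 (\<alpha> j) (quantile (bary n \<omega>)) - x j\<bar> < 1} \<in> sets M"
        by (intro sets.sets_Collect_finite_All) auto
      then show "{\<omega>\<in>space M. \<forall>j<d. \<bar>inner_L2 (\<alpha> j) (quantile (bary n \<omega>)) - x j\<bar> < 1} \<in> sets M"
        unfolding Ball_def lessThan_iff .
    qed
    finally show ?case unfolding x_def .
  qed
qed

text \<open>Inside a compact set, a neighbourhood of \<open>f\<close> contains a cylinder around \<open>f\<close> given by finitely
  many linear functionals, so exponential tightness reduces the bound to finite dimensions.\<close>

proposition lower_bound:
  assumes U: "openin P2_topology U" and f: "f \<in> U" and \<epsilon>: "\<epsilon> > 0"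
    and rate: "\<And>\<gamma>. \<gamma> \<in> L2_unit \<Longrightarrow> inner_L2 \<gamma> (quantile f) - law.log_mgf \<gamma> \<le> I"
  shows "\<forall>\<^sub>F n in sequentially. exp (- (real n * (I + \<epsilon>))) \<le> prob {\<omega>\<in>space M. bary n \<omega> \<in> U}"
proof -
  have fP: "f \<in> P2" using openin_subset[OF U] f by auto
  have I: "0 \<le> I" by (rule rate_bound_nonneg[OF rate])
  \<comment> \<open>Tightness is used at the level \<open>I + \<epsilon>\<close> of the claim, the
    cylinder bound at \<open>I + \<epsilon> / 2\<close>; the gap absorbs the mass outside
    \<open>K\<close>.\<close>
  have "0 \<le> I + \<epsilon>" using I \<epsilon> by simp
  then obtain K where K: "compactin P2_topology K"
    "\<And>n. n \<ge> 1 \<Longrightarrow> prob {\<omega>\<in>space M. bary n \<omega> \<notin> K} \<le> 2 * exp (- (real n * (I + \<epsilon>)))"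
    using exponentially_tight by blast
  \<comment> \<open>The direction from \<open>f\<close> to \<open>g\<close>, scaled so that the
    functional increases by 2 from \<open>f\<close> to \<open>g\<close>. Hence \<open>g\<close> lies
    in its half-space, which starts at an increase of 1, and a cylinder of radius 1 around
    \<open>f\<close> avoids all these half-spaces.\<close>
  define \<beta> where "\<beta> g u = 2 / (W2 g f)\<^sup>2 * (quantile g u - quantile f u)" for g u
  have \<beta>: "\<beta> g \<in> L2_unit" if "g \<in> P2" for g
    unfolding \<beta>_def[abs_def] L2_unit_eq using that fP by (intro L2_cmult L2_diff quantile_L2)
  let ?V = "\<lambda>g. {h\<in>P2. inner_L2 (\<beta> g) (quantile h) \<in> {inner_L2 (\<beta> g) (quantile f) + 1<..}}"
  have KU: "K - U \<subseteq> P2" using compactin_subset_topspace[OF K(1)] by auto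
  have gV: "g \<in> ?V g" if g: "g \<in> K - U" for g
  proof -
    have gP: "g \<in> P2" using g KU by auto
    have "W2 g f \<noteq> 0" using g f gP fP by auto
    have "inner_L2 (\<beta> g) (quantile g) - inner_L2 (\<beta> g) (quantile f) = (\<integral>u. \<beta> g u * (quantile g u - quantile f u) \<partial>UI)"
      using \<beta>[OF gP] gP fP unfolding L2_unit_eq
      by (simp add: inner_L2_eq right_diff_distrib L2_mult_integrable quantile_L2)
    also have "\<dots> = 2 / (W2 g f)\<^sup>2 * (\<integral>u. (quantile g u - quantile f u)\<^sup>2 \<partial>UI)"
      unfolding \<beta>_def by (simp only: mult.assoc power2_eq_square integral_mult_right_zero)
    also have "(\<integral>u. (quantile g u - quantile f u)\<^sup>2 \<partial>UI) = (W2 g f)\<^sup>2"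
      using gP fP by (simp add: W2_eq_L2_norm L2_norm_power2)
    also have "2 / (W2 g f)\<^sup>2 * (W2 g f)\<^sup>2 = 2" using \<open>W2 g f \<noteq> 0\<close> by simp
    finally show ?thesis using gP by simp
  qed
  have "closedin P2_topology (topspace P2_topology - U)" using U by (rule closedin_diff[OF closedin_topspace])
  then have "compactin P2_topology ((topspace P2_topology - U) \<inter> K)" by (rule closed_Int_compactin[OF _ K(1)])
  moreover have "(topspace P2_topology - U) \<inter> K = K - U" using KU compactin_subset_topspace[OF K(1)] by auto
  ultimately have "compactin P2_topology (K - U)" by simp
  moreover have "\<And>T. T \<in> ?V ` (K - U) \<Longrightarrow> openin P2_topology T"
    using openin_inner_L2[OF _ open_greaterThan] \<beta> KU by blast
  moreover have "K - U \<subseteq> \<Union>(?V ` (K - U))" using gV by blast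
  ultimately obtain F where F: "finite F" "F \<subseteq> ?V ` (K - U)" "K - U \<subseteq> \<Union>F"
    using compactinD[of P2_topology "K - U" "?V ` (K - U)"] by blast
  obtain A where "A \<subseteq> K - U" "finite A" "F = ?V ` A" using finite_subset_image[OF F(1,2)] by blast
  with F(3) have A: "A \<subseteq> K - U" "finite A" "K - U \<subseteq> \<Union>(?V ` A)" by simp_all
  obtain xs where xs: "set xs = A" using finite_list[OF A(2)] by blast
  define \<alpha> where "\<alpha> j = \<beta> (xs ! j)" for j
  have \<alpha>: "\<alpha> j \<in> L2_unit" if "j < length xs" for j
    unfolding \<alpha>_def using that xs A KU by (intro \<beta>) (metis nth_mem subsetD)
  have e2: "\<epsilon> / 2 > 0" using \<epsilon> by simp
  have "\<forall>\<^sub>F n in sequentially. exp (- (real n * (I + \<epsilon> / 2)))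
    \<le> prob {\<omega>\<in>space M. \<forall>j<length xs. \<bar>inner_L2 (\<alpha> j) (quantile (bary n \<omega>)) - inner_L2 (\<alpha> j) (quantile f)\<bar> < 1}"
    by (rule cylinder_lower_bound[OF \<alpha> fP e2 rate])
  then show ?thesis
    using eventually_ge_at_top[of "nat \<lceil>max 1 (4 / \<epsilon>)\<rceil>"]
  proof eventually_elim
    case (elim n)
    then have "max 1 (4 / \<epsilon>) \<le> real n" by linarith
    then have n: "n \<ge> 1" "4 / \<epsilon> \<le> real n" by auto
    let ?C = "{\<omega>\<in>space M. \<forall>j<length xs. \<bar>inner_L2 (\<alpha> j) (quantile (bary n \<omega>)) - inner_L2 (\<alpha> j) (quantile f)\<bar> < 1}"
    let ?N = "{\<omega>\<in>space M. bary n \<omega> \<notin> K}" and ?U = "{\<omega>\<in>space M. bary n \<omega> \<in> U}"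
    have Us: "?U \<in> sets M" by (intro bary_sets n law.openin_sets_P U)
    have Ns: "?N \<in> sets M"
    proof -
      have "{\<omega>\<in>space M. bary n \<omega> \<in> K} \<in> sets M"
        using compactin_P2_sets[OF K(1)] by (intro bary_sets n) (simp add: law.sets_P)
      from sets.compl_sets[OF this] show ?thesis by (rule back_subst[of "\<lambda>x. x \<in> sets M"]) auto
    qed
    have "?C \<subseteq> ?U \<union> ?N"
    proof
      fix \<omega> assume \<omega>: "\<omega> \<in> ?C"
      show "\<omega> \<in> ?U \<union> ?N"
      proof (rule ccontr)
        assume "\<omega> \<notin> ?U \<union> ?N"
        then have "bary n \<omega> \<in> K - U" using \<omega> by auto
        then obtain g where g: "g \<in> A" "bary n \<omega> \<in> ?V g" using A(3) by blast
        then obtain j where j: "j < length xs" "g = xs ! j" using xs by (metis in_set_conv_nth)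
        have "\<bar>inner_L2 (\<alpha> j) (quantile (bary n \<omega>)) - inner_L2 (\<alpha> j) (quantile f)\<bar> < 1" using \<omega> j by simp
        then show False using g j unfolding \<alpha>_def by auto
      qed
    qed
    then have "prob ?C \<le> prob (?U \<union> ?N)" using Us Ns by (intro finite_measure_mono) auto
    also have "\<dots> \<le> prob ?U + prob ?N" using Us Ns by (intro measure_Un_le) auto
    finally have le: "exp (- (real n * (I + \<epsilon> / 2))) \<le> prob ?U + 2 * exp (- (real n * (I + \<epsilon>)))"
      using elim(1) K(2)[OF n(1)] by linarith
    \<comment> \<open>Of the factor 3, two units pay for the mass outside \<open>K\<close> and one
      remains as the claimed bound.\<close>
    have "3 \<le> 1 + real n * (\<epsilon> / 2)" using n(2) \<epsilon> by (simp add: field_simps)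
    also have "\<dots> \<le> exp (real n * (\<epsilon> / 2))" by (rule exp_ge_add_one_self)
    finally have "3 * exp (- (real n * (I + \<epsilon>))) \<le> exp (real n * (\<epsilon> / 2)) * exp (- (real n * (I + \<epsilon>)))"
      by (intro mult_right_mono) auto
    also have "\<dots> = exp (- (real n * (I + \<epsilon> / 2)))" by (simp add: exp_add[symmetric] algebra_simps)
    finally show ?case using le by linarith
  qed
qed

end

section \<open>Logarithmic asymptotics\<close>

lemma elog_ennreal: "0 < p \<Longrightarrow> elog (ennreal p) = ereal (ln p)"
  by (simp add: elog_def)

lemma limsup_elog_le:
  fixes p :: "nat \<Rightarrow> real"
  assumes C: "C > 0" and p: "\<And>n. 0 \<le> p n" "\<And>n. n \<ge> 1 \<Longrightarrow> p n \<le> C * exp (- (real n * c))"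
  shows "limsup (\<lambda>n. ereal (1 / real n) * elog (ennreal (p n))) \<le> - ereal c"
proof -
  have "(\<lambda>n. ln C * (1 / real n) - c) \<longlonglongrightarrow> ln C * 0 - c" by (intro tendsto_intros lim_1_over_n)
  then have "(\<lambda>n. ereal (ln C * (1 / real n) - c)) \<longlonglongrightarrow> ereal (- c)" by simp
  then have "limsup (\<lambda>n. ereal (ln C * (1 / real n) - c)) = ereal (- c)"
    by (rule lim_imp_Limsup[OF trivial_limit_sequentially])
  moreover have "\<forall>\<^sub>F n in sequentially. ereal (1 / real n) * elog (ennreal (p n)) \<le> ereal (ln C * (1 / real n) - c)"
    using eventually_ge_at_top[of 1]
  proof eventually_elim
    case (elim n)
    show ?case
    proof (cases "p n = 0")
      case True
      then show ?thesis using elim by (simp add: elog_def)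
    next
      case False
      then have pos: "0 < p n" using p(1)[of n] by simp
      then have "ln (p n) \<le> ln (C * exp (- (real n * c)))" using p(2)[OF elim] by (intro ln_mono) auto
      also have "\<dots> = ln C - real n * c" using C by (simp add: ln_mult)
      finally have "1 / real n * ln (p n) \<le> 1 / real n * (ln C - real n * c)" by (intro mult_left_mono) auto
      also have "\<dots> = ln C * (1 / real n) - c" using elim by (simp add: field_simps)
      finally show ?thesis using pos by (simp add: elog_ennreal)
    qed
  qed
  ultimately show ?thesis using Limsup_mono by fastforce
qed

lemma liminf_elog_ge:
  fixes p :: "nat \<Rightarrow> real"
  assumes "\<forall>\<^sub>F n in sequentially. exp (- (real n * c)) \<le> p n"
  shows "- ereal c \<le> liminf (\<lambda>n. ereal (1 / real n) * elog (ennreal (p n)))"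
proof (rule Liminf_bounded)
  show "\<forall>\<^sub>F n in sequentially. - ereal c \<le> ereal (1 / real n) * elog (ennreal (p n))"
    using assms eventually_ge_at_top[of 1]
  proof eventually_elim
    case (elim n)
    then have pos: "0 < p n" by (meson exp_gt_zero less_le_trans)
    have "ln (exp (- (real n * c))) \<le> ln (p n)" using elim pos by (intro ln_mono) auto
    then have "1 / real n * (- (real n * c)) \<le> 1 / real n * ln (p n)" by (intro mult_left_mono) auto
    then show ?case using elim pos by (simp add: elog_ennreal)
  qed
qed

lemma ereal_le_uminus_swap: "a \<le> - b \<Longrightarrow> b \<le> - a" for a b :: ereal
  using ereal_minus_le_minus[of "- b" a] by simp

section \<open>The large deviations principle\<close>

lemma Wac_topology_eq: "Wac_topology = subtopology P2_topology Wac"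
proof -
  interpret Submetric P2 W2 Wac
    by unfold_locales (rule Wac_subset_P2)
  show ?thesis unfolding Wac_topology_def P2_topology_def by (rule mtopology_submetric)
qed

lemma topspace_Wac: "topspace Wac_topology = Wac"
  unfolding Wac_topology_eq using Wac_subset_P2 by auto

context wasserstein_sample
begin

text \<open>Since \<open>Wac\<close> is itself measurable for \<open>P\<close>, so are traces of
  open sets and complements relative to \<open>Wac\<close>.\<close>

lemma borel_of_Wac_sets:
  assumes "E \<in> sets (borel_of Wac_topology)"
  shows "E \<in> sets P" "E \<subseteq> Wac"
proof -
  have "E \<in> sigma_sets Wac {U. openin Wac_topology U}" using assms by (simp add: sets_borel_of topspace_Wac)
  then show "E \<in> sets P"
  proof induction
    case (Basic U)
    then obtain V where "openin P2_topology V" "U = V \<inter> Wac" by (auto simp: Wac_topology_eq openin_subtopology)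
    then show ?case using law.openin_sets_P law.Wac_sets by auto
  qed auto
  show "E \<subseteq> Wac" using sets.sets_into_space[OF assms] by (simp add: space_borel_of topspace_Wac)
qed

text \<open>The rate is a supremum of continuous functionals, so a sublevel set is the trace on
  \<open>Wac\<close> of an intersection of closed half-spaces of \<open>P2\<close>.\<close>

lemma rate_function_I_rate: "rate_function Wac_topology (I_rate P)"
  unfolding rate_function_def
proof (intro conjI ballI allI)
  fix c :: real
  let ?H = "\<lambda>\<alpha>. {\<mu>\<in>P2. inner_L2 \<alpha> (quantile \<mu>) \<in> {c + law.log_mgf \<alpha><..}}"
  have "openin P2_topology (\<Union>(?H ` L2_unit))"
    using openin_inner_L2[OF _ open_greaterThan] by (intro openin_Union) blast
  then have "closedin P2_topology (P2 - \<Union>(?H ` L2_unit))"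
    using closedin_diff[OF closedin_topspace] by fastforce
  moreover have "{\<mu>\<in>topspace Wac_topology. I_rate P \<mu> \<le> ereal c} = (P2 - \<Union>(?H ` L2_unit)) \<inter> Wac"
    using Wac_subset_P2 by (auto simp: topspace_Wac law.I_rate_eq SUP_le_iff not_less algebra_simps)
  ultimately show "closedin Wac_topology {\<mu>\<in>topspace Wac_topology. I_rate P \<mu> \<le> ereal c}"
    unfolding Wac_topology_eq closedin_subtopology by blast
qed (rule law.I_rate_nonneg)

theorem large_deviations: "satisfies_LDP M Wac_topology bary (I_rate P)"
  unfolding satisfies_LDP_def
proof (intro conjI ballI rate_function_I_rate)
  fix E assume E: "E \<in> sets (borel_of Wac_topology)"
  note EP = borel_of_Wac_sets(1)[OF E] and EW = borel_of_Wac_sets(2)[OF E]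
  let ?p = "\<lambda>n. prob {\<omega>\<in>space M. bary n \<omega> \<in> E}"
  let ?L = "\<lambda>n. ereal (1 / real n) * elog (emeasure M {\<omega>\<in>space M. bary n \<omega> \<in> E})"
  have L: "?L = (\<lambda>n. ereal (1 / real n) * elog (ennreal (?p n)))" by (simp add: emeasure_eq_measure)
  show "liminf ?L \<le> limsup ?L" by (rule Liminf_le_Limsup) simp
  show "- (INF \<mu>\<in>Wac_topology interior_of E. I_rate P \<mu>) \<le> liminf ?L"
  proof -
    have "- liminf ?L \<le> I_rate P \<mu>" if \<mu>: "\<mu> \<in> Wac_topology interior_of E" for \<mu>
    proof (cases "I_rate P \<mu>")
      case (real I)
      \<comment> \<open>The open set \<open>G\<close> of \<open>P2\<close> need not lie in
        \<open>E\<close>; only its trace on \<open>Wac\<close> does, which is enough because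
        barycenters are almost surely in \<open>Wac\<close>.\<close>
      obtain G where G: "openin P2_topology G" "Wac_topology interior_of E = G \<inter> Wac"
        using openin_interior_of[of Wac_topology E] unfolding Wac_topology_eq openin_subtopology by blast
      have rate: "inner_L2 \<gamma> (quantile \<mu>) - law.log_mgf \<gamma> \<le> I" if "\<gamma> \<in> L2_unit" for \<gamma>
      proof -
        have "ereal (inner_L2 \<gamma> (quantile \<mu>) - law.log_mgf \<gamma>) \<le> I_rate P \<mu>"
          unfolding law.I_rate_eq using that by (rule SUP_upper)
        then show ?thesis using real by simp
      qed
      have "- ereal (I + \<epsilon>) \<le> liminf ?L" if \<epsilon>: "\<epsilon> > 0" for \<epsilon>
        unfolding L
      proof (rule liminf_elog_ge)
        have "\<forall>\<^sub>F n in sequentially. exp (- (real n * (I + \<epsilon>))) \<le> prob {\<omega>\<in>space M. bary n \<omega> \<in> G}"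
          using \<mu> G by (intro lower_bound[OF G(1) _ \<epsilon> rate]) auto
        then show "\<forall>\<^sub>F n in sequentially. exp (- (real n * (I + \<epsilon>))) \<le> ?p n"
          using eventually_ge_at_top[of 1]
        proof eventually_elim
          case (elim n)
          have "prob {\<omega>\<in>space M. bary n \<omega> \<in> G} \<le> ?p n"
          proof (rule finite_measure_mono_AE)
            show "AE \<omega> in M. \<omega> \<in> {\<omega>\<in>space M. bary n \<omega> \<in> G} \<longrightarrow> \<omega> \<in> {\<omega>\<in>space M. bary n \<omega> \<in> E}"
              using AE_bary_Wac[OF elim(2)]
            proof eventually_elim
              case (elim \<omega>)
              then show ?case using G(2) interior_of_subset[of Wac_topology E] by blast
            qed
          qed (rule bary_sets[OF elim(2) EP])
          then show ?case using elim(1) by linarith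
        qed
      qed
      then have le: "- liminf ?L \<le> ereal I + ereal \<epsilon>" if "\<epsilon> > 0" for \<epsilon>
        using that by (simp add: ereal_uminus_le_reorder)
      show ?thesis unfolding real by (rule ereal_le_epsilon2) (rule le)
    next
      case MInf
      then show ?thesis using law.I_rate_nonneg[of \<mu>] by simp
    qed simp
    then have "- liminf ?L \<le> (INF \<mu>\<in>Wac_topology interior_of E. I_rate P \<mu>)" by (intro INF_greatest)
    then show ?thesis by (simp only: ereal_uminus_le_reorder)
  qed
  show "limsup ?L \<le> - (INF \<mu>\<in>Wac_topology closure_of E. I_rate P \<mu>)"
  proof -
    have "(INF \<mu>\<in>Wac_topology closure_of E. I_rate P \<mu>) \<le> - limsup ?L"
    proof (rule dense_le)
      \<comment> \<open>Testing every \<open>x\<close> below the infimum treats finite and infinite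
        infima alike.\<close>
      fix x assume x: "x < (INF \<mu>\<in>Wac_topology closure_of E. I_rate P \<mu>)"
      show "x \<le> - limsup ?L"
      proof (cases x)
        case (real c)
        \<comment> \<open>The two closures differ only outside \<open>Wac\<close>: a point of
          \<open>Wac\<close> in the closure in \<open>P2\<close> is in the relative closure and has
          rate above \<open>c\<close>, while elsewhere the rate is infinite.\<close>
        have "\<exists>\<alpha>\<in>L2_unit. c < inner_L2 \<alpha> (quantile \<mu>) - law.log_mgf \<alpha>" if \<mu>: "\<mu> \<in> P2_topology closure_of E" for \<mu>
        proof (rule law.rate_test_function)
          show "\<mu> \<in> P2" using \<mu> closure_of_subset_topspace[of P2_topology E] by auto
          assume "\<mu> \<in> Wac"
          then have \<mu>W: "\<mu> \<in> Wac_topology closure_of E"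
            using \<mu> EW unfolding Wac_topology_eq closure_of_subtopology by (simp add: Int_absorb1)
          show "ereal c < I_rate P \<mu>" using less_le_trans[OF x INF_lower[OF \<mu>W]] unfolding real .
        qed
        then obtain C where "C > 0" "\<And>n. n \<ge> 1 \<Longrightarrow> ?p n \<le> C * exp (- (real n * c))"
          using upper_bound[OF EP] by blast
        then have "limsup ?L \<le> - ereal c" unfolding L by (intro limsup_elog_le) auto
        then show ?thesis unfolding real by (rule ereal_le_uminus_swap)
      qed (use x in auto)
    qed
    then show ?thesis by (rule ereal_le_uminus_swap)
  qed
qed

end

theorem mainTheorem7:
  fixes P :: "real measure measure"
    and M :: "'w measure"
    and \<nu> :: "nat \<Rightarrow> 'w \<Rightarrow> real measure"
  assumes "prob_space P"
    and "sets P = sets (borel_of P2_topology)"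
    and "\<exists>\<mu> \<in> P2. \<exists>l::real. l > 0 \<and> (\<integral>\<^sup>+\<rho>. ennreal (exp (l * (W2 \<mu> \<rho>)\<^sup>2)) \<partial>P) < \<infinity>"
    and "measure P Wac = 1"
    and "prob_space M"
    and "prob_space.indep_vars M (\<lambda>_. P) \<nu> {1..}"
    and "\<And>i. i \<ge> 1 \<Longrightarrow> distr M P (\<nu> i) = P"
  shows "satisfies_LDP M Wac_topology (\<lambda>n \<omega>. barycenter n (\<lambda>i. \<nu> i \<omega>)) (I_rate P)"
proof -
  have law: "wasserstein_law P"
    using assms by (intro wasserstein_law.intro wasserstein_law_axioms.intro) auto
  have "wasserstein_sample P M \<nu>"
    using assms law by (intro wasserstein_sample.intro wasserstein_sample_axioms.intro) auto
  then show ?thesis by (rule wasserstein_sample.large_deviations)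
qed

end
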